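(* Assume that (VD), (PI$_p(p\theta_p)$) and (cap$_p(p\theta_p)_{\le}$) hold for some $\theta_p\ge1$. Then there exists $C\in[1,\infty)$ such that for any open subset $\Omega$ of $X$ satisfying the extension property (E) and any $u\in\mathcal{F}_p(\Omega)$, $$C^{-1}\Gamma_p\langle u\rangle(\Omega)\le\liminf_{\theta\uparrow\theta_p}(\theta_p-\theta)\int_\Omega\int_\Omega\frac{|u(x)-u(y)|^p}{d(x,y)^{p\theta}m(B(y,d(x,y)))}\,m(dx)\,m(dy)$$ $$\le\limsup_{\theta\uparrow\theta_p}(\theta_p-\theta)\int_\Omega\int_\Omega\frac{|u(x)-u(y)|^p}{d(x,y)^{p\theta}m(B(y,d(x,y)))}\,m(dx)\,m(dy)\le C\,\Gamma_p\langle u\rangle(\Omega).$$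
   Context: **Setting.** $(X,d)$ is a locally compact, separable, complete metric space with at least two points, $m$ is a Radon measure on $X$ with full topological support, and $p\in(1,\infty)$. $B(x,r)=\{y\in X: d(x,y)<r\}$; $u_A=\frac1{m(A)}\int_A u\,dm$; $C_c(X)$ is the set of compactly supported continuous functions on $X$; $\mathbf{1}_A$ is the indicator function of $A$. $\mathcal{F}_p$ is a linear subspace of $L^p(X,m)$, $\mathcal{E}_p:\mathcal{F}_p\to[0,\infty)$ is such that $\mathcal{E}_p^{1/p}$ is a seminorm on $\mathcal{F}_p$, and $\{\Gamma_p\langle u\rangle\}_{u\in\mathcal{F}_p}$ is a family of finite Borel measures on $X$ such that: (1) for any $u\in\mathcal{F}_p$ and any $1$-Lipschitz $\varphi:\mathbb{R}\to\mathbb{R}$ with $\varphi(0)=0$, $\varphi(u)\in\mathcal{F}_p$ and $\mathcal{E}_p(\varphi(u))\le\mathcal{E}_p(u)$; and $\mathcal{E}_p^{-1}(0)\subset\mathbb{R}\mathbf{1}_X$; (2) $\mathcal{F}_p$ with the norm $\|\cdot\|_{L^p(X,m)}+\mathcal{E}_p(\cdot)^{1/p}$ is a reflexive Banach space; (3) $\mathcal{F}_p\cap C_c(X)$ is dense in $\mathcal{F}_p$ and is dense in $C_c(X)$ with respect to the uniform norm; (4) for any Borel $A\subset X$, $u\mapsto\Gamma_p\langle u\rangle(A)^{1/p}$ is a seminorm on $\mathcal{F}_p$; (5) $\mathcal{E}_p(u)=\Gamma_p\langle u\rangle(X)$ for any $u\in\mathcal{F}_p$; (6) if $u,v\in\mathcal{F}_p\cap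 C_c(X)$, $U\subset X$ is open and $(u-v)|_U$ is constant, then $\Gamma_p\langle u\rangle|_U=\Gamma_p\langle v\rangle|_U$ (restrictions to Borel subsets of $U$). **(VD)**: there is $c_{\mathrm D}\in[1,\infty)$ with $m(B(x,2r))\le c_{\mathrm D}m(B(x,r))$ for all $x\in X$, $r>0$. **(PI$_p(\beta)$)**, $\beta\in(0,\infty)$: there are $C_{\mathrm P}\in(0,\infty)$, $A_{\mathrm P}\in[1,\infty)$ such that for all $x\in X$, $r>0$, $u\in\mathcal{F}_p$: $\int_{B(x,r)}|u-u_{B(x,r)}|^p\,dm\le C_{\mathrm P}r^\beta\,\Gamma_p\langle u\rangle(B(x,A_{\mathrm P}r))$. **(cap$_p(\beta)_{\le}$)**: there are $C_{\mathrm{cap}},A_{\mathrm{cap},1},A_{\mathrm{cap},2}\in(1,\infty)$ such that for all $x\in X$ and $0<R<\operatorname{diam}(X,d)/A_{\mathrm{cap},2}$: $\inf\{\mathcal{E}_p(u): u\in\mathcal{F}_p,\ u=1\ m\text{-a.e. on }B(x,R),\ u=0\ m\text{-a.e. on }X\setminus B(x,A_{\mathrm{cap},1}R)\}\le C_{\mathrm{cap}}\,m(B(x,R))/R^\beta$. **Local spaces.** For a non-empty open $U\subset X$, $\mathcal{F}_{p,\mathrm{loc}}(U)$ is the set of ($m$-equivalence classes of) real-valued Borel functions $u$ on $U$ such that for each relatively compact open subset $A$ of $U$ there is $u^\#\in\mathcal{F}_p$ with $u=u^\#$ $m$-a.e. on $A$. For $u\in\mathcal{F}_{p,\mathrm{loc}}(U)$,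 the Radon measure $\Gamma_{p,U}\langle u\rangle$ on $U$ is given by $\Gamma_{p,U}\langle u\rangle(E)=\Gamma_p\langle u^\#\rangle(E)$ for relatively compact Borel $E$ in $U$ (where $A$ is any relatively compact open subset of $U$ with $E\subset A$ and $u^\#\in\mathcal{F}_p$ is any function with $u=u^\#$ $m$-a.e. on $A$; the value is independent of these choices), extended by monotone limits along exhaustions of $U$ by relatively compact open subsets. We also write $\Gamma_p\langle u\rangle$ for $\Gamma_{p,U}\langle u\rangle$. $\mathcal{F}_p(U)=\{u\in\mathcal{F}_{p,\mathrm{loc}}(U):\int_U|u|^p\,dm+\Gamma_{p,U}\langle u\rangle(U)<\infty\}$. **Extension property (E).** An open $\Omega\subset X$ with $\Omega\ne X$ satisfies (E) if for any $f\in\mathcal{F}_p(\Omega)$ there is $F\in\mathcal{F}_p$ with $f=F$ $m$-a.e. on $\Omega$ and $\Gamma_p\langle F\rangle(\partial\Omega)=0$. Integrands with $d(x,y)$ in a denominator are understood for $x\ne y$. *)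

theory Defs
  imports "HOL-Analysis.Analysis"
begin

text \<open>
  The metric space is the universe of a type of class \<open>polish_space\<close>, i.e. a complete separable
  metric space. Elements of function spaces are functions rather than \<open>m\<close>-equivalence classes;
  a set of equivalence classes is represented by the set of all their Borel representatives.
\<close>

section \<open>Seminormed spaces of functions\<close>

definition fun_subspace :: "('b \<Rightarrow> real) set \<Rightarrow> bool" where
  "fun_subspace V \<longleftrightarrow>
     (\<lambda>x. 0) \<in> V \<and>
     (\<forall>u\<in>V. \<forall>v\<in>V. (\<lambda>x. u x + v x) \<in> V) \<and>
     (\<forall>c. \<forall>u\<in>V. (\<lambda>x. c * u x) \<in> V)"

definition seminorm_on :: "('b \<Rightarrow> real) set \<Rightarrow> (('b \<Rightarrow> real) \<Rightarrow> real) \<Rightarrow> bool" where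
  "seminorm_on V N \<longleftrightarrow>
     (\<forall>u\<in>V. 0 \<le> N u) \<and>
     (\<forall>c. \<forall>u\<in>V. N (\<lambda>x. c * u x) = \<bar>c\<bar> * N u) \<and>
     (\<forall>u\<in>V. \<forall>v\<in>V. N (\<lambda>x. u x + v x) \<le> N u + N v)"

definition complete_wrt :: "('b \<Rightarrow> real) set \<Rightarrow> (('b \<Rightarrow> real) \<Rightarrow> real) \<Rightarrow> bool" where
  "complete_wrt V N \<longleftrightarrow>
     (\<forall>s. (\<forall>n::nat. s n \<in> V) \<and>
          (\<forall>e>0. \<exists>M. \<forall>i\<ge>M. \<forall>j\<ge>M. N (\<lambda>x. s i x - s j x) < e) \<longrightarrow>
          (\<exists>u\<in>V. (\<lambda>n. N (\<lambda>x. s n x - u x)) \<longlonglongrightarrow> 0))"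

text \<open>Functionals are extended by \<open>0\<close> outside \<open>V\<close>, so that each one has a single representative.\<close>

definition dual_space :: "('b \<Rightarrow> real) set \<Rightarrow> (('b \<Rightarrow> real) \<Rightarrow> real) \<Rightarrow> (('b \<Rightarrow> real) \<Rightarrow> real) set" where
  "dual_space V N =
     {\<phi>. (\<forall>u\<in>V. \<forall>v\<in>V. \<phi> (\<lambda>x. u x + v x) = \<phi> u + \<phi> v) \<and>
         (\<forall>c. \<forall>u\<in>V. \<phi> (\<lambda>x. c * u x) = c * \<phi> u) \<and>
         (\<exists>K. \<forall>u\<in>V. \<bar>\<phi> u\<bar> \<le> K * N u) \<and>
         (\<forall>u. u \<notin> V \<longrightarrow> \<phi> u = 0)}"

definition dual_norm :: "('b \<Rightarrow> real) set \<Rightarrow> (('b \<Rightarrow> real) \<Rightarrow> real) \<Rightarrow> (('b \<Rightarrow> real) \<Rightarrow> real) \<Rightarrow> real" where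
  "dual_norm V N \<phi> = (SUP u\<in>{u\<in>V. N u \<le> 1}. \<bar>\<phi> u\<bar>)"

text \<open>Reflexivity: the canonical map from \<open>V\<close> into its bidual is onto.\<close>

definition reflexive_wrt :: "('b \<Rightarrow> real) set \<Rightarrow> (('b \<Rightarrow> real) \<Rightarrow> real) \<Rightarrow> bool" where
  "reflexive_wrt V N \<longleftrightarrow>
     (\<forall>\<Psi> \<in> dual_space (dual_space V N) (dual_norm V N).
        \<exists>u\<in>V. \<forall>\<phi>\<in>dual_space V N. \<Psi> \<phi> = \<phi> u)"

section \<open>Measures and function spaces on a metric space\<close>

definition radon_measure :: "'a::metric_space measure \<Rightarrow> bool" where
  "radon_measure m \<longleftrightarrow>
     sets m = sets borel \<and>
     (\<forall>K. compact K \<longrightarrow> emeasure m K < \<infinity>) \<and>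
     (\<forall>A\<in>sets borel. emeasure m A = (INF U\<in>{U. open U \<and> A \<subseteq> U}. emeasure m U)) \<and>
     (\<forall>U. open U \<longrightarrow> emeasure m U = (SUP K\<in>{K. compact K \<and> K \<subseteq> U}. emeasure m K))"

definition full_support :: "'a::metric_space measure \<Rightarrow> bool" where
  "full_support m \<longleftrightarrow> (\<forall>U. open U \<and> U \<noteq> {} \<longrightarrow> 0 < emeasure m U)"

definition Lp_space :: "'a::metric_space measure \<Rightarrow> real \<Rightarrow> ('a \<Rightarrow> real) set" where
  "Lp_space m p = {u \<in> borel_measurable m. integrable m (\<lambda>x. \<bar>u x\<bar> powr p)}"

definition Lp_norm :: "'a::metric_space measure \<Rightarrow> real \<Rightarrow> ('a \<Rightarrow> real) \<Rightarrow> real" where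
  "Lp_norm m p u = (\<integral>x. \<bar>u x\<bar> powr p \<partial>m) powr (1 / p)"

definition Cc :: "('a::metric_space \<Rightarrow> real) set" where
  "Cc = {u. continuous_on UNIV u \<and> compact (closure {x. u x \<noteq> 0})}"

definition mean_value :: "'a::metric_space measure \<Rightarrow> 'a set \<Rightarrow> ('a \<Rightarrow> real) \<Rightarrow> real" where
  "mean_value m A u = (1 / measure m A) * (LINT x:A|m. u x)"

definition ediameter :: "'a::metric_space set \<Rightarrow> ennreal" where
  "ediameter S = (SUP x\<in>S. SUP y\<in>S. ennreal (dist x y))"

section \<open>The energy and its energy measures\<close>

definition energy_norm ::
  "'a::metric_space measure \<Rightarrow> real \<Rightarrow> (('a \<Rightarrow> real) \<Rightarrow> real) \<Rightarrow> ('a \<Rightarrow> real) \<Rightarrow> real" where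
  "energy_norm m p \<E> u = Lp_norm m p u + \<E> u powr (1 / p)"

text \<open>
  The assumptions \<open>F_ae\<close>, \<open>E_ae\<close> and \<open>Gamma_ae\<close> say that \<open>F\<close>, \<open>\<E>\<close> and \<open>\<Gamma>\<close> live on \<open>m\<close>-equivalence
  classes.
\<close>

locale p_energy_space =
  fixes m :: "'a::polish_space measure"
    and p :: real
    and F :: "('a \<Rightarrow> real) set"
    and \<E> :: "('a \<Rightarrow> real) \<Rightarrow> real"
    and \<Gamma> :: "('a \<Rightarrow> real) \<Rightarrow> 'a measure"
  assumes two_points: "\<exists>x y :: 'a. x \<noteq> y"
    and locally_compact: "locally compact (UNIV :: 'a set)"
    and m_radon: "radon_measure m"
    and m_full_support: "full_support m"
    and p_gt_1: "1 < p"
    and F_Lp: "F \<subseteq> Lp_space m p"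
    and F_subspace: "fun_subspace F"
    and F_ae: "\<lbrakk>u \<in> F; v \<in> borel_measurable m; AE x in m. u x = v x\<rbrakk> \<Longrightarrow> v \<in> F"
    and E_ae: "\<lbrakk>u \<in> F; v \<in> F; AE x in m. u x = v x\<rbrakk> \<Longrightarrow> \<E> u = \<E> v"
    and E_nonneg: "u \<in> F \<Longrightarrow> 0 \<le> \<E> u"
    and E_seminorm: "seminorm_on F (\<lambda>u. \<E> u powr (1 / p))"
    and Gamma_ae: "\<lbrakk>u \<in> F; v \<in> F; AE x in m. u x = v x\<rbrakk> \<Longrightarrow> \<Gamma> u = \<Gamma> v"
    and Gamma_borel: "u \<in> F \<Longrightarrow> sets (\<Gamma> u) = sets borel"
    and Gamma_finite: "u \<in> F \<Longrightarrow> finite_measure (\<Gamma> u)"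
    and contraction:
      "\<lbrakk>u \<in> F; 1-lipschitz_on UNIV \<phi>; \<phi> 0 = 0\<rbrakk>
        \<Longrightarrow> (\<lambda>x. \<phi> (u x)) \<in> F \<and> \<E> (\<lambda>x. \<phi> (u x)) \<le> \<E> u"
    and E_zero: "\<lbrakk>u \<in> F; \<E> u = 0\<rbrakk> \<Longrightarrow> \<exists>c. AE x in m. u x = c"
    and banach: "complete_wrt F (energy_norm m p \<E>)"
    and reflexive: "reflexive_wrt F (energy_norm m p \<E>)"
    and dense_F:
      "\<lbrakk>u \<in> F; 0 < e\<rbrakk> \<Longrightarrow> \<exists>v \<in> F \<inter> Cc. energy_norm m p \<E> (\<lambda>x. u x - v x) < e"
    and dense_Cc:
      "\<lbrakk>u \<in> Cc; 0 < e\<rbrakk> \<Longrightarrow> \<exists>v \<in> F \<inter> Cc. \<forall>x. \<bar>u x - v x\<bar> < e"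
    and Gamma_seminorm:
      "A \<in> sets borel \<Longrightarrow> seminorm_on F (\<lambda>u. measure (\<Gamma> u) A powr (1 / p))"
    and E_eq_Gamma: "u \<in> F \<Longrightarrow> \<E> u = measure (\<Gamma> u) UNIV"
    and Gamma_local:
      "\<lbrakk>u \<in> F \<inter> Cc; v \<in> F \<inter> Cc; open U; \<exists>c. \<forall>x\<in>U. u x - v x = c; A \<in> sets borel; A \<subseteq> U\<rbrakk>
        \<Longrightarrow> emeasure (\<Gamma> u) A = emeasure (\<Gamma> v) A"

definition volume_doubling :: "'a::metric_space measure \<Rightarrow> bool" where
  "volume_doubling m \<longleftrightarrow>
     (\<exists>c\<ge>1. \<forall>x r. 0 < r \<longrightarrow> emeasure m (ball x (2 * r)) \<le> ennreal c * emeasure m (ball x r))"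

definition poincare_ineq ::
  "'a::metric_space measure \<Rightarrow> real \<Rightarrow> ('a \<Rightarrow> real) set \<Rightarrow> (('a \<Rightarrow> real) \<Rightarrow> 'a measure) \<Rightarrow> real \<Rightarrow> bool" where
  "poincare_ineq m p F \<Gamma> \<beta> \<longleftrightarrow>
     (\<exists>C>0. \<exists>A\<ge>1. \<forall>x r. \<forall>u\<in>F. 0 < r \<longrightarrow>
        (\<integral>\<^sup>+y\<in>ball x r. ennreal (\<bar>u y - mean_value m (ball x r) u\<bar> powr p) \<partial>m)
          \<le> ennreal (C * r powr \<beta>) * emeasure (\<Gamma> u) (ball x (A * r)))"

text \<open>The infimum is taken in \<open>ennreal\<close>, so it is \<open>\<infinity>\<close> if there is no competitor.\<close>

definition capacity_upper ::
  "'a::metric_space measure \<Rightarrow> ('a \<Rightarrow> real) set \<Rightarrow> (('a \<Rightarrow> real) \<Rightarrow> real) \<Rightarrow> real \<Rightarrow> bool" where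
  "capacity_upper m F \<E> \<beta> \<longleftrightarrow>
     (\<exists>C>1. \<exists>A1>1. \<exists>A2>1. \<forall>x R.
        0 < R \<and> ennreal R < ediameter (UNIV :: 'a set) / ennreal A2 \<longrightarrow>
        (INF u\<in>{u\<in>F. (AE y in m. y \<in> ball x R \<longrightarrow> u y = 1) \<and>
                      (AE y in m. y \<notin> ball x (A1 * R) \<longrightarrow> u y = 0)}. ennreal (\<E> u))
          \<le> ennreal C * emeasure m (ball x R) / ennreal (R powr \<beta>))"

section \<open>Local spaces\<close>

definition relcompact_in :: "'a::metric_space set \<Rightarrow> 'a set \<Rightarrow> bool" where
  "relcompact_in A U \<longleftrightarrow> compact (closure A) \<and> closure A \<subseteq> U"

text \<open>Functions on \<open>U\<close> are total functions of which only the values on \<open>U\<close> matter.\<close>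

definition F_loc ::
  "'a::metric_space measure \<Rightarrow> ('a \<Rightarrow> real) set \<Rightarrow> 'a set \<Rightarrow> ('a \<Rightarrow> real) set" where
  "F_loc m F U =
     {u \<in> borel_measurable (restrict_space borel U).
        \<forall>A. open A \<and> relcompact_in A U \<longrightarrow> (\<exists>v\<in>F. AE x in m. x \<in> A \<longrightarrow> u x = v x)}"

definition local_rep ::
  "'a::metric_space measure \<Rightarrow> ('a \<Rightarrow> real) set \<Rightarrow> 'a set \<Rightarrow> ('a \<Rightarrow> real) \<Rightarrow> ('a \<Rightarrow> real)" where
  "local_rep m F A u = (SOME v. v \<in> F \<and> (AE x in m. x \<in> A \<longrightarrow> u x = v x))"

text \<open>
  The energy measure of a local function. The value on a relatively compact set \<open>E\<close> is
  independent of the chosen representative and of \<open>A \<supseteq> E\<close>; hence the supremum is over an upwards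
  directed family and equals the limit along any exhaustion of \<open>U\<close> by relatively compact open
  sets, and for \<open>E\<close> relatively compact in \<open>U\<close> it is attained at any admissible \<open>A \<supseteq> E\<close>.
\<close>

definition Gamma_loc ::
  "'a::metric_space measure \<Rightarrow> ('a \<Rightarrow> real) set \<Rightarrow> (('a \<Rightarrow> real) \<Rightarrow> 'a measure) \<Rightarrow>
   'a set \<Rightarrow> ('a \<Rightarrow> real) \<Rightarrow> 'a measure" where
  "Gamma_loc m F \<Gamma> U u =
     measure_of U (sets (restrict_space borel U))
       (\<lambda>E. SUP A\<in>{A. open A \<and> relcompact_in A U}. emeasure (\<Gamma> (local_rep m F A u)) (E \<inter> A))"

definition F_on ::
  "'a::metric_space measure \<Rightarrow> real \<Rightarrow> ('a \<Rightarrow> real) set \<Rightarrow> (('a \<Rightarrow> real) \<Rightarrow> 'a measure) \<Rightarrow>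
   'a set \<Rightarrow> ('a \<Rightarrow> real) set" where
  "F_on m p F \<Gamma> U =
     {u \<in> F_loc m F U.
        (\<integral>\<^sup>+x\<in>U. ennreal (\<bar>u x\<bar> powr p) \<partial>m) + emeasure (Gamma_loc m F \<Gamma> U u) U < \<infinity>}"

definition extension_property ::
  "'a::metric_space measure \<Rightarrow> real \<Rightarrow> ('a \<Rightarrow> real) set \<Rightarrow> (('a \<Rightarrow> real) \<Rightarrow> 'a measure) \<Rightarrow>
   'a set \<Rightarrow> bool" where
  "extension_property m p F \<Gamma> \<Omega> \<longleftrightarrow>
     (\<forall>f\<in>F_on m p F \<Gamma> \<Omega>. \<exists>g\<in>F.
        (AE x in m. x \<in> \<Omega> \<longrightarrow> f x = g x) \<and> emeasure (\<Gamma> g) (frontier \<Omega>) = 0)"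

section \<open>The nonlocal energy\<close>

text \<open>The diagonal is excluded from the domain of integration.\<close>

definition nonlocal_energy ::
  "'a::metric_space measure \<Rightarrow> real \<Rightarrow> real \<Rightarrow> 'a set \<Rightarrow> ('a \<Rightarrow> real) \<Rightarrow> ennreal" where
  "nonlocal_energy m p \<theta> \<Omega> u =
     (\<integral>\<^sup>+y\<in>\<Omega>. (\<integral>\<^sup>+x\<in>\<Omega> - {y}.
        ennreal (\<bar>u x - u y\<bar> powr p) /
          (ennreal (dist x y powr (p * \<theta>)) * emeasure m (ball y (dist x y))) \<partial>m) \<partial>m)"

end

theory Submission
  imports Defs
begin

text \<open>
  Write \<open>W r \<Omega> u\<close> for the integral of \<open>\<bar>u x - u y\<bar>\<^sup>p / m (ball y r)\<close> over \<open>x, y \<in> \<Omega>\<close> with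
  \<open>dist x y < r\<close>, and \<open>\<beta> = p \<theta>\<^sub>p\<close>. Splitting the domain into dyadic annuli, the nonlocal energy is
  comparable to the sum of \<open>r powr (\<beta> - p \<theta>) * (W r \<Omega> u / r powr \<beta>)\<close> over dyadic \<open>r\<close>. As \<open>\<theta>\<close> increases
  to \<open>\<theta>\<^sub>p\<close>, the factor \<open>\<theta>\<^sub>p - \<theta>\<close> turns the geometric weights into an average that only sees small \<open>r\<close>,
  so it remains to compare \<open>W r \<Omega> u / r powr \<beta>\<close> with the energy for small \<open>r\<close>.

  Upper bound: cover \<open>\<Omega>\<close> by balls of radius \<open>r\<close> with bounded overlap and apply the Poincare
  inequality to the extension \<open>g\<close> of \<open>u\<close>; this gives the energy of \<open>g\<close> near the closure of \<open>\<Omega>\<close>, and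
  the boundary carries no energy.

  Lower bound: the discrete convolution \<open>\<Sum>s. u\<^sub>s \<psi>\<^sub>s\<close> of averages of \<open>u\<close> over a net with a partition
  of unity of controlled energy converges to \<open>u\<close> in \<open>L\<^sup>p\<close>, and its energy measure is locally bounded by
  \<open>W r \<Omega> u / r powr \<beta>\<close>. By reflexivity and Mazur's lemma the energy measure is lower semicontinuous
  along it. The same bound shows that the energy measure of any function vanishing on an open set
  vanishes there, so the energy measure of a local function does not depend on representatives.
\<close>

section \<open>Hahn--Banach and weak compactness\<close>

text \<open>Three obstacles shape the argument. Elements of \<open>F\<close> are functions and their
  norms are only seminorms, so Hahn--Banach, duality and Mazur's lemma are set up for seminormed
  spaces of functions, and a weak limit is tested directly against convex sets. Locality is given on
  \<open>F \<inter> Cc\<close> only, so the lower bound is shown there first and extended by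
  density; this costs just a constant factor, because the Poincare inequality bounds
  \<open>ks_energy\<close> at every scale by \<open>r powr \<beta>\<close> times the full energy.
  Finally, the energy of a discrete convolution on a set is controlled by the values of the function
  on a neighbourhood of that set, so bounds inside \<Omega> are obtained on sets at positive
  distance from its complement, and \<Omega> is exhausted by them. Lattice operations replace
  products throughout: they need nothing beyond the contraction property. The constants in the final
  bounds are built from \<open>p\<close>, \<beta> and the constants of the hypotheses, which makes
  them uniform in \<Omega> and \<open>u\<close>.\<close>

definition sublinear_on :: "('b \<Rightarrow> real) set \<Rightarrow> (('b \<Rightarrow> real) \<Rightarrow> real) \<Rightarrow> bool" where
  "sublinear_on V q \<longleftrightarrow>
     (\<forall>u\<in>V. \<forall>v\<in>V. q (\<lambda>x. u x + v x) \<le> q u + q v) \<and>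
     (\<forall>c\<ge>0. \<forall>u\<in>V. q (\<lambda>x. c * u x) = c * q u)"

lemma fun_subspaceD:
  assumes "fun_subspace V"
  shows "(\<lambda>x. 0) \<in> V" "\<And>u v. u \<in> V \<Longrightarrow> v \<in> V \<Longrightarrow> (\<lambda>x. u x + v x) \<in> V"
    "\<And>u c. u \<in> V \<Longrightarrow> (\<lambda>x. c * u x) \<in> V" "\<And>u. u \<in> V \<Longrightarrow> (\<lambda>x. - u x) \<in> V"
    "\<And>u v. u \<in> V \<Longrightarrow> v \<in> V \<Longrightarrow> (\<lambda>x. u x - v x) \<in> V"
proof -
  show 1: "(\<lambda>x. 0) \<in> V" and 2: "\<And>u v. u \<in> V \<Longrightarrow> v \<in> V \<Longrightarrow> (\<lambda>x. u x + v x) \<in> V"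
    and 3: "\<And>u c. u \<in> V \<Longrightarrow> (\<lambda>x. c * u x) \<in> V"
    using assms by (auto simp: fun_subspace_def)
  show 4: "(\<lambda>x. - u x) \<in> V" if "u \<in> V" for u using 3[OF that, of "-1"] by simp
  show "\<And>u v. u \<in> V \<Longrightarrow> v \<in> V \<Longrightarrow> (\<lambda>x. u x - v x) \<in> V"
    using 2 4 by fastforce
qed

lemma sublinear_onD:
  assumes "sublinear_on V q"
  shows "\<And>u v. u \<in> V \<Longrightarrow> v \<in> V \<Longrightarrow> q (\<lambda>x. u x + v x) \<le> q u + q v"
    "\<And>c u. c \<ge> 0 \<Longrightarrow> u \<in> V \<Longrightarrow> q (\<lambda>x. c * u x) = c * q u"
  using assms by (auto simp: sublinear_on_def)

lemma sublinear_on_zero: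
  assumes "fun_subspace V" "sublinear_on V q"
  shows "q (\<lambda>x. 0) = 0"
  using sublinear_onD(2)[OF assms(2) order_refl fun_subspaceD(1)[OF assms(1)]] by simp

lemma sublinear_on_neg_le:
  assumes "fun_subspace V" "sublinear_on V q" "u \<in> V"
  shows "- q (\<lambda>x. - u x) \<le> q u"
proof -
  have "q (\<lambda>x. u x + - u x) \<le> q u + q (\<lambda>x. - u x)"
    by (rule sublinear_onD(1)[OF assms(2,3) fun_subspaceD(4)[OF assms(1,3)]])
  thus ?thesis using sublinear_on_zero[OF assms(1,2)] by simp
qed

text \<open>One inequality for positive factors suffices: applied to the inverse factor it gives the
  reverse one.\<close>

lemma sublinear_onI:
  assumes V: "fun_subspace V" and zero: "q (\<lambda>x. 0) = 0"
    and add: "\<And>u v. u \<in> V \<Longrightarrow> v \<in> V \<Longrightarrow> q (\<lambda>x. u x + v x) \<le> q u + q v"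
    and scale: "\<And>c u. 0 < c \<Longrightarrow> u \<in> V \<Longrightarrow> q (\<lambda>x. c * u x) \<le> c * q u"
  shows "sublinear_on V q"
  unfolding sublinear_on_def
proof (intro conjI ballI allI impI add)
  fix c :: real and u assume c: "0 \<le> c" and u: "u \<in> V"
  show "q (\<lambda>x. c * u x) = c * q u"
  proof (cases "c = 0")
    case False
    hence c: "0 < c" using c by simp
    have "q (\<lambda>x. (1 / c) * (c * u x)) \<le> (1 / c) * q (\<lambda>x. c * u x)"
      by (rule scale) (use c fun_subspaceD(3)[OF V u] in auto)
    moreover have "(\<lambda>x. (1 / c) * (c * u x)) = u" using c by auto
    ultimately have "c * q u \<le> q (\<lambda>x. c * u x)" using c by (simp add: field_simps)
    thus ?thesis using scale[OF c u] by simp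
  qed (use zero in simp)
qed

text \<open>A pointwise minimal sublinear functional is linear, since it equals
  \<open>x \<mapsto> INF t\<ge>0. l (x + t a) - t l a\<close> for every \<open>a\<close>.\<close>

lemma sublinear_minimal_additive:
  assumes V: "fun_subspace V" and l: "sublinear_on V l"
    and minimal: "\<And>q. sublinear_on V q \<Longrightarrow> (\<forall>u\<in>V. q u \<le> l u) \<Longrightarrow> (\<forall>u\<in>V. q u = l u)"
    and a: "a \<in> V" and x: "x \<in> V"
  shows "l (\<lambda>y. x y + a y) = l x + l a"
proof -
  note Vs = fun_subspaceD[OF V]
  have sub: "\<And>u v. u \<in> V \<Longrightarrow> v \<in> V \<Longrightarrow> l (\<lambda>x. u x + v x) \<le> l u + l v"
    and hom: "\<And>u c. c \<ge> 0 \<Longrightarrow> u \<in> V \<Longrightarrow> l (\<lambda>x. c * u x) = c * l u"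
    using sublinear_onD[OF l] by blast+
  define g where "g t u = l (\<lambda>y. u y + t * a y) - t * l a" for t u
  define q where "q u = (INF t\<in>{0..}. g t u)" for u
  \<comment> \<open>A lower bound independent of \<open>t\<close>; it makes the infimum in
    \<open>q\<close> finite.\<close>
  have low: "- l (\<lambda>y. - u y) \<le> g t u" if "t \<in> {0..}" "u \<in> V" for t u
  proof -
    have "l (\<lambda>y. (u y + t * a y) + (- u y)) \<le> l (\<lambda>y. u y + t * a y) + l (\<lambda>y. - u y)"
      by (rule sub) (use that Vs a in auto)
    thus ?thesis using hom[of t a] a that by (simp add: g_def)
  qed
  have bdd: "bdd_below ((\<lambda>t. g t u) ` {0..})" if "u \<in> V" for u
    using low[OF _ that] by (auto intro!: bdd_belowI2)
  have le: "q u \<le> g t u" if "t \<ge> 0" "u \<in> V" for t u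
    unfolding q_def using that by (intro cINF_lower bdd) auto
  have ge: "c \<le> q u" if "\<And>t. t \<ge> 0 \<Longrightarrow> c \<le> g t u" for c u
    unfolding q_def using that by (intro cINF_greatest) auto
  have q: "sublinear_on V q"
  proof (rule sublinear_onI[OF V])
    have "g t (\<lambda>x. 0) = 0" if "t \<ge> 0" for t
      using hom[of t a] a that by (simp add: g_def)
    thus "q (\<lambda>x. 0) = 0"
      using le[of 0 "\<lambda>x. 0"] ge[of 0 "\<lambda>x. 0"] Vs(1) by simp
  next
    fix u v assume uv: "u \<in> V" "v \<in> V"
    have "q (\<lambda>x. u x + v x) - g s u \<le> g t v" if "s \<ge> 0" "t \<ge> 0" for s t
    proof -
      have "q (\<lambda>x. u x + v x) \<le> g (s + t) (\<lambda>x. u x + v x)"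
        by (rule le) (use that Vs uv in auto)
      also have "\<dots> = l (\<lambda>y. (u y + s * a y) + (v y + t * a y)) - (s + t) * l a"
        unfolding g_def by (intro arg_cong2[where f="(-)"] arg_cong[where f=l]) (auto simp: algebra_simps)
      also have "\<dots> \<le> l (\<lambda>y. u y + s * a y) + l (\<lambda>y. v y + t * a y) - (s + t) * l a"
        using sub[of "\<lambda>y. u y + s * a y" "\<lambda>y. v y + t * a y"] Vs a uv by auto
      finally show ?thesis by (simp add: g_def algebra_simps)
    qed
    hence "q (\<lambda>x. u x + v x) - g s u \<le> q v" if "s \<ge> 0" for s
      using that by (intro ge) auto
    hence "q (\<lambda>x. u x + v x) - q v \<le> g s u" if "s \<ge> 0" for s
      using that by (smt (verit))
    hence "q (\<lambda>x. u x + v x) - q v \<le> q u"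
      by (intro ge) auto
    thus "q (\<lambda>x. u x + v x) \<le> q u + q v" by simp
  next
    fix c :: real and u assume c: "0 < c" and u: "u \<in> V"
    have "q (\<lambda>x. c * u x) / c \<le> g t u" if t: "t \<ge> 0" for t
    proof -
      have "q (\<lambda>x. c * u x) \<le> g (c * t) (\<lambda>x. c * u x)"
        by (rule le) (use t c Vs u in auto)
      also have "\<dots> = l (\<lambda>y. c * (u y + t * a y)) - c * t * l a"
        unfolding g_def by (simp add: algebra_simps)
      also have "\<dots> = c * g t u"
        using hom[of c "\<lambda>y. u y + t * a y"] Vs u a c by (auto simp: g_def algebra_simps)
      finally show ?thesis using c by (simp add: field_simps)
    qed
    hence "q (\<lambda>x. c * u x) / c \<le> q u" by (intro ge)
    thus "q (\<lambda>x. c * u x) \<le> c * q u" using c by (simp add: field_simps)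
  qed
  have "q u \<le> l u" if "u \<in> V" for u
    using le[of 0 u] that by (simp add: g_def)
  hence eq: "q u = l u" if "u \<in> V" for u
    using minimal[OF q] that by blast
  \<comment> \<open>The choice \<open>t = 1\<close> in the infimum, which equals \<open>l x\<close>
    by minimality, yields the inequality opposite to subadditivity.\<close>
  have "l x \<le> l (\<lambda>y. x y + a y) - l a"
    using le[of 1 x] eq[OF x] x by (simp add: g_def)
  thus ?thesis using sub[OF x a] by simp
qed

definition linear_on_funs :: "('b \<Rightarrow> real) set \<Rightarrow> (('b \<Rightarrow> real) \<Rightarrow> real) \<Rightarrow> bool" where
  "linear_on_funs V l \<longleftrightarrow>
     (\<forall>u\<in>V. \<forall>v\<in>V. l (\<lambda>x. u x + v x) = l u + l v) \<and> (\<forall>c. \<forall>u\<in>V. l (\<lambda>x. c * u x) = c * l u)"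

lemma linear_on_funsD:
  assumes "linear_on_funs V l"
  shows "\<And>u v. u \<in> V \<Longrightarrow> v \<in> V \<Longrightarrow> l (\<lambda>x. u x + v x) = l u + l v"
    "\<And>c u. u \<in> V \<Longrightarrow> l (\<lambda>x. c * u x) = c * l u"
  using assms by (auto simp: linear_on_funs_def)

lemma linear_on_funs_diff:
  assumes "fun_subspace V" "linear_on_funs V l" "u \<in> V" "v \<in> V"
  shows "l (\<lambda>x. u x - v x) = l u - l v"
proof -
  have "l (\<lambda>x. u x + (-1) * v x) = l u + l (\<lambda>x. (-1) * v x)"
    by (rule linear_on_funsD(1)[OF assms(2,3) fun_subspaceD(3)[OF assms(1,4)]])
  also have "l (\<lambda>x. (-1) * v x) = (-1) * l v"
    by (rule linear_on_funsD(2)[OF assms(2,4)])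
  finally show ?thesis by simp
qed

text \<open>Additivity turns \<open>l\<close> into an odd functional, which carries homogeneity over
  to negative factors.\<close>

lemma sublinear_additive_linear:
  assumes V: "fun_subspace V" and l: "sublinear_on V l"
    and add: "\<And>u v. u \<in> V \<Longrightarrow> v \<in> V \<Longrightarrow> l (\<lambda>x. u x + v x) = l u + l v"
  shows "linear_on_funs V l"
  unfolding linear_on_funs_def
proof (intro conjI ballI allI add)
  note Vs = fun_subspaceD[OF V]
  have neg: "l (\<lambda>x. - u x) = - l u" if "u \<in> V" for u
  proof -
    have "l (\<lambda>x. u x + - u x) = l u + l (\<lambda>x. - u x)"
      by (rule add) (use Vs that in auto)
    thus ?thesis using sublinear_on_zero[OF V l] by simp
  qed
  fix c u assume u: "u \<in> V"
  show "l (\<lambda>x. c * u x) = c * l u"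
  proof (cases "c \<ge> 0")
    case True thus ?thesis using sublinear_onD(2)[OF l _ u] by blast
  next
    case False
    have "l (\<lambda>x. - ((- c) * u x)) = - l (\<lambda>x. (-c) * u x)"
      by (rule neg[OF Vs(3)[OF u]])
    also have "l (\<lambda>x. (-c) * u x) = (-c) * l u"
      using sublinear_onD(2)[OF l _ u, of "- c"] False by simp
    finally show ?thesis by simp
  qed
qed

text \<open>Subadditivity of an infimum fails in general. In a chain, the members used at
  \<open>u\<close> and at \<open>v\<close> can be replaced by the smaller of the two, which serves
  both points. The bound \<open>b\<close> keeps the infimum finite.\<close>

lemma sublinear_chain_Inf:
  assumes V: "fun_subspace V" and ne: "C \<noteq> {}"
    and sub: "\<And>f. f \<in> C \<Longrightarrow> sublinear_on V f"
    and low: "\<And>f u. f \<in> C \<Longrightarrow> u \<in> V \<Longrightarrow> b u \<le> f u"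
    and chain: "\<And>f g. f \<in> C \<Longrightarrow> g \<in> C \<Longrightarrow> (\<forall>u\<in>V. f u \<le> g u) \<or> (\<forall>u\<in>V. g u \<le> f u)"
  shows "sublinear_on V (\<lambda>u. INF f\<in>C. f u)"
proof -
  note Vs = fun_subspaceD[OF V]
  define s where "s u = (INF f\<in>C. f u)" for u
  have le: "s u \<le> f u" if "f \<in> C" "u \<in> V" for f u
    unfolding s_def by (rule cINF_lower[OF _ that(1)]) (use low that(2) in \<open>auto intro!: bdd_belowI2\<close>)
  have ge: "c \<le> s u" if "\<And>f. f \<in> C \<Longrightarrow> c \<le> f u" for c u
    unfolding s_def by (rule cINF_greatest) (use ne that in auto)
  have "sublinear_on V s"
  proof (rule sublinear_onI[OF V])
    have "s (\<lambda>x. 0) = (INF f\<in>C. 0)"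
      unfolding s_def by (rule INF_cong) (use sublinear_on_zero[OF V sub] in auto)
    thus "s (\<lambda>x. 0) = 0" using ne by simp
  next
    fix u v assume uv: "u \<in> V" "v \<in> V"
    have "s (\<lambda>x. u x + v x) \<le> f u + g v" if fg: "f \<in> C" "g \<in> C" for f g
    proof -
      have "\<exists>h\<in>C. h u \<le> f u \<and> h v \<le> g v"
        using chain[OF fg] fg uv by (meson order_refl)
      then obtain h where h: "h \<in> C" "h u \<le> f u" "h v \<le> g v" by blast
      have "s (\<lambda>x. u x + v x) \<le> h (\<lambda>x. u x + v x)" using le h Vs uv by auto
      also have "\<dots> \<le> h u + h v" by (rule sublinear_onD(1)[OF sub[OF h(1)] uv])
      finally show ?thesis using h by simp
    qed
    hence "s (\<lambda>x. u x + v x) - f u \<le> s v" if "f \<in> C" for f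
      using that by (intro ge) (smt (verit))
    hence "s (\<lambda>x. u x + v x) - s v \<le> s u"
      by (intro ge) (smt (verit))
    thus "s (\<lambda>x. u x + v x) \<le> s u + s v" by simp
  next
    fix c :: real and u assume c: "0 < c" and u: "u \<in> V"
    have "s (\<lambda>x. c * u x) / c \<le> s u"
    proof (rule ge)
      fix f assume f: "f \<in> C"
      have "s (\<lambda>x. c * u x) \<le> f (\<lambda>x. c * u x)" by (rule le[OF f Vs(3)[OF u]])
      also have "\<dots> = c * f u" using sublinear_onD(2)[OF sub[OF f] _ u, of c] c by simp
      finally show "s (\<lambda>x. c * u x) / c \<le> f u" using c by (simp add: field_simps)
    qed
    thus "s (\<lambda>x. c * u x) \<le> c * s u" using c by (simp add: field_simps)
  qed
  thus ?thesis unfolding s_def .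
qed

text \<open>Zorn's lemma is applied to the sublinear functionals below \<open>q\<close>, with the
  order reversed so that a maximal element is pointwise minimal and therefore linear. Prescribed
  values on a subspace do not appear, since each application encodes its constraints in the choice
  of \<open>q\<close>. Members of \<open>A\<close> vanish outside \<open>V\<close> to make the order
  antisymmetric.\<close>

theorem hahn_banach_sublinear:
  assumes V: "fun_subspace V" and q: "sublinear_on V q"
  obtains l where "linear_on_funs V l" "\<And>u. u \<in> V \<Longrightarrow> l u \<le> q u" "\<And>u. u \<notin> V \<Longrightarrow> l u = 0"
proof -
  note Vs = fun_subspaceD[OF V]
  define A where "A = {f. sublinear_on V f \<and> (\<forall>u\<in>V. f u \<le> q u) \<and> (\<forall>u. u \<notin> V \<longrightarrow> f u = 0)}"
  define P where "P f g \<longleftrightarrow> (\<forall>u. g u \<le> (f u :: real))" for f g :: "('a \<Rightarrow> real) \<Rightarrow> real"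
  have AD: "sublinear_on V f" "u \<in> V \<Longrightarrow> f u \<le> q u" "u \<notin> V \<Longrightarrow> f u = 0" if "f \<in> A" for f u
    using that by (simp_all add: A_def)
  have AI: "f \<in> A" if "sublinear_on V f" "\<And>u. u \<in> V \<Longrightarrow> f u \<le> q u" "\<And>u. u \<notin> V \<Longrightarrow> f u = 0" for f
    using that by (simp add: A_def)
  have ext: "sublinear_on V (\<lambda>u. if u \<in> V then f u else 0)" if "sublinear_on V f" for f
    using that Vs by (auto simp: sublinear_on_def)
  have qA: "(\<lambda>u. if u \<in> V then q u else 0) \<in> A"
    using ext[OF q] by (auto simp: A_def)
  have low: "- q (\<lambda>x. - u x) \<le> f u" if "f \<in> A" "u \<in> V" for f u
  proof -
    have "f (\<lambda>x. - u x) \<le> q (\<lambda>x. - u x)" using that Vs by (auto simp: A_def)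
    thus ?thesis using sublinear_on_neg_le[OF V, of f u] that by (auto simp: A_def)
  qed
  have "\<exists>m\<in>A. \<forall>a\<in>A. P m a \<longrightarrow> a = m"
  proof (rule predicate_Zorn)
    show "partial_order_on A (relation_of P A)"
      by (rule partial_order_on_relation_ofI) (auto simp: P_def fun_eq_iff intro: order_trans antisym)
  next
    fix C assume C: "C \<in> Chains (relation_of P A)"
    have CA: "C \<subseteq> A" using C by (auto simp: Chains_def relation_of_def)
    have ch: "P f g \<or> P g f" if "f \<in> C" "g \<in> C" for f g
      using C that by (auto simp: Chains_def relation_of_def)
    show "\<exists>u\<in>A. \<forall>a\<in>C. P a u"
    proof (cases "C = {}")
      case True thus ?thesis using qA by blast
    next
      case False
      have bdd: "bdd_below ((\<lambda>f. f u) ` C)" if "u \<in> V" for u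
        using low[OF _ that] CA by (auto intro!: bdd_belowI2)
      have ch': "(\<forall>u\<in>V. f u \<le> g u) \<or> (\<forall>u\<in>V. g u \<le> f u)" if "f \<in> C" "g \<in> C" for f g
        using ch[OF that] by (auto simp: P_def)
      let ?s = "\<lambda>u. INF f\<in>C. f u"
      have "sublinear_on V ?s"
        by (rule sublinear_chain_Inf[OF V False, of "\<lambda>u. - q (\<lambda>x. - u x)"])
           (use AD(1) low ch' CA in blast)+
      hence s: "sublinear_on V (\<lambda>u. if u \<in> V then ?s u else 0)" by (rule ext)
      have le: "?s u \<le> f u" if "f \<in> C" "u \<in> V" for f u
        by (rule cINF_lower[OF bdd]) (use that in auto)
      obtain f0 where f0: "f0 \<in> C" using False by blast
      have "?s u \<le> q u" if "u \<in> V" for u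
        using le[OF f0 that] AD(2)[of f0 u] f0 CA that by auto
      hence "(\<lambda>u. if u \<in> V then ?s u else 0) \<in> A" by (intro AI s) auto
      moreover have "P f (\<lambda>u. if u \<in> V then ?s u else 0)" if f: "f \<in> C" for f
        using le[OF f] AD(3)[of f] f CA by (auto simp: P_def)
      ultimately show ?thesis by blast
    qed
  qed
  then obtain l where lA: "l \<in> A" and lmin: "\<And>a. a \<in> A \<Longrightarrow> P l a \<Longrightarrow> a = l" by blast
  have l: "sublinear_on V l" using lA by (simp add: A_def)
  have "\<forall>u\<in>V. f u = l u" if f: "sublinear_on V f" "\<forall>u\<in>V. f u \<le> l u" for f
  proof -
    have "f u \<le> q u" if "u \<in> V" for u using f(2) AD(2)[OF lA that] that by force
    hence eq: "(\<lambda>u. if u \<in> V then f u else 0) = l"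
      by (intro lmin AI ext f(1)) (use f(2) AD(3)[OF lA] in \<open>auto simp: P_def\<close>)
    show ?thesis
    proof
      fix u assume "u \<in> V"
      thus "f u = l u" using fun_cong[OF eq, of u] by simp
    qed
  qed
  hence "l (\<lambda>x. u x + v x) = l u + l v" if "u \<in> V" "v \<in> V" for u v
    using sublinear_minimal_additive[OF V l _ that(2,1)] by blast
  hence "linear_on_funs V l" by (rule sublinear_additive_linear[OF V l])
  thus ?thesis by (rule that) (use AD[OF lA] in auto)
qed

section \<open>Seminorms and separation of a point from a convex set\<close>

lemma seminorm_onD:
  assumes "seminorm_on V N"
  shows "\<And>u. u \<in> V \<Longrightarrow> 0 \<le> N u" "\<And>c u. u \<in> V \<Longrightarrow> N (\<lambda>x. c * u x) = \<bar>c\<bar> * N u"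
    "\<And>u v. u \<in> V \<Longrightarrow> v \<in> V \<Longrightarrow> N (\<lambda>x. u x + v x) \<le> N u + N v"
    "\<And>u. u \<in> V \<Longrightarrow> N (\<lambda>x. - u x) = N u"
proof -
  show "\<And>u. u \<in> V \<Longrightarrow> 0 \<le> N u" "\<And>u v. u \<in> V \<Longrightarrow> v \<in> V \<Longrightarrow> N (\<lambda>x. u x + v x) \<le> N u + N v"
    and h: "\<And>c u. u \<in> V \<Longrightarrow> N (\<lambda>x. c * u x) = \<bar>c\<bar> * N u"
    using assms by (auto simp: seminorm_on_def)
  show "N (\<lambda>x. - u x) = N u" if "u \<in> V" for u using h[OF that, of "-1"] by simp
qed

lemma seminorm_on_zero:
  assumes "fun_subspace V" "seminorm_on V N"
  shows "N (\<lambda>x. 0) = 0"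
  using seminorm_onD(2)[OF assms(2) fun_subspaceD(1)[OF assms(1)], of 0] by simp

lemma seminorm_on_diff_commute:
  assumes "fun_subspace V" "seminorm_on V N" "u \<in> V" "v \<in> V"
  shows "N (\<lambda>x. u x - v x) = N (\<lambda>x. v x - u x)"
  using seminorm_onD(4)[OF assms(2) fun_subspaceD(5)[OF assms(1,3,4)]] by simp

lemma seminorm_on_triangle_diff:
  assumes "fun_subspace V" "seminorm_on V N" "u \<in> V" "v \<in> V"
  shows "N u \<le> N v + N (\<lambda>x. u x - v x)"
  using seminorm_onD(3)[OF assms(2,4) fun_subspaceD(5)[OF assms(1,3,4)]] by simp

lemma seminorm_on_diff_le:
  assumes "fun_subspace V" "seminorm_on V N" "u \<in> V" "v \<in> V"
  shows "N (\<lambda>x. u x - v x) \<le> N u + N v"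
  using seminorm_onD(3)[OF assms(2,3) fun_subspaceD(4)[OF assms(1,4)]]
    seminorm_onD(4)[OF assms(2,4)] by simp

lemma seminorm_on_sum_le:
  assumes "fun_subspace V" "seminorm_on V N" "finite I" "\<And>i. i \<in> I \<Longrightarrow> u i \<in> V"
  shows "(\<lambda>x. \<Sum>i\<in>I. u i x) \<in> V \<and> N (\<lambda>x. \<Sum>i\<in>I. u i x) \<le> (\<Sum>i\<in>I. N (u i))"
  using assms(3,4)
proof (induction I rule: finite_induct)
  case empty
  thus ?case using seminorm_on_zero[OF assms(1,2)] fun_subspaceD(1)[OF assms(1)] by simp
next
  case (insert i I)
  hence "(\<lambda>x. \<Sum>i\<in>I. u i x) \<in> V" "N (\<lambda>x. \<Sum>i\<in>I. u i x) \<le> (\<Sum>i\<in>I. N (u i))" by auto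
  moreover have "N (\<lambda>x. u i x + (\<Sum>i\<in>I. u i x)) \<le> N (u i) + N (\<lambda>x. \<Sum>i\<in>I. u i x)"
    using seminorm_onD(3)[OF assms(2)] insert calculation by auto
  ultimately show ?case using insert fun_subspaceD(2)[OF assms(1)] by auto
qed

definition convex_funs :: "('b \<Rightarrow> real) set \<Rightarrow> bool" where
  "convex_funs Q \<longleftrightarrow>
     (\<forall>v\<in>Q. \<forall>w\<in>Q. \<forall>a b. 0 \<le> a \<and> 0 \<le> b \<and> a + b = 1 \<longrightarrow> (\<lambda>x. a * v x + b * w x) \<in> Q)"

text \<open>The functional is dominated by the infimum \<open>q\<close> of
  \<open>N (x + t (w - u)) - t d\<close> over \<open>t \<ge> 0\<close> and \<open>w\<close> in
  \<open>Q\<close>. The distance hypothesis bounds \<open>q\<close> below by \<open>- N\<close>.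
  Every linear \<open>l \<le> q\<close> does the job: \<open>t = 0\<close> gives
  \<open>l \<le> N\<close>, and \<open>t = 1\<close> at \<open>u - w\<close> gives
  \<open>l (u - w) \<le> - d\<close>.\<close>

lemma separation_from_convex:
  assumes V: "fun_subspace V" and N: "seminorm_on V N"
    and Q: "convex_funs Q" "Q \<subseteq> V" "Q \<noteq> {}" and u: "u \<in> V"
    and d: "\<And>w. w \<in> Q \<Longrightarrow> d \<le> N (\<lambda>x. u x - w x)"
  obtains \<phi> where "\<phi> \<in> dual_space V N" "\<And>w. w \<in> Q \<Longrightarrow> \<phi> u + d \<le> \<phi> w"
proof -
  note Vs = fun_subspaceD[OF V] and Ns = seminorm_onD[OF N]
  define g where "g = (\<lambda>(t, w) x. N (\<lambda>y. x y + t * (w y - u y)) - t * d)"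
  define P where "P = {0::real..} \<times> Q"
  define q where "q x = (INF tw\<in>P. g tw x)" for x
  have Pne: "P \<noteq> {}" using Q by (auto simp: P_def)
  have mem: "(\<lambda>y. x y + t * (w y - u y)) \<in> V" if "x \<in> V" "w \<in> Q" for x w and t :: real
    using Vs(2)[OF that(1) Vs(3)[OF Vs(5)]] that Q u by blast
  have low: "- N x \<le> g tw x" if tw: "tw \<in> P" and x: "x \<in> V" for tw x
  proof -
    obtain t w where [simp]: "tw = (t, w)" by fastforce
    have tw: "t \<ge> 0" "w \<in> Q" using tw by (auto simp: P_def)
    have wV: "(\<lambda>y. w y - u y) \<in> V" using Vs(5) tw Q u by auto
    have "N (\<lambda>y. (x y + t * (w y - u y)) - x y) \<le> N (\<lambda>y. x y + t * (w y - u y)) + N x"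
      by (rule seminorm_on_diff_le[OF V N mem[OF x tw(2)] x])
    also have "(\<lambda>y. (x y + t * (w y - u y)) - x y) = (\<lambda>y. t * (w y - u y))" by auto
    also have "N (\<lambda>y. t * (w y - u y)) = t * N (\<lambda>y. w y - u y)"
      using Ns(2)[OF wV, of t] tw by simp
    finally have "t * N (\<lambda>y. u y - w y) \<le> N (\<lambda>y. x y + t * (w y - u y)) + N x"
      using seminorm_on_diff_commute[OF V N u, of w] tw Q by auto
    moreover have "t * d \<le> t * N (\<lambda>y. u y - w y)"
      using d tw by (intro mult_left_mono) auto
    ultimately show ?thesis by (simp add: g_def)
  qed
  have le: "q x \<le> g tw x" if "tw \<in> P" "x \<in> V" for tw x
    unfolding q_def by (rule cINF_lower[OF _ that(1)]) (use low that(2) in \<open>auto intro!: bdd_belowI2\<close>)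
  have ge: "c \<le> q x" if "\<And>tw. tw \<in> P \<Longrightarrow> c \<le> g tw x" for c x
    unfolding q_def by (rule cINF_greatest[OF Pne]) (use that in auto)
  have "sublinear_on V q"
  proof (rule sublinear_onI[OF V])
    obtain w0 where w0: "w0 \<in> Q" using Q by blast
    have "q (\<lambda>x. 0) \<le> g (0, w0) (\<lambda>x. 0)" using w0 Vs by (intro le) (auto simp: P_def)
    hence "q (\<lambda>x. 0) \<le> 0" using seminorm_on_zero[OF V N] by (simp add: g_def)
    moreover have "0 \<le> q (\<lambda>x. 0)"
      by (rule ge) (use low[OF _ Vs(1)] seminorm_on_zero[OF V N] in auto)
    ultimately show "q (\<lambda>x. 0) = 0" by simp
  next
    fix a b assume ab: "a \<in> V" "b \<in> V"
    have key: "q (\<lambda>x. a x + b x) \<le> g tv a + g sw b" if P: "tv \<in> P" "sw \<in> P" for tv sw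
    proof -
      obtain t v where tv: "tv = (t, v)" by fastforce
      obtain s w where sw: "sw = (s, w)" by fastforce
      have h: "t \<ge> 0" "s \<ge> 0" "v \<in> Q" "w \<in> Q" using P tv sw by (auto simp: P_def)
      \<comment> \<open>Convexity of \<open>Q\<close> merges the two admissible pairs:
        \<open>z\<close> is the mean of \<open>v\<close> and \<open>w\<close> with weights
        proportional to \<open>t\<close> and \<open>s\<close>, or any point of \<open>Q\<close> if
        both weights vanish.\<close>
      obtain z where z: "z \<in> Q" "\<And>y. (t + s) * z y = t * v y + s * w y"
      proof (cases "t + s = 0")
        case True
        hence "t = 0" "s = 0" using h by auto
        thus ?thesis using h that[of v] by simp
      next
        case False
        have "(\<lambda>y. t / (t + s) * v y + s / (t + s) * w y) \<in> Q"
          using Q(1)[unfolded convex_funs_def, rule_format, of v w "t / (t + s)" "s / (t + s)"] h False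
          by (simp flip: add_divide_distrib)
        thus ?thesis by (rule that) (use False in \<open>simp add: distrib_left\<close>)
      qed
      have "q (\<lambda>x. a x + b x) \<le> g (t + s, z) (\<lambda>x. a x + b x)"
        by (rule le) (use h z ab Vs in \<open>auto simp: P_def\<close>)
      also have "(\<lambda>y. a y + b y + (t + s) * (z y - u y)) =
          (\<lambda>y. (a y + t * (v y - u y)) + (b y + s * (w y - u y)))"
        using z(2) by (auto simp: algebra_simps)
      hence "g (t + s, z) (\<lambda>x. a x + b x) =
          N (\<lambda>y. (a y + t * (v y - u y)) + (b y + s * (w y - u y))) - (t + s) * d"
        by (simp add: g_def)
      also have "\<dots> \<le> g tv a + g sw b"
        using Ns(3)[OF mem[OF ab(1) h(3), of t] mem[OF ab(2) h(4), of s]]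
        by (simp add: g_def tv sw algebra_simps)
      finally show ?thesis .
    qed
    have "q (\<lambda>x. a x + b x) - g tv a \<le> q b" if "tv \<in> P" for tv
      by (rule ge) (use key[OF that] in \<open>smt (verit)\<close>)
    hence "q (\<lambda>x. a x + b x) - q b \<le> q a"
      by (intro ge) (smt (verit))
    thus "q (\<lambda>x. a x + b x) \<le> q a + q b" by simp
  next
    fix c :: real and a assume c: "0 < c" and a: "a \<in> V"
    have "q (\<lambda>x. c * a x) / c \<le> g tw a" if tw: "tw \<in> P" for tw
    proof -
      obtain t w where [simp]: "tw = (t, w)" by fastforce
      have h: "t \<ge> 0" "w \<in> Q" using tw by (auto simp: P_def)
      have "q (\<lambda>x. c * a x) \<le> g (c * t, w) (\<lambda>x. c * a x)"
        by (rule le) (use h c Vs a in \<open>auto simp: P_def\<close>)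
      also have "\<dots> = N (\<lambda>y. c * (a y + t * (w y - u y))) - c * t * d"
        unfolding g_def by (simp add: algebra_simps)
      also have "\<dots> = c * g tw a"
        using Ns(2)[OF mem[OF a h(2), of t], of c] c by (auto simp: g_def algebra_simps)
      finally show ?thesis using c by (simp add: field_simps)
    qed
    hence "q (\<lambda>x. c * a x) / c \<le> q a" by (rule ge)
    thus "q (\<lambda>x. c * a x) \<le> c * q a" using c by (simp add: field_simps)
  qed
  then obtain l where l: "linear_on_funs V l" "\<And>x. x \<in> V \<Longrightarrow> l x \<le> q x" "\<And>x. x \<notin> V \<Longrightarrow> l x = 0"
    using hahn_banach_sublinear[OF V] by metis
  obtain w0 where w0: "w0 \<in> Q" using Q by blast
  have lN: "l x \<le> N x" if "x \<in> V" for x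
    using l(2)[OF that] le[of "(0, w0)" x] w0 that by (auto simp: P_def g_def)
  have "\<bar>l x\<bar> \<le> 1 * N x" if "x \<in> V" for x
  proof -
    have "l (\<lambda>y. (-1) * x y) = (-1) * l x"
      by (rule linear_on_funsD(2)[OF l(1) that])
    thus ?thesis using lN[OF that] lN[OF Vs(4)[OF that]] Ns(4)[OF that] by auto
  qed
  hence "l \<in> dual_space V N"
    using l(3) linear_on_funsD[OF l(1)] unfolding dual_space_def by blast
  moreover have "l u + d \<le> l w" if w: "w \<in> Q" for w
  proof -
    have wV: "w \<in> V" using w Q by auto
    have "l (\<lambda>y. u y - w y) \<le> q (\<lambda>y. u y - w y)" using l Vs u wV by auto
    also have "\<dots> \<le> g (1, w) (\<lambda>y. u y - w y)" by (rule le) (use w Vs u wV in \<open>auto simp: P_def\<close>)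
    also have "\<dots> = - d" using seminorm_on_zero[OF V N] by (simp add: g_def)
    finally show ?thesis using linear_on_funs_diff[OF V l(1) u wV] by simp
  qed
  ultimately show ?thesis by (rule that)
qed

section \<open>Dual norms and weak limits\<close>

lemma dual_spaceE:
  assumes "f \<in> dual_space V N"
  obtains K where "\<And>u. u \<in> V \<Longrightarrow> \<bar>f u\<bar> \<le> K * N u"
proof -
  have "\<exists>K. \<forall>u\<in>V. \<bar>f u\<bar> \<le> K * N u" using assms by (simp add: dual_space_def)
  thus ?thesis using that by blast
qed

lemma dual_norm_upper:
  assumes N: "seminorm_on V N" and f: "f \<in> dual_space V N" and u: "u \<in> V" "N u \<le> 1"
  shows "\<bar>f u\<bar> \<le> dual_norm V N f"
proof -
  obtain K where K: "\<And>u. u \<in> V \<Longrightarrow> \<bar>f u\<bar> \<le> K * N u" using dual_spaceE[OF f] by metis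
  have "\<bar>f v\<bar> \<le> \<bar>K\<bar>" if "v \<in> V" "N v \<le> 1" for v
    using K[OF that(1)] mult_mono[of K "\<bar>K\<bar>" "N v" 1] seminorm_onD(1)[OF N that(1)] that by linarith
  hence "bdd_above ((\<lambda>u. \<bar>f u\<bar>) ` {u \<in> V. N u \<le> 1})" by (auto intro!: bdd_aboveI2)
  thus ?thesis unfolding dual_norm_def by (rule cSUP_upper[rotated]) (use u in simp)
qed

lemma dual_norm_nonneg:
  assumes V: "fun_subspace V" and N: "seminorm_on V N" and f: "f \<in> dual_space V N"
  shows "0 \<le> dual_norm V N f"
  using dual_norm_upper[OF N f fun_subspaceD(1)[OF V]] seminorm_on_zero[OF V N] by simp

lemma dual_norm_bound:
  assumes V: "fun_subspace V" and N: "seminorm_on V N" and f: "f \<in> dual_space V N" and u: "u \<in> V"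
  shows "\<bar>f u\<bar> \<le> dual_norm V N f * N u"
proof (cases "N u = 0")
  \<comment> \<open>Normalising \<open>u\<close> is impossible when its seminorm is zero, but then
    boundedness of \<open>f\<close> forces \<open>f u = 0\<close>.\<close>
  case True
  obtain K where "\<And>u. u \<in> V \<Longrightarrow> \<bar>f u\<bar> \<le> K * N u" using dual_spaceE[OF f] by metis
  from this[OF u] show ?thesis using True by simp
next
  case False
  note Ns = seminorm_onD[OF N]
  have pos: "N u > 0" using False Ns(1)[OF u] by simp
  have hom: "f (\<lambda>x. c * u x) = c * f u" for c using f u by (auto simp: dual_space_def)
  have "\<bar>f (\<lambda>x. (1 / N u) * u x)\<bar> \<le> dual_norm V N f"
    by (rule dual_norm_upper[OF N f fun_subspaceD(3)[OF V u]])
      (use Ns(2)[OF u, of "1 / N u"] pos in simp)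
  thus ?thesis using pos unfolding hom by (simp add: abs_mult field_simps)
qed

lemma dual_space_subspace:
  assumes N: "seminorm_on V N"
  shows "fun_subspace (dual_space V N)"
  unfolding fun_subspace_def
proof (intro conjI ballI allI)
  show "(\<lambda>x. 0) \<in> dual_space V N" by (auto simp: dual_space_def intro!: exI[of _ 0])
next
  fix f g assume fg: "f \<in> dual_space V N" "g \<in> dual_space V N"
  then obtain K L where "\<And>u. u \<in> V \<Longrightarrow> \<bar>f u\<bar> \<le> K * N u" "\<And>u. u \<in> V \<Longrightarrow> \<bar>g u\<bar> \<le> L * N u"
    using dual_spaceE by metis
  hence "\<forall>u\<in>V. \<bar>f u + g u\<bar> \<le> (K + L) * N u"
    by (smt (verit) distrib_right)
  hence "\<exists>K. \<forall>u\<in>V. \<bar>f u + g u\<bar> \<le> K * N u" by blast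
  thus "(\<lambda>x. f x + g x) \<in> dual_space V N"
    using fg by (auto simp: dual_space_def algebra_simps)
next
  fix f and c :: real assume f: "f \<in> dual_space V N"
  then obtain K where "\<And>u. u \<in> V \<Longrightarrow> \<bar>f u\<bar> \<le> K * N u" using dual_spaceE[OF f] by metis
  hence "\<bar>c * f u\<bar> \<le> (\<bar>c\<bar> * K) * N u" if "u \<in> V" for u
    using mult_left_mono[of "\<bar>f u\<bar>" "K * N u" "\<bar>c\<bar>"] that by (simp add: abs_mult algebra_simps)
  hence "\<exists>K. \<forall>u\<in>V. \<bar>c * f u\<bar> \<le> K * N u" by blast
  thus "(\<lambda>x. c * f x) \<in> dual_space V N"
    using f by (auto simp: dual_space_def algebra_simps)
qed

text \<open>The infimum of all eventual upper bounds is the upper limit of the sequence, here as a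
  real number.\<close>

lemma Inf_eventual_bounds_le:
  fixes a :: "nat \<Rightarrow> real"
  assumes bdd: "\<And>k. \<bar>a k\<bar> \<le> K" and ev: "eventually (\<lambda>k. a k \<le> c) sequentially"
  shows "Inf {c. eventually (\<lambda>k. a k \<le> c) sequentially} \<le> c"
proof (intro cInf_lower bdd_belowI)
  fix d assume "d \<in> {c. eventually (\<lambda>k. a k \<le> c) sequentially}"
  then obtain k where "a k \<le> d" unfolding eventually_sequentially by blast
  thus "- K \<le> d" using bdd[of k] by linarith
qed (use ev in simp)

text \<open>Eventual upper bounds of two sequences add up to one of their sum, hence upper limits
  are subadditive.\<close>

lemma Inf_eventual_bounds_sublinear:
  fixes v :: "nat \<Rightarrow> 'b"
  assumes V: "fun_subspace V" and bdd: "\<And>f. f \<in> V \<Longrightarrow> \<exists>K. \<forall>k. \<bar>f (v k)\<bar> \<le> K"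
  shows "sublinear_on V (\<lambda>f. Inf {c. eventually (\<lambda>k. f (v k) \<le> c) sequentially})"
proof -
  let ?A = "\<lambda>f. {c. eventually (\<lambda>k. f (v k) \<le> c) sequentially}"
  define q :: "('b \<Rightarrow> real) \<Rightarrow> real" where "q f = Inf (?A f)" for f
  note Vs = fun_subspaceD[OF V]
  have le: "q f \<le> c" if f: "f \<in> V" and ev: "eventually (\<lambda>k. f (v k) \<le> c) sequentially" for f c
  proof -
    obtain K where "\<And>k. \<bar>f (v k)\<bar> \<le> K" using bdd[OF f] by blast
    thus ?thesis unfolding q_def by (rule Inf_eventual_bounds_le[OF _ ev])
  qed
  have ge: "c \<le> q f" if f: "f \<in> V" and c: "\<And>d. eventually (\<lambda>k. f (v k) \<le> d) sequentially \<Longrightarrow> c \<le> d" for f c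
  proof -
    obtain K where "\<And>k. \<bar>f (v k)\<bar> \<le> K" using bdd[OF f] by blast
    hence "K \<in> ?A f" by (auto simp: abs_le_iff)
    thus ?thesis unfolding q_def by (intro cInf_greatest) (use c in auto)
  qed
  have "sublinear_on V q"
  proof (rule sublinear_onI[OF V])
    show "q (\<lambda>x. 0) = 0" using le[OF Vs(1), of 0] ge[OF Vs(1), of 0] by simp
  next
    fix f g assume fg: "f \<in> V" "g \<in> V"
    have key: "q (\<lambda>x. f x + g x) \<le> c + d"
      if "eventually (\<lambda>k. f (v k) \<le> c) sequentially" "eventually (\<lambda>k. g (v k) \<le> d) sequentially" for c d
      by (rule le[OF Vs(2)[OF fg]]) (use that in eventually_elim, auto)
    have "q (\<lambda>x. f x + g x) - c \<le> q g" if c: "eventually (\<lambda>k. f (v k) \<le> c) sequentially" for c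
      by (rule ge[OF fg(2)]) (drule key[OF c], simp)
    note key = this
    have "q (\<lambda>x. f x + g x) - q g \<le> q f"
      by (rule ge[OF fg(1)]) (drule key, simp)
    thus "q (\<lambda>x. f x + g x) \<le> q f + q g" by simp
  next
    fix c :: real and f assume c: "0 < c" and f: "f \<in> V"
    have "q (\<lambda>x. c * f x) / c \<le> q f"
    proof (rule ge[OF f])
      fix d assume "eventually (\<lambda>k. f (v k) \<le> d) sequentially"
      hence "eventually (\<lambda>k. c * f (v k) \<le> c * d) sequentially" by eventually_elim (use c in simp)
      from le[OF Vs(3)[OF f] this] show "q (\<lambda>x. c * f x) / c \<le> d" using c by (simp add: field_simps)
    qed
    thus "q (\<lambda>x. c * f x) \<le> c * q f" using c by (simp add: field_simps)
  qed
  thus ?thesis unfolding q_def .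
qed

text \<open>Extending the upper limit of \<open>f (v k)\<close>, a sublinear function of \<open>f\<close>, to a linear one yields
  an element of the bidual, and the function representing it cannot be separated from \<open>Q\<close>.\<close>

theorem reflexive_weak_limit:
  assumes V: "fun_subspace V" and N: "seminorm_on V N" and R: "reflexive_wrt V N"
    and v: "\<And>k::nat. v k \<in> V" and bound: "\<And>k. N (v k) \<le> K"
  obtains u where "u \<in> V"
    "\<And>Q e. convex_funs Q \<Longrightarrow> Q \<subseteq> V \<Longrightarrow> eventually (\<lambda>k. v k \<in> Q) sequentially \<Longrightarrow> 0 < e
       \<Longrightarrow> \<exists>w\<in>Q. N (\<lambda>x. u x - w x) < e"
proof -
  let ?D = "dual_space V N"
  note D = dual_space_subspace[OF N] and Ns = seminorm_onD[OF N]
  note Ds = fun_subspaceD[OF D]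
  have dn: "\<bar>f (v k)\<bar> \<le> K * dual_norm V N f" if f: "f \<in> ?D" for f k
  proof -
    have "\<bar>f (v k)\<bar> \<le> dual_norm V N f * N (v k)" by (rule dual_norm_bound[OF V N f v])
    also have "\<dots> \<le> dual_norm V N f * K" using dual_norm_nonneg[OF V N f] bound by (intro mult_left_mono)
    finally show ?thesis by (simp add: mult.commute)
  qed
  define q :: "(('a \<Rightarrow> real) \<Rightarrow> real) \<Rightarrow> real" where "q f = Inf {c. eventually (\<lambda>k. f (v k) \<le> c) sequentially}" for f
  have q: "sublinear_on ?D q"
    unfolding q_def by (rule Inf_eventual_bounds_sublinear[OF D]) (use dn in blast)
  obtain \<Psi> where \<Psi>: "linear_on_funs ?D \<Psi>" "\<And>f. f \<in> ?D \<Longrightarrow> \<Psi> f \<le> q f" "\<And>f. f \<notin> ?D \<Longrightarrow> \<Psi> f = 0"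
    using hahn_banach_sublinear[OF D q] by metis
  have qle: "q f \<le> c" if f: "f \<in> ?D" and ev: "eventually (\<lambda>k. f (v k) \<le> c) sequentially" for f c
    unfolding q_def by (rule Inf_eventual_bounds_le[OF dn[OF f] ev])
  have neg: "\<Psi> (\<lambda>x. - f x) = - \<Psi> f" if "f \<in> ?D" for f
  proof -
    have "\<Psi> (\<lambda>x. (-1) * f x) = (-1) * \<Psi> f"
      by (rule linear_on_funsD(2)[OF \<Psi>(1) that])
    thus ?thesis by simp
  qed
  have "\<bar>\<Psi> f\<bar> \<le> K * dual_norm V N f" if f: "f \<in> ?D" for f
  proof -
    have "\<Psi> f \<le> K * dual_norm V N f"
      using \<Psi>(2)[OF f] qle[OF f, of "K * dual_norm V N f"] dn[OF f] by (force simp: abs_le_iff)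
    moreover have "q (\<lambda>x. - f x) \<le> K * dual_norm V N f"
      by (rule qle[OF Ds(4)[OF f]]) (use dn[OF f] in \<open>auto simp: abs_le_iff\<close>)
    hence "\<Psi> (\<lambda>x. - f x) \<le> K * dual_norm V N f"
      using \<Psi>(2)[OF Ds(4)[OF f]] by linarith
    ultimately show ?thesis using neg[OF f] by (simp add: abs_le_iff)
  qed
  hence "\<Psi> \<in> dual_space ?D (dual_norm V N)"
    using \<Psi>(3) linear_on_funsD[OF \<Psi>(1)] unfolding dual_space_def[of ?D] by blast
  then obtain u where u: "u \<in> V" "\<And>f. f \<in> ?D \<Longrightarrow> \<Psi> f = f u"
    using R unfolding reflexive_wrt_def by blast
  show ?thesis
  proof (rule that[OF u(1)])
    fix Q and e :: real
    assume Q: "convex_funs Q" "Q \<subseteq> V" and ev: "eventually (\<lambda>k. v k \<in> Q) sequentially" and e: "0 < e"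
    show "\<exists>w\<in>Q. N (\<lambda>x. u x - w x) < e"
    proof (rule ccontr)
      assume "\<not> ?thesis"
      hence far: "\<And>w. w \<in> Q \<Longrightarrow> e \<le> N (\<lambda>x. u x - w x)" by force
      have "Q \<noteq> {}" using ev unfolding eventually_sequentially by blast
      then obtain f where f: "f \<in> ?D" "\<And>w. w \<in> Q \<Longrightarrow> f u + e \<le> f w"
        using separation_from_convex[OF V N Q _ u(1) far] by metis
      \<comment> \<open>As \<open>f\<close> is at least \<open>f u + e\<close> on \<open>Q\<close>,
        the numbers \<open>- f (v k)\<close> are eventually at most \<open>- f u - e\<close>. But
        \<Psi> is below the upper limit and takes the value \<open>- f u\<close> at the negative of
        \<open>f\<close>.\<close>
      have "q (\<lambda>x. - f x) \<le> - f u - e"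
        by (rule qle[OF Ds(4)[OF f(1)]]) (use ev in eventually_elim, use f in force)
      hence "- f u \<le> - f u - e"
        using \<Psi>(2)[OF Ds(4)[OF f(1)]] neg[OF f(1)] u(2)[OF f(1)] by linarith
      thus False using e by simp
    qed
  qed
qed

section \<open>Doubling measures and nets\<close>

lemma nn_integral_countable_cover:
  assumes T: "countable T" and [measurable]: "f \<in> borel_measurable M" "A \<in> sets M"
    and B[measurable]: "\<And>s. B s \<in> sets M" and cover: "A \<subseteq> (\<Union>s\<in>T. B s)"
  shows "(\<integral>\<^sup>+x\<in>A. f x \<partial>M) \<le> (\<integral>\<^sup>+s. (\<integral>\<^sup>+x\<in>A \<inter> B s. f x \<partial>M) \<partial>count_space T)"
proof -
  have "(\<integral>\<^sup>+x\<in>A. f x \<partial>M) \<le> (\<integral>\<^sup>+x. (\<integral>\<^sup>+s. f x * indicator (A \<inter> B s) x \<partial>count_space T) \<partial>M)"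
  proof (rule nn_integral_mono)
    fix x
    show "f x * indicator A x \<le> (\<integral>\<^sup>+s. f x * indicator (A \<inter> B s) x \<partial>count_space T)"
    proof (cases "x \<in> A")
      case True
      then obtain s where "s \<in> T" "x \<in> B s" using cover by blast
      thus ?thesis
        using nn_integral_ge_point[of s T "\<lambda>s. f x * indicator (A \<inter> B s) x"] True by simp
    qed simp
  qed
  also have "\<dots> = (\<integral>\<^sup>+s. (\<integral>\<^sup>+x\<in>A \<inter> B s. f x \<partial>M) \<partial>count_space T)"
    by (rule nn_integral_count_space_nn_integral[OF T]) measurable
  finally show ?thesis .
qed

lemma nn_integral_bounded_overlap:
  assumes T: "countable T" and [measurable]: "f \<in> borel_measurable M" "D \<in> sets M"
    and B[measurable]: "\<And>s. B s \<in> sets M" and sub: "\<And>s. s \<in> T \<Longrightarrow> B s \<subseteq> D"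
    and fin: "\<And>x. finite {s \<in> T. x \<in> B s}" and N: "\<And>x. card {s \<in> T. x \<in> B s} \<le> N"
  shows "(\<integral>\<^sup>+s. (\<integral>\<^sup>+x\<in>B s. f x \<partial>M) \<partial>count_space T) \<le> of_nat N * (\<integral>\<^sup>+x\<in>D. f x \<partial>M)"
proof -
  have "(\<integral>\<^sup>+s. (\<integral>\<^sup>+x\<in>B s. f x \<partial>M) \<partial>count_space T) =
      (\<integral>\<^sup>+x. (\<integral>\<^sup>+s. f x * indicator (B s) x \<partial>count_space T) \<partial>M)"
    by (rule nn_integral_count_space_nn_integral[OF T, symmetric]) measurable
  also have "\<dots> \<le> (\<integral>\<^sup>+x. of_nat N * (f x * indicator D x) \<partial>M)"
  proof (rule nn_integral_mono)
    fix x
    have "(\<integral>\<^sup>+s. f x * indicator (B s) x \<partial>count_space T) =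
        f x * (\<integral>\<^sup>+s. indicator {s \<in> T. x \<in> B s} s \<partial>count_space T)"
      by (subst nn_integral_cmult[symmetric]) (auto intro!: nn_integral_cong simp: indicator_def)
    also have "\<dots> = f x * of_nat (card {s \<in> T. x \<in> B s})"
      using fin by (subst nn_integral_indicator) (auto simp: emeasure_count_space_finite)
    also have "\<dots> \<le> of_nat N * (f x * indicator D x)"
    proof (cases "x \<in> D")
      case True
      have "f x * of_nat (card {s \<in> T. x \<in> B s}) \<le> f x * of_nat N"
        using N[of x] by (intro mult_left_mono) auto
      thus ?thesis using True by (simp add: mult.commute)
    next
      case False
      hence "{s \<in> T. x \<in> B s} = {}" using sub by auto
      thus ?thesis by (simp only: card.empty) simp
    qed
    finally show "(\<integral>\<^sup>+s. f x * indicator (B s) x \<partial>count_space T) \<le> of_nat N * (f x * indicator D x)" .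
  qed
  also have "\<dots> = of_nat N * (\<integral>\<^sup>+x\<in>D. f x \<partial>M)"
    by (rule nn_integral_cmult) measurable
  finally show ?thesis .
qed

text \<open>Separation and covering use the same radius, so these are exactly the maximal
  \<open>r\<close>-separated sets.\<close>

definition is_net :: "real \<Rightarrow> 'a::metric_space set \<Rightarrow> bool" where
  "is_net r S \<longleftrightarrow> (\<forall>x\<in>S. \<forall>y\<in>S. x \<noteq> y \<longrightarrow> r \<le> dist x y) \<and> (\<forall>x. \<exists>s\<in>S. dist s x < r)"

lemma net_exists:
  assumes "0 < r"
  shows "\<exists>S::'a::metric_space set. is_net r S"
proof -
  define A where "A = {S::'a set. \<forall>x\<in>S. \<forall>y\<in>S. x \<noteq> y \<longrightarrow> r \<le> dist x y}"
  have "\<exists>M\<in>A. \<forall>X\<in>A. M \<subseteq> X \<longrightarrow> X = M"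
  proof (rule subset_Zorn')
    fix C assume "subset.chain A C"
    hence C: "C \<subseteq> A" "\<And>X Y. X \<in> C \<Longrightarrow> Y \<in> C \<Longrightarrow> X \<subseteq> Y \<or> Y \<subseteq> X"
      by (auto simp: subset.chain_def)
    show "\<Union>C \<in> A"
      unfolding A_def
    proof safe
      fix x y X Y assume h: "x \<in> X" "X \<in> C" "y \<in> Y" "Y \<in> C" "x \<noteq> y"
      then obtain Z where "Z \<in> C" "x \<in> Z" "y \<in> Z" using C(2)[of X Y] by blast
      thus "r \<le> dist x y" using C(1) h(5) by (auto simp: A_def)
    qed
  qed
  then obtain S where S: "S \<in> A" "\<And>X. X \<in> A \<Longrightarrow> S \<subseteq> X \<Longrightarrow> X = S" by blast
  have "\<exists>s\<in>S. dist s x < r" for x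
  proof (rule ccontr)
    assume far: "\<not> ?thesis"
    hence "insert x S \<in> A" using S(1) by (force simp: A_def dist_commute)
    hence "x \<in> S" using S(2)[of "insert x S"] by blast
    thus False using far assms by auto
  qed
  thus ?thesis using S(1) by (auto simp: is_net_def A_def)
qed

text \<open>Volumes are handled as real numbers. Finiteness of balls is required separately because
  \<open>measure\<close> is \<open>0\<close> on sets of infinite measure.\<close>

locale doubling_space =
  fixes m :: "'a::polish_space measure" and c :: real
  assumes sets_m[measurable_cong, simp]: "sets m = sets borel"
    and c: "1 \<le> c"
    and vol_pos: "0 < r \<Longrightarrow> 0 < measure m (ball x r)"
    and ball_finite: "emeasure m (ball x r) < \<infinity>"
    and doubling: "0 < r \<Longrightarrow> measure m (ball x (2 * r)) \<le> c * measure m (ball x r)"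
begin

abbreviation vol :: "'a \<Rightarrow> real \<Rightarrow> real" where "vol x r \<equiv> measure m (ball x r)"

lemma space_m[simp]: "space m = UNIV"
  using sets_eq_imp_space_eq[OF sets_m] by simp

lemma emeasure_ball: "emeasure m (ball x r) = ennreal (vol x r)"
  using ball_finite[of x r] by (simp add: emeasure_eq_ennreal_measure less_top)

sublocale sigma_finite_measure m
proof
  fix x0 :: 'a
  show "\<exists>A. countable A \<and> A \<subseteq> sets m \<and> \<Union>A = space m \<and> (\<forall>a\<in>A. emeasure m a \<noteq> \<infinity>)"
  proof (intro exI conjI)
    show "\<Union> (range (\<lambda>n::nat. ball undefined n)) = space m"
      using reals_Archimedean2 by (fastforce simp: set_eq_iff)
  qed (use ball_finite in \<open>auto simp: less_top\<close>)
qed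

lemma vol_mono: "ball x r \<subseteq> ball y s \<Longrightarrow> vol x r \<le> vol y s"
  using ball_finite by (intro measure_mono_fmeasurable) (auto simp: fmeasurable_def)

lemma vol_pow: "0 < r \<Longrightarrow> vol x (2 ^ k * r) \<le> c ^ k * vol x r"
proof (induction k)
  case (Suc k)
  have "vol x (2 * (2 ^ k * r)) \<le> c * vol x (2 ^ k * r)" by (rule doubling) (use Suc in simp)
  also have "\<dots> \<le> c * (c ^ k * vol x r)" using Suc c by (intro mult_left_mono) auto
  finally show ?case by (simp add: mult.assoc)
qed simp

lemma vol_le:
  assumes "0 < r" "dist x y + R \<le> 2 ^ k * r"
  shows "vol x R \<le> c ^ k * vol y r"
proof -
  have "vol x R \<le> vol y (2 ^ k * r)"
  proof (rule vol_mono, safe)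
    fix z assume "z \<in> ball x R"
    hence "dist x z < R" by simp
    thus "z \<in> ball y (2 ^ k * r)" using assms dist_triangle[of y z x] by (simp add: dist_commute)
  qed
  thus ?thesis using vol_pow[OF assms(1), of y k] by simp
qed

text \<open>The exponent \<open>k\<close> is chosen with \<open>4 * \<rho> + 2 \<le> 2 ^ k\<close>,
  as the volume count in \<open>net_overlap\<close> demands. The value is independent of the scale
  \<open>r\<close>, and so are all constants below.\<close>

definition overlap :: "real \<Rightarrow> nat" where
  "overlap \<rho> = nat \<lfloor>c ^ nat \<lceil>4 * \<rho> + 2\<rceil>\<rfloor>"

text \<open>A volume count: the balls of radius \<open>r / 2\<close> about the net points in
  question are disjoint and lie in \<open>ball x ((\<rho> + 1) * r)\<close>, and by doubling each of
  them carries at least the fraction \<open>1 / c ^ k\<close> of its volume.\<close>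

lemma net_overlap:
  fixes S :: "'a set"
  assumes S: "is_net r S" and r: "0 < r" and l: "0 < \<rho>"
  shows "finite {s \<in> S. dist s x < \<rho> * r} \<and> card {s \<in> S. dist s x < \<rho> * r} \<le> overlap \<rho>"
proof (rule finite_if_finite_subsets_card_bdd)
  fix T assume T: "T \<subseteq> {s \<in> S. dist s x < \<rho> * r}" "finite T"
  define k where "k = nat \<lceil>4 * \<rho> + 2\<rceil>"
  have "4 * \<rho> + 2 \<le> real k" unfolding k_def by linarith
  also have "real k \<le> 2 ^ k" using of_nat_less_two_power[of k] by (simp add: less_imp_le)
  finally have k: "4 * \<rho> + 2 \<le> 2 ^ k" .
  let ?R = "(\<rho> + 1) * r"
  have V: "vol x ?R \<le> c ^ k * vol s (r / 2)" if "s \<in> T" for s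
  proof (rule vol_le)
    have "dist x s + ?R \<le> (2 * \<rho> + 1) * r"
      using that T(1) by (auto simp: dist_commute algebra_simps)
    also have "\<dots> \<le> 2 ^ k / 2 * r" using k r by (intro mult_right_mono) auto
    finally show "dist x s + ?R \<le> 2 ^ k * (r / 2)" by simp
  qed (use r in simp)
  have disj: "disjoint_family_on (\<lambda>s. ball s (r / 2)) T"
    unfolding disjoint_family_on_def
  proof (intro ballI impI)
    fix s t assume st: "s \<in> T" "t \<in> T" "s \<noteq> t"
    hence "r \<le> dist s t" using T(1) S by (auto simp: is_net_def)
    thus "ball s (r / 2) \<inter> ball t (r / 2) = {}"
      by (intro disjoint_ballI) simp
  qed
  have "real (card T) * vol x ?R = (\<Sum>s\<in>T. vol x ?R)" by simp
  also have "\<dots> \<le> (\<Sum>s\<in>T. c ^ k * vol s (r / 2))" by (intro sum_mono V)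
  also have "\<dots> = c ^ k * measure m (\<Union>s\<in>T. ball s (r / 2))"
    unfolding sum_distrib_left[symmetric]
    using ball_finite by (subst measure_finite_Union[OF T(2) _ disj]) (auto simp: less_top)
  also have "measure m (\<Union>s\<in>T. ball s (r / 2)) \<le> vol x ?R"
  proof (rule measure_mono_fmeasurable)
    show "(\<Union>s\<in>T. ball s (r / 2)) \<subseteq> ball x ?R"
    proof safe
      fix s y assume "s \<in> T" "y \<in> ball s (r / 2)"
      hence "dist s x < \<rho> * r" "dist s y < r / 2" using T(1) by auto
      thus "y \<in> ball x ?R"
        using dist_triangle[of x y s] r by (simp add: dist_commute algebra_simps)
    qed
  qed (use ball_finite in \<open>auto simp: fmeasurable_def intro!: borel_open\<close>)
  finally have "real (card T) * vol x ?R \<le> c ^ k * vol x ?R" using c by (simp add: mult_left_mono)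
  moreover have "0 < vol x ?R" by (rule vol_pos) (use r l in simp)
  ultimately have "real (card T) \<le> c ^ k" by simp
  thus "card T \<le> overlap \<rho>" unfolding overlap_def k_def[symmetric] by (simp add: le_nat_floor)
qed

lemma net_countable:
  fixes S :: "'a set"
  assumes S: "is_net r S" and r: "0 < r"
  shows "countable S"
proof -
  have "S = (\<Union>n::nat. {s \<in> S. dist s undefined < (real n + 1) * r})"
  proof (safe; clarsimp)
    fix s
    obtain n :: nat where "dist s undefined / r < n" using reals_Archimedean2 by blast
    hence "dist s undefined < (real n + 1) * r" using r by (simp add: field_simps)
    thus "\<exists>n::nat. dist s undefined < (real n + 1) * r" ..
  qed
  moreover have "countable (\<Union>n::nat. {s \<in> S. dist s undefined < (real n + 1) * r})"
    using net_overlap[OF S r] by (intro countable_UN) (auto intro!: countable_finite)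
  ultimately show ?thesis by simp
qed

text \<open>Finitely many points of an \<open>e\<close>-net lie near a bounded set, so doubling
  makes bounded sets totally bounded; completeness does the rest.\<close>

lemma bounded_closed_compact:
  fixes K :: "'a set"
  assumes "bounded K" "closed K"
  shows "compact K"
  unfolding compact_eq_totally_bounded
proof (intro conjI allI impI)
  show "complete K" using assms(2) complete_eq_closed by blast
  fix e :: real assume e: "0 < e"
  obtain S :: "'a set" where S: "is_net e S" using net_exists[OF e] by blast
  obtain a R where R: "\<And>x. x \<in> K \<Longrightarrow> dist a x \<le> R" using assms(1) by (auto simp: bounded_def)
  have fin: "finite {s \<in> S. dist s a < ((\<bar>R\<bar> + e) / e) * e}"
    using net_overlap[OF S e, of "(\<bar>R\<bar> + e) / e" a] e by auto
  show "\<exists>k. finite k \<and> K \<subseteq> (\<Union>x\<in>k. ball x e)"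
  proof (intro exI conjI)
    show "finite {s \<in> S. dist s a < \<bar>R\<bar> + e}" using fin e by simp
    show "K \<subseteq> (\<Union>x\<in>{s \<in> S. dist s a < \<bar>R\<bar> + e}. ball x e)"
    proof
      fix x assume x: "x \<in> K"
      obtain s where s: "s \<in> S" "dist s x < e" using S unfolding is_net_def by meson
      have "dist s a < \<bar>R\<bar> + e"
        using R[OF x] s(2) dist_triangle[of s a x] by (simp add: dist_commute)
      thus "x \<in> (\<Union>x\<in>{s \<in> S. dist s a < \<bar>R\<bar> + e}. ball x e)" using s by auto
    qed
  qed
qed

lemma mem_Cc_iff: "u \<in> Cc \<longleftrightarrow> continuous_on UNIV u \<and> bounded {x::'a. u x \<noteq> 0}"
proof
  assume "u \<in> Cc"
  thus "continuous_on UNIV u \<and> bounded {x. u x \<noteq> 0}"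
    using bounded_subset[OF compact_imp_bounded closure_subset] by (auto simp: Cc_def)
next
  assume "continuous_on UNIV u \<and> bounded {x. u x \<noteq> 0}"
  thus "u \<in> Cc" by (auto simp: Cc_def intro!: bounded_closed_compact)
qed

text \<open>The measure \<open>M\<close> is arbitrary since this cover, and the overlap bound after
  it, are applied both to \<open>m\<close> and to energy measures.\<close>

lemma nn_integral_net_cover:
  fixes S :: "'a set"
  assumes S: "is_net r S" "0 < r" and M[measurable_cong]: "sets M = sets borel"
    and [measurable]: "f \<in> borel_measurable borel" "A \<in> sets borel"
  shows "(\<integral>\<^sup>+x\<in>A. f x \<partial>M) \<le>
    (\<integral>\<^sup>+s. (\<integral>\<^sup>+x\<in>A \<inter> ball s r. f x \<partial>M) \<partial>count_space {s \<in> S. A \<inter> ball s r \<noteq> {}})"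
proof (rule nn_integral_countable_cover)
  show "countable {s \<in> S. A \<inter> ball s r \<noteq> {}}"
    by (rule countable_subset[OF _ net_countable[OF S]]) auto
  show "A \<subseteq> (\<Union>s\<in>{s \<in> S. A \<inter> ball s r \<noteq> {}}. ball s r)"
    using S(1) by (fastforce simp: is_net_def)
qed auto

lemma nn_integral_net_overlap:
  fixes S :: "'a set"
  assumes S: "is_net r S" "0 < r" and l: "0 < \<rho>" and M[measurable_cong]: "sets M = sets borel"
    and [measurable]: "f \<in> borel_measurable borel" "D \<in> sets borel"
    and T: "T \<subseteq> S" "\<And>s. s \<in> T \<Longrightarrow> ball s (\<rho> * r) \<subseteq> D"
  shows "(\<integral>\<^sup>+s. (\<integral>\<^sup>+x\<in>ball s (\<rho> * r). f x \<partial>M) \<partial>count_space T) \<le> of_nat (overlap \<rho>) * (\<integral>\<^sup>+x\<in>D. f x \<partial>M)"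
proof (rule nn_integral_bounded_overlap)
  show "countable T" by (rule countable_subset[OF T(1) net_countable[OF S]])
  fix x
  have "{s \<in> T. x \<in> ball s (\<rho> * r)} \<subseteq> {s \<in> S. dist s x < \<rho> * r}" using T(1) by auto
  thus "finite {s \<in> T. x \<in> ball s (\<rho> * r)}" "card {s \<in> T. x \<in> ball s (\<rho> * r)} \<le> overlap \<rho>"
    using net_overlap[OF S l, of x] by (auto intro: finite_subset order_trans[OF card_mono])
qed (use T(2) M in auto)

end

lemma (in p_energy_space) doubling_space_of_volume_doubling:
  assumes "volume_doubling m"
  shows "\<exists>c. doubling_space m c"
proof -
  obtain c where c: "1 \<le> c"
    "\<And>x r. 0 < r \<Longrightarrow> emeasure m (ball x (2 * r)) \<le> ennreal c * emeasure m (ball x r)"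
    using assms by (auto simp: volume_doubling_def)
  have pos: "0 < emeasure m (ball x r)" if "0 < r" for x r
    using m_full_support that by (auto simp: full_support_def)
  \<comment> \<open>Local compactness yields one ball of finite measure about each centre; doubling
    spreads finiteness to all radii.\<close>
  have fin: "emeasure m (ball x r) < \<infinity>" for x r
  proof -
    obtain U K where UK: "x \<in> U" "U \<subseteq> K" "compact K" "open U"
      using locally_compact unfolding locally_def by (metis UNIV_I open_openin openin_open_eq subtopology_UNIV topspace_euclidean openin_subtopology_self)
    then obtain e where e: "0 < e" "ball x e \<subseteq> U" using openE by blast
    have "emeasure m (ball x e) \<le> emeasure m K"
      using e UK m_radon by (intro emeasure_mono) (auto simp: radon_measure_def compact_imp_closed)
    also have "\<dots> < \<infinity>" using UK m_radon by (auto simp: radon_measure_def)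
    finally have f: "emeasure m (ball x e) < \<infinity>" .
    have f: "emeasure m (ball x (2 ^ n * e)) < \<infinity>" for n
    proof (induction n)
      case (Suc n)
      have "emeasure m (ball x (2 * (2 ^ n * e))) \<le> ennreal c * emeasure m (ball x (2 ^ n * e))"
        by (rule c) (use e in simp)
      also have "\<dots> < \<infinity>" using Suc by (simp add: ennreal_mult_less_top)
      finally show ?case by (simp add: mult.assoc)
    qed (use f in simp)
    obtain n :: nat where "r / e < n" using reals_Archimedean2 by blast
    also have "real n < 2 ^ n" by (rule of_nat_less_two_power)
    finally have "r < 2 ^ n * e" using e by (simp add: field_simps)
    hence "emeasure m (ball x r) \<le> emeasure m (ball x (2 ^ n * e))"
      using m_radon by (intro emeasure_mono) (auto simp: radon_measure_def)
    thus ?thesis using f[of n] by (simp add: le_less_trans)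
  qed
  have eq: "emeasure m (ball x r) = ennreal (measure m (ball x r))" for x r
    using fin[of x r] by (simp add: emeasure_eq_ennreal_measure less_top)
  have "doubling_space m c"
  proof
    show "sets m = sets borel" using m_radon by (simp add: radon_measure_def)
    fix x and r :: real assume r: "0 < r"
    show "0 < measure m (ball x r)" using pos[OF r, of x] eq[of x r] by (simp add: ennreal_less_zero_iff)
    show "measure m (ball x (2 * r)) \<le> c * measure m (ball x r)"
      using c(2)[OF r, of x] c(1) unfolding eq by (simp flip: ennreal_mult)
  qed (use c fin in auto)
  thus ?thesis ..
qed

section \<open>The Korevaar--Schoen energy\<close>

lemma powr_abs_add_le:
  fixes a b p :: real
  assumes "0 < p"
  shows "\<bar>a + b\<bar> powr p \<le> 2 powr p * (\<bar>a\<bar> powr p + \<bar>b\<bar> powr p)"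
proof -
  have "\<bar>a + b\<bar> powr p \<le> (2 * max \<bar>a\<bar> \<bar>b\<bar>) powr p"
    using assms by (intro powr_mono2) auto
  also have "\<dots> = 2 powr p * max \<bar>a\<bar> \<bar>b\<bar> powr p" by (simp add: powr_mult)
  also have "max \<bar>a\<bar> \<bar>b\<bar> powr p \<le> \<bar>a\<bar> powr p + \<bar>b\<bar> powr p" by (auto simp: max_def)
  finally show ?thesis by (simp add: mult_left_mono)
qed

lemma powr_abs_diff_le:
  fixes a b p :: real
  assumes "0 < p"
  shows "\<bar>a - b\<bar> powr p \<le> 2 powr p * (\<bar>a\<bar> powr p + \<bar>b\<bar> powr p)"
  using powr_abs_add_le[OF assms, of a "-b"] by simp

lemma divide_ennreal_eq_mult: "0 < v \<Longrightarrow> x / ennreal v = x * ennreal (1 / v)"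
  by (simp add: divide_ennreal_def inverse_ennreal inverse_eq_divide)

lemma nn_integral_cmult_add:
  assumes "f \<in> borel_measurable M" "g \<in> borel_measurable M"
  shows "(\<integral>\<^sup>+x. k * (f x + g x) \<partial>M) = k * ((\<integral>\<^sup>+x. f x \<partial>M) + (\<integral>\<^sup>+x. g x \<partial>M))"
  using assms by (simp add: nn_integral_cmult nn_integral_add)

text \<open>Not normalised: for functions of finite energy it decays like \<open>r powr \<beta>\<close>.\<close>

definition ks_energy :: "'a::metric_space measure \<Rightarrow> real \<Rightarrow> real \<Rightarrow> 'a set \<Rightarrow> ('a \<Rightarrow> real) \<Rightarrow> ennreal" where
  "ks_energy m p r \<Omega> g =
     (\<integral>\<^sup>+y\<in>\<Omega>. (\<integral>\<^sup>+x\<in>\<Omega> \<inter> ball y r. ennreal (\<bar>g x - g y\<bar> powr p) \<partial>m) / emeasure m (ball y r) \<partial>m)"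

context doubling_space
begin

lemma sets_ball [measurable]: "ball (x::'a) r \<in> sets borel"
  by simp

lemma measurable_ball_indicator [measurable]:
  "(\<lambda>z. indicator (ball (fst z) r) (snd z) :: ennreal) \<in> borel_measurable (borel \<Otimes>\<^sub>M (borel :: 'a measure))"
proof -
  have "{z::'a \<times> 'a. dist (fst z) (snd z) < r} \<in> sets (borel \<Otimes>\<^sub>M borel)"
    unfolding borel_prod by (intro borel_open open_Collect_less continuous_intros)
  hence "(indicator {z::'a \<times> 'a. dist (fst z) (snd z) < r} :: _ \<Rightarrow> ennreal) \<in> borel_measurable (borel \<Otimes>\<^sub>M (borel :: 'a measure))"
    by (rule borel_measurable_indicator)
  moreover have "indicator {z::'a \<times> 'a. dist (fst z) (snd z) < r} =
      (\<lambda>z. indicator (ball (fst z) r) (snd z) :: ennreal)"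
    by (auto simp: indicator_def fun_eq_iff)
  ultimately show ?thesis by simp
qed

lemma borel_measurable_emeasure_ball [measurable]:
  "(\<lambda>y. emeasure m (ball y r)) \<in> borel_measurable borel"
proof -
  have "(\<lambda>y. \<integral>\<^sup>+x. indicator (ball y r) x \<partial>m) \<in> borel_measurable borel"
    by (rule borel_measurable_nn_integral)
       (use measurable_ball_indicator[of r] in \<open>simp add: case_prod_beta'\<close>)
  thus ?thesis by simp
qed

text \<open>Needed for the joint measurability of the kernel of the nonlocal energy, whose ball has
  a radius depending on both points. A strict inequality between distances is an open condition on
  three points, and one of them is integrated out.\<close>

lemma borel_measurable_emeasure_ball_dist:
  "(\<lambda>z. emeasure m (ball (fst z) (dist (snd z) (fst z)))) \<in> borel_measurable (borel \<Otimes>\<^sub>M (borel :: 'a measure))"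
proof -
  have "{w::('a \<times> 'a) \<times> 'a. dist (fst (fst w)) (snd w) < dist (snd (fst w)) (fst (fst w))}
      \<in> sets ((borel \<Otimes>\<^sub>M borel) \<Otimes>\<^sub>M borel)"
    unfolding borel_prod by (intro borel_open open_Collect_less continuous_intros)
  hence *: "(indicator {w::('a \<times> 'a) \<times> 'a. dist (fst (fst w)) (snd w) < dist (snd (fst w)) (fst (fst w))} :: _ \<Rightarrow> ennreal)
      \<in> borel_measurable ((borel \<Otimes>\<^sub>M borel) \<Otimes>\<^sub>M (borel :: 'a measure))"
    by (rule borel_measurable_indicator)
  have "(\<lambda>z. \<integral>\<^sup>+x. indicator (ball (fst z) (dist (snd z) (fst z))) x \<partial>m)
      \<in> borel_measurable (borel \<Otimes>\<^sub>M (borel :: 'a measure))"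
  proof (rule borel_measurable_nn_integral)
    have "(\<lambda>(z, x). indicator (ball (fst z) (dist (snd z) (fst z))) x :: ennreal) =
        indicator {w::('a \<times> 'a) \<times> 'a. dist (fst (fst w)) (snd w) < dist (snd (fst w)) (fst (fst w))}"
      by (auto simp: indicator_def fun_eq_iff)
    thus "(\<lambda>(z, x). indicator (ball (fst z) (dist (snd z) (fst z))) x :: ennreal)
        \<in> borel_measurable ((borel \<Otimes>\<^sub>M borel) \<Otimes>\<^sub>M m)" using * by simp
  qed
  thus ?thesis by simp
qed

lemma borel_measurable_ks_inner [measurable]:
  assumes [measurable]: "g \<in> borel_measurable borel" "D \<in> sets borel"
  shows "(\<lambda>y. \<integral>\<^sup>+x\<in>D \<inter> ball y r. ennreal (\<bar>g x - g y\<bar> powr p) \<partial>m) \<in> borel_measurable borel"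
proof (rule borel_measurable_nn_integral)
  have "(\<lambda>z. ennreal (\<bar>g (snd z) - g (fst z)\<bar> powr p) * (indicator D (snd z) * indicator (ball (fst z) r) (snd z)))
      \<in> borel_measurable (borel \<Otimes>\<^sub>M (borel :: 'a measure))" by measurable
  thus "(\<lambda>(y, x). ennreal (\<bar>g x - g y\<bar> powr p) * indicator (D \<inter> ball y r) x) \<in> borel_measurable (borel \<Otimes>\<^sub>M m)"
    by (simp add: case_prod_beta' indicator_inter_arith)
qed

lemma ks_energy_cong:
  assumes "AE x in m. x \<in> \<Omega> \<longrightarrow> f x = g x"
  shows "ks_energy m p r \<Omega> f = ks_energy m p r \<Omega> g"
  unfolding ks_energy_def
proof (rule nn_integral_cong_AE, use assms in eventually_elim)
  case (elim y)
  have "(\<integral>\<^sup>+x\<in>\<Omega> \<inter> ball y r. ennreal (\<bar>f x - f y\<bar> powr p) \<partial>m) =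
      (\<integral>\<^sup>+x\<in>\<Omega> \<inter> ball y r. ennreal (\<bar>g x - g y\<bar> powr p) \<partial>m)" if "y \<in> \<Omega>"
    by (rule nn_integral_cong_AE, use assms in eventually_elim) (use elim that in \<open>auto simp: indicator_def\<close>)
  thus ?case by (auto simp: indicator_def)
qed

text \<open>For \<open>y\<close> in \<open>ball s r\<close> and \<open>x\<close> in
  \<open>ball y r\<close> both points lie in \<open>ball s (2 * r)\<close>, so \<open>g x\<close>
  and \<open>g y\<close> can be compared through a constant \<open>a s\<close>. The constants stay
  free: means lead to the Poincare inequality, zeros to an \<open>L^p\<close> bound. One factor
  \<open>c\<close> comes from moving the centre of a ball from \<open>y\<close> to \<open>s\<close>,
  and \<open>1 + c\<close> bounds the volumes of the two balls about \<open>s\<close> against the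
  smaller one.\<close>

lemma ks_energy_le_net:
  fixes S :: "'a set"
  assumes [measurable]: "g \<in> borel_measurable borel" "\<Omega> \<in> sets borel"
    and S: "is_net r S" "0 < r" and p: "0 < p"
  shows "ks_energy m p r \<Omega> g \<le> ennreal (c * 2 powr p * (1 + c)) *
    (\<integral>\<^sup>+s. (\<integral>\<^sup>+x\<in>ball s (2 * r). ennreal (\<bar>g x - a s\<bar> powr p) \<partial>m)
      \<partial>count_space {s \<in> S. \<Omega> \<inter> ball s r \<noteq> {}})"
proof -
  let ?T = "{s \<in> S. \<Omega> \<inter> ball s r \<noteq> {}}"
  define h where "h y = (\<integral>\<^sup>+x\<in>\<Omega> \<inter> ball y r. ennreal (\<bar>g x - g y\<bar> powr p) \<partial>m) / emeasure m (ball y r)" for y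
  have hm[measurable]: "h \<in> borel_measurable borel" unfolding h_def by measurable
  define G where "G s = (\<integral>\<^sup>+x\<in>ball s (2 * r). ennreal (\<bar>g x - a s\<bar> powr p) \<partial>m)" for s
  have step: "(\<integral>\<^sup>+y\<in>\<Omega> \<inter> ball s r. h y \<partial>m) \<le> ennreal (c * 2 powr p * (1 + c)) * G s" for s
  proof -
    let ?v = "vol s r" and ?w = "vol s (2 * r)"
    have v: "0 < ?v" using S by (simp add: vol_pos)
    let ?k = "ennreal (c * 2 powr p / ?v)"
    have hb: "h y \<le> ?k * (G s + ennreal (\<bar>g y - a s\<bar> powr p) * ennreal ?w)" if y: "y \<in> ball s r" for y
    proof -
      have "vol s r \<le> c ^ 1 * vol y r"
        by (rule vol_le) (use y S in \<open>auto simp: dist_commute\<close>)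
      hence vy: "1 / vol y r \<le> c / ?v" using v vol_pos[OF S(2), of y] by (simp add: field_simps)
      have "(\<integral>\<^sup>+x\<in>\<Omega> \<inter> ball y r. ennreal (\<bar>g x - g y\<bar> powr p) \<partial>m) \<le>
          (\<integral>\<^sup>+x. ennreal (2 powr p) * (ennreal (\<bar>g x - a s\<bar> powr p) * indicator (ball s (2 * r)) x
             + ennreal (\<bar>g y - a s\<bar> powr p) * indicator (ball s (2 * r)) x) \<partial>m)"
      proof (rule nn_integral_mono)
        fix x
        show "ennreal (\<bar>g x - g y\<bar> powr p) * indicator (\<Omega> \<inter> ball y r) x \<le>
          ennreal (2 powr p) * (ennreal (\<bar>g x - a s\<bar> powr p) * indicator (ball s (2 * r)) x
             + ennreal (\<bar>g y - a s\<bar> powr p) * indicator (ball s (2 * r)) x)"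
        proof (cases "x \<in> ball y r")
          case True
          hence "x \<in> ball s (2 * r)" using y dist_triangle[of s x y] by simp
          moreover have "\<bar>g x - g y\<bar> powr p \<le> 2 powr p * (\<bar>g x - a s\<bar> powr p + \<bar>g y - a s\<bar> powr p)"
            using powr_abs_diff_le[OF p, of "g x - a s" "g y - a s"] by simp
          ultimately show ?thesis
            by (auto simp: indicator_def ennreal_mult[symmetric] ennreal_plus[symmetric] simp del: ennreal_plus)
        qed simp
      qed
      also have "\<dots> = ennreal (2 powr p) * (G s + ennreal (\<bar>g y - a s\<bar> powr p) * ennreal ?w)"
      proof (rule trans[OF nn_integral_cmult_add])
        have "(\<integral>\<^sup>+x. ennreal (\<bar>g y - a s\<bar> powr p) * indicator (ball s (2 * r)) x \<partial>m) =
            ennreal (\<bar>g y - a s\<bar> powr p) * ennreal ?w"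
          unfolding emeasure_ball[symmetric] by (rule nn_integral_cmult_indicator) simp
        thus "ennreal (2 powr p) * ((\<integral>\<^sup>+x\<in>ball s (2 * r). ennreal (\<bar>g x - a s\<bar> powr p) \<partial>m) +
            (\<integral>\<^sup>+x\<in>ball s (2 * r). ennreal (\<bar>g y - a s\<bar> powr p) \<partial>m)) =
            ennreal (2 powr p) * (G s + ennreal (\<bar>g y - a s\<bar> powr p) * ennreal ?w)"
          unfolding G_def by (simp only:)
      qed measurable
      finally have "h y \<le> ennreal (2 powr p) * (G s + ennreal (\<bar>g y - a s\<bar> powr p) * ennreal ?w) * ennreal (1 / vol y r)"
        unfolding h_def emeasure_ball[of y r] divide_ennreal_eq_mult[OF vol_pos[OF S(2)]]
        by (rule mult_right_mono) simp
      also have "\<dots> \<le> ennreal (2 powr p) * (G s + ennreal (\<bar>g y - a s\<bar> powr p) * ennreal ?w) * ennreal (c / ?v)"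
        by (rule mult_left_mono[OF ennreal_leI[OF vy]]) simp
      also have "\<dots> = ?k * (G s + ennreal (\<bar>g y - a s\<bar> powr p) * ennreal ?w)"
      proof -
        have "?k = ennreal (2 powr p) * ennreal (c / ?v)"
          using c v by (subst ennreal_mult[symmetric]) (auto simp: mult.commute)
        thus ?thesis by (simp only: mult_ac)
      qed
      finally show ?thesis .
    qed
    have "(\<integral>\<^sup>+y\<in>\<Omega> \<inter> ball s r. h y \<partial>m) \<le>
        (\<integral>\<^sup>+y. ?k * (G s * indicator (ball s r) y
           + ennreal ?w * (ennreal (\<bar>g y - a s\<bar> powr p) * indicator (ball s (2 * r)) y)) \<partial>m)"
    proof (rule nn_integral_mono)
      fix y
      show "h y * indicator (\<Omega> \<inter> ball s r) y \<le> ?k * (G s * indicator (ball s r) y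
           + ennreal ?w * (ennreal (\<bar>g y - a s\<bar> powr p) * indicator (ball s (2 * r)) y))"
        using hb[of y] S(2) by (auto simp: indicator_def mult.commute)
    qed
    also have "\<dots> = ?k * (G s * ennreal ?v + ennreal ?w * G s)"
    proof (rule trans[OF nn_integral_cmult_add])
      have "(\<integral>\<^sup>+y. G s * indicator (ball s r) y \<partial>m) = G s * ennreal ?v"
        unfolding emeasure_ball[symmetric] by (rule nn_integral_cmult_indicator) simp
      moreover have "(\<integral>\<^sup>+y. ennreal ?w * (ennreal (\<bar>g y - a s\<bar> powr p) * indicator (ball s (2 * r)) y) \<partial>m) = ennreal ?w * G s"
        unfolding G_def by (rule nn_integral_cmult) measurable
      ultimately show "?k * ((\<integral>\<^sup>+y. G s * indicator (ball s r) y \<partial>m) +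
          (\<integral>\<^sup>+y. ennreal ?w * (ennreal (\<bar>g y - a s\<bar> powr p) * indicator (ball s (2 * r)) y) \<partial>m)) =
          ?k * (G s * ennreal ?v + ennreal ?w * G s)" by (simp only:)
    qed measurable
    also have "\<dots> \<le> ?k * (G s * ennreal ?v + ennreal (c * ?v) * G s)"
      using doubling[OF S(2), of s] by (intro mult_left_mono add_left_mono mult_right_mono ennreal_leI) auto
    also have "\<dots> = ?k * (ennreal ((1 + c) * ?v) * G s)"
      using c v by (simp add: distrib_right mult.commute[of "G s"] ennreal_plus)
    also have "\<dots> = ennreal (c * 2 powr p * (1 + c)) * G s"
    proof -
      have "?k * ennreal ((1 + c) * ?v) = ennreal (c * 2 powr p * (1 + c))"
        using c v by (subst ennreal_mult[symmetric]) auto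
      thus ?thesis by (simp only: mult.assoc[symmetric])
    qed
    finally show ?thesis .
  qed
  have "ks_energy m p r \<Omega> g = (\<integral>\<^sup>+y\<in>\<Omega>. h y \<partial>m)" by (simp add: ks_energy_def h_def)
  also have "\<dots> \<le> (\<integral>\<^sup>+s. (\<integral>\<^sup>+y\<in>\<Omega> \<inter> ball s r. h y \<partial>m) \<partial>count_space ?T)"
    by (rule nn_integral_net_cover[OF S]) auto
  also have "\<dots> \<le> (\<integral>\<^sup>+s. ennreal (c * 2 powr p * (1 + c)) * G s \<partial>count_space ?T)"
    by (intro nn_integral_mono step)
  also have "\<dots> = ennreal (c * 2 powr p * (1 + c)) * (\<integral>\<^sup>+s. G s \<partial>count_space ?T)"
    by (rule nn_integral_cmult) simp
  finally show ?thesis by (simp add: G_def)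
qed

text \<open>The bound does not decay as \<open>r\<close> tends to \<open>0\<close>; it serves for
  scales bounded away from zero.\<close>

lemma ks_energy_le_Lp:
  assumes [measurable]: "g \<in> borel_measurable borel" "\<Omega> \<in> sets borel" and r: "0 < r" and p: "0 < p"
  shows "ks_energy m p r \<Omega> g \<le>
    ennreal (c * 2 powr p * (1 + c) * overlap 2) * (\<integral>\<^sup>+x. ennreal (\<bar>g x\<bar> powr p) \<partial>m)"
proof -
  obtain S :: "'a set" where S: "is_net r S" using net_exists[OF r] by blast
  let ?K = "c * 2 powr p * (1 + c)"
  have "ks_energy m p r \<Omega> g \<le> ennreal ?K *
      (\<integral>\<^sup>+s. (\<integral>\<^sup>+x\<in>ball s (2 * r). ennreal (\<bar>g x - 0\<bar> powr p) \<partial>m)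
        \<partial>count_space {s \<in> S. \<Omega> \<inter> ball s r \<noteq> {}})"
    by (rule ks_energy_le_net) (use S r p in auto)
  also have "\<dots> \<le> ennreal ?K * (of_nat (overlap 2) * (\<integral>\<^sup>+x\<in>UNIV. ennreal (\<bar>g x - 0\<bar> powr p) \<partial>m))"
    by (intro mult_left_mono nn_integral_net_overlap[OF S r]) auto
  also have "\<dots> = ennreal (?K * overlap 2) * (\<integral>\<^sup>+x. ennreal (\<bar>g x\<bar> powr p) \<partial>m)"
    using c by (simp add: ennreal_mult mult.assoc ennreal_of_nat_eq_real_of_nat)
  finally show ?thesis .
qed

lemma ks_energy_diff_le:
  assumes [measurable]: "f \<in> borel_measurable borel" "g \<in> borel_measurable borel" "\<Omega> \<in> sets borel"
    and p: "0 < p"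
  shows "ks_energy m p r \<Omega> (\<lambda>x. f x - g x) \<le>
    ennreal (2 powr p) * (ks_energy m p r \<Omega> f + ks_energy m p r \<Omega> g)"
proof -
  let ?I = "\<lambda>h y. \<integral>\<^sup>+x\<in>\<Omega> \<inter> ball y r. ennreal (\<bar>h x - h y\<bar> powr p) \<partial>m"
  let ?h = "\<lambda>x. f x - g x"
  have le: "?I ?h y \<le> ennreal (2 powr p) * (?I f y + ?I g y)" for y
  proof -
    have "?I ?h y \<le> (\<integral>\<^sup>+x. ennreal (2 powr p) * (ennreal (\<bar>f x - f y\<bar> powr p) * indicator (\<Omega> \<inter> ball y r) x
        + ennreal (\<bar>g x - g y\<bar> powr p) * indicator (\<Omega> \<inter> ball y r) x) \<partial>m)"
    proof (rule nn_integral_mono)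
      fix x
      have "\<bar>?h x - ?h y\<bar> powr p \<le> 2 powr p * (\<bar>f x - f y\<bar> powr p + \<bar>g x - g y\<bar> powr p)"
        using powr_abs_diff_le[OF p, of "f x - f y" "g x - g y"] by (simp add: algebra_simps)
      thus "ennreal (\<bar>?h x - ?h y\<bar> powr p) * indicator (\<Omega> \<inter> ball y r) x \<le>
          ennreal (2 powr p) * (ennreal (\<bar>f x - f y\<bar> powr p) * indicator (\<Omega> \<inter> ball y r) x
        + ennreal (\<bar>g x - g y\<bar> powr p) * indicator (\<Omega> \<inter> ball y r) x)"
        by (auto simp: indicator_def ennreal_mult[symmetric] ennreal_plus[symmetric] simp del: ennreal_plus)
    qed
    also have "\<dots> = ennreal (2 powr p) * (?I f y + ?I g y)"
      by (rule nn_integral_cmult_add) measurable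
    finally show ?thesis .
  qed
  have "ks_energy m p r \<Omega> ?h \<le> (\<integral>\<^sup>+y. ennreal (2 powr p) *
      (?I f y / emeasure m (ball y r) * indicator \<Omega> y + ?I g y / emeasure m (ball y r) * indicator \<Omega> y) \<partial>m)"
    unfolding ks_energy_def
  proof (rule nn_integral_mono)
    fix y
    have "?I ?h y / emeasure m (ball y r) \<le> ennreal (2 powr p) * (?I f y + ?I g y) / emeasure m (ball y r)"
      by (rule divide_right_mono_ennreal[OF le])
    thus "?I ?h y / emeasure m (ball y r) * indicator \<Omega> y \<le> ennreal (2 powr p) *
      (?I f y / emeasure m (ball y r) * indicator \<Omega> y + ?I g y / emeasure m (ball y r) * indicator \<Omega> y)"
      by (cases "y \<in> \<Omega>") (simp_all add: divide_ennreal_def distrib_left distrib_right mult.assoc)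
  qed
  also have "\<dots> = ennreal (2 powr p) * (ks_energy m p r \<Omega> f + ks_energy m p r \<Omega> g)"
    unfolding ks_energy_def by (rule nn_integral_cmult_add) measurable
  finally show ?thesis .
qed

end

section \<open>The energy norm\<close>

text \<open>The tangent of \<open>t powr p\<close> at \<open>a\<close> lies below the graph. Young's
  inequality with exponents \<open>p\<close> and \<open>p / (p - 1)\<close> shows this without
  derivatives.\<close>

lemma powr_tangent_le:
  fixes p t a :: real
  assumes p: "1 < p" and "0 \<le> t" "0 \<le> a"
  shows "p * a powr (p - 1) * t \<le> t powr p + (p - 1) * a powr p"
proof -
  have "t * a powr (p - 1) \<le> t powr p / p + (a powr (p - 1)) powr (p / (p - 1)) / (p / (p - 1))"
    by (rule Youngs_inequality) (use assms in \<open>auto simp: field_simps\<close>)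
  also have "(a powr (p - 1)) powr (p / (p - 1)) = a powr p"
    using p by (simp add: powr_powr)
  finally show ?thesis using p by (simp add: field_simps)
qed

text \<open>The weighted sum of the tangent inequalities at the mean
  \<open>x * a + y * b\<close>.\<close>

lemma powr_convex_combination:
  fixes p a b x y :: real
  assumes p: "1 < p" and xy: "0 \<le> x" "0 \<le> y" "x + y = 1" and ab: "0 \<le> a" "0 \<le> b"
  shows "(x * a + y * b) powr p \<le> x * a powr p + y * b powr p"
proof -
  let ?m = "x * a + y * b"
  have m: "0 \<le> ?m" using xy ab by simp
  have "x * (p * ?m powr (p - 1) * a) + y * (p * ?m powr (p - 1) * b) \<le>
      x * (a powr p + (p - 1) * ?m powr p) + y * (b powr p + (p - 1) * ?m powr p)"
    using powr_tangent_le[OF p _ m] xy ab by (intro add_mono mult_left_mono) auto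
  also have "\<dots> = x * a powr p + y * b powr p + (x + y) * ((p - 1) * ?m powr p)"
    by (simp add: algebra_simps)
  also have "x * (p * ?m powr (p - 1) * a) + y * (p * ?m powr (p - 1) * b) = p * (?m * ?m powr (p - 1))"
    by (simp add: algebra_simps)
  also have "?m * ?m powr (p - 1) = ?m powr p"
    using m p powr_mult_base[of ?m "p - 1"] by simp
  finally show ?thesis using xy by (simp add: algebra_simps)
qed

section \<open>Minkowski's and Jensen's inequalities\<close>

lemma Lp_space_iff:
  "u \<in> Lp_space m p \<longleftrightarrow> u \<in> borel_measurable m \<and> integrable m (\<lambda>x. \<bar>u x\<bar> powr p)"
  by (simp add: Lp_space_def)

lemma Lp_norm_nonneg: "0 \<le> Lp_norm m p u"
  by (simp add: Lp_norm_def)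

lemma Lp_norm_powr:
  assumes "0 < p" shows "Lp_norm m p u powr p = (\<integral>x. \<bar>u x\<bar> powr p \<partial>m)"
  using assms by (simp add: Lp_norm_def powr_powr integral_nonneg)

lemma nn_integral_Lp:
  assumes "u \<in> Lp_space m p" "0 < p"
  shows "(\<integral>\<^sup>+x. ennreal (\<bar>u x\<bar> powr p) \<partial>m) = ennreal (Lp_norm m p u powr p)"
  using assms by (simp add: Lp_norm_powr Lp_space_iff nn_integral_eq_integral)

lemma Lp_norm_leI:
  assumes p: "0 < p" and a: "0 \<le> a" and "(\<integral>x. \<bar>u x\<bar> powr p \<partial>m) \<le> a powr p"
  shows "Lp_norm m p u \<le> a"
proof -
  have "Lp_norm m p u \<le> (a powr p) powr (1 / p)"
    unfolding Lp_norm_def using assms by (intro powr_mono2) (auto simp: integral_nonneg)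
  thus ?thesis using p a by (simp add: powr_powr)
qed

lemma Lp_norm_scale:
  assumes p: "0 < p"
  shows "Lp_norm m p (\<lambda>x. c * u x) = \<bar>c\<bar> * Lp_norm m p u"
proof -
  have "(\<integral>x. \<bar>c * u x\<bar> powr p \<partial>m) = \<bar>c\<bar> powr p * (\<integral>x. \<bar>u x\<bar> powr p \<partial>m)"
    by (simp add: abs_mult powr_mult)
  thus ?thesis
    using p by (simp add: Lp_norm_def powr_mult powr_powr integral_nonneg)
qed

text \<open>Minkowski's inequality from convexity: \<open>u\<close> and \<open>v\<close> are
  normalised by \<open>s\<close> and \<open>t\<close>, and the sum is a convex combination with
  weights proportional to \<open>s\<close> and \<open>t\<close>, scaled by
  \<open>s + t\<close>.\<close>

lemma Lp_norm_triangle: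
  assumes p: "1 < p" and u: "u \<in> Lp_space m p" and v: "v \<in> Lp_space m p"
  shows "(\<lambda>x. u x + v x) \<in> Lp_space m p \<and> Lp_norm m p (\<lambda>x. u x + v x) \<le> Lp_norm m p u + Lp_norm m p v"
proof
  have [measurable]: "u \<in> borel_measurable m" "v \<in> borel_measurable m"
    and iu: "integrable m (\<lambda>x. \<bar>u x\<bar> powr p)" and iv: "integrable m (\<lambda>x. \<bar>v x\<bar> powr p)"
    using u v by (auto simp: Lp_space_iff)
  have int: "integrable m (\<lambda>x. \<bar>u x + v x\<bar> powr p)"
    by (rule Bochner_Integration.integrable_bound[of _ "\<lambda>x. 2 powr p * (\<bar>u x\<bar> powr p + \<bar>v x\<bar> powr p)"])
       (use iu iv p powr_abs_add_le[of p] in auto)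
  thus "(\<lambda>x. u x + v x) \<in> Lp_space m p" by (simp add: Lp_space_iff)
  show "Lp_norm m p (\<lambda>x. u x + v x) \<le> Lp_norm m p u + Lp_norm m p v"
  proof (rule field_le_epsilon)
    fix e :: real assume e: "0 < e"
    \<comment> \<open>The summand \<open>e / 2\<close> keeps \<open>s\<close> and \<open>t\<close>
      positive when a norm vanishes.\<close>
    define s where "s = Lp_norm m p u + e / 2"
    define t where "t = Lp_norm m p v + e / 2"
    have st: "0 < s" "0 < t" using e Lp_norm_nonneg[of m p] by (auto simp: s_def t_def add_nonneg_pos)
    let ?x = "s / (s + t)" and ?y = "t / (s + t)"
    have "(\<integral>x. \<bar>u x + v x\<bar> powr p \<partial>m) \<le>
        (\<integral>x. (s + t) powr p * (?x * (\<bar>u x\<bar> powr p / s powr p) + ?y * (\<bar>v x\<bar> powr p / t powr p)) \<partial>m)"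
    proof (rule integral_mono[OF int])
      fix x
      have "\<bar>u x + v x\<bar> powr p \<le> ((s + t) * (?x * (\<bar>u x\<bar> / s) + ?y * (\<bar>v x\<bar> / t))) powr p"
        using st p by (intro powr_mono2) (auto simp: distrib_left)
      also have "\<dots> = (s + t) powr p * (?x * (\<bar>u x\<bar> / s) + ?y * (\<bar>v x\<bar> / t)) powr p"
        using st by (intro powr_mult)
      also have "\<dots> \<le> (s + t) powr p * (?x * (\<bar>u x\<bar> / s) powr p + ?y * (\<bar>v x\<bar> / t) powr p)"
        using st by (intro mult_left_mono powr_convex_combination[OF p])
          (auto simp flip: add_divide_distrib)
      finally show "\<bar>u x + v x\<bar> powr p \<le>
          (s + t) powr p * (?x * (\<bar>u x\<bar> powr p / s powr p) + ?y * (\<bar>v x\<bar> powr p / t powr p))"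
        using st by (simp add: powr_divide)
    qed (use iu iv in auto)
    also have "\<dots> = (s + t) powr p * (?x * (Lp_norm m p u powr p / s powr p) + ?y * (Lp_norm m p v powr p / t powr p))"
      using iu iv p by (simp add: Lp_norm_powr)
    also have "\<dots> \<le> (s + t) powr p * (?x * 1 + ?y * 1)"
    proof -
      have "Lp_norm m p u powr p / s powr p \<le> 1" "Lp_norm m p v powr p / t powr p \<le> 1"
        using st e p Lp_norm_nonneg by (auto simp: s_def t_def intro!: powr_mono2)
      thus ?thesis using st by (intro mult_left_mono add_mono) auto
    qed
    also have "\<dots> = (s + t) powr p" using st by (simp flip: add_divide_distrib)
    finally have "Lp_norm m p (\<lambda>x. u x + v x) \<le> s + t"
      using st p by (intro Lp_norm_leI) auto
    thus "Lp_norm m p (\<lambda>x. u x + v x) \<le> Lp_norm m p u + Lp_norm m p v + e"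
      by (simp add: s_def t_def)
  qed
qed

lemma Lp_norm_mono:
  assumes p: "0 < p" and "v \<in> Lp_space m p" "u \<in> borel_measurable m" "\<And>x. \<bar>u x\<bar> \<le> \<bar>v x\<bar>"
  shows "Lp_norm m p u \<le> Lp_norm m p v"
proof (rule Lp_norm_leI[OF p Lp_norm_nonneg])
  have "\<bar>u x\<bar> powr p \<le> \<bar>v x\<bar> powr p" for x using p assms by (intro powr_mono2) auto
  hence "(\<integral>x. \<bar>u x\<bar> powr p \<partial>m) \<le> (\<integral>x. \<bar>v x\<bar> powr p \<partial>m)"
  proof (intro integral_mono)
    show iv: "integrable m (\<lambda>x. \<bar>v x\<bar> powr p)" using assms by (simp add: Lp_space_iff)
    have [measurable]: "u \<in> borel_measurable m" by fact
    show "integrable m (\<lambda>x. \<bar>u x\<bar> powr p)"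
      by (rule Bochner_Integration.integrable_bound[OF iv]) (use \<open>\<And>x. \<bar>u x\<bar> powr p \<le> \<bar>v x\<bar> powr p\<close> in auto)
  qed
  thus "(\<integral>x. \<bar>u x\<bar> powr p \<partial>m) \<le> Lp_norm m p v powr p" using p by (simp add: Lp_norm_powr)
qed

lemma Lp_norm_cong_AE:
  assumes "u \<in> borel_measurable m" "v \<in> borel_measurable m" "AE x in m. u x = v x"
  shows "Lp_norm m p u = Lp_norm m p v"
proof -
  have "(\<integral>x. \<bar>u x\<bar> powr p \<partial>m) = (\<integral>x. \<bar>v x\<bar> powr p \<partial>m)"
    by (rule integral_cong_AE) (use assms in auto)
  thus ?thesis by (simp add: Lp_norm_def)
qed

lemma ennreal_add_le_cancel:
  assumes "ennreal a \<le> x + ennreal b" "0 \<le> a" "0 \<le> b"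
  shows "ennreal (a - b) \<le> x"
proof (cases x)
  case (real r)
  hence "a \<le> r + b" using assms by (simp add: ennreal_plus[symmetric] del: ennreal_plus)
  thus ?thesis using real by (simp add: ennreal_leI)
qed simp

text \<open>With \<open>a\<close> the distance of the mean from \<open>k\<close>, the tangent
  inequality at \<open>a\<close> is integrated over \<open>B\<close>. Since
  \<open>a * measure m B\<close> is at most the integral of the distance of \<open>f\<close> to
  \<open>k\<close>, this leaves \<open>p * a powr p\<close> on the left against
  \<open>(p - 1) * a powr p\<close> on the right, each times the finite measure of
  \<open>B\<close>.\<close>

lemma jensen_mean_value:
  assumes p: "1 < p" and B[measurable]: "B \<in> sets m" and fin: "emeasure m B < \<infinity>" and pos: "0 < measure m B"
    and f: "set_integrable m B f" and [measurable]: "f \<in> borel_measurable m"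
  shows "ennreal (\<bar>mean_value m B f - k\<bar> powr p * measure m B) \<le> (\<integral>\<^sup>+x\<in>B. ennreal (\<bar>f x - k\<bar> powr p) \<partial>m)"
proof -
  define a where "a = \<bar>mean_value m B f - k\<bar>"
  let ?V = "measure m B"
  have Bk: "set_integrable m B (\<lambda>x. k)"
    unfolding set_integrable_def
    by (rule integrable_scaleR_left) (use fin in \<open>auto simp: integrable_indicator_iff\<close>)
  have fk: "set_integrable m B (\<lambda>x. f x - k)"
    using set_integral_diff(1)[OF f Bk] .
  have "(LINT x:B|m. f x - k) = (LINT x:B|m. f x) - k * ?V"
    using set_integral_diff(2)[OF f Bk] by (simp add: set_lebesgue_integral_def mult.commute)
  hence "(LINT x:B|m. f x - k) = (mean_value m B f - k) * ?V"
  proof -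
    have "mean_value m B f * ?V = (LINT x:B|m. f x)" using pos by (simp add: mean_value_def)
    thus ?thesis using \<open>(LINT x:B|m. f x - k) = (LINT x:B|m. f x) - k * ?V\<close>
      by (simp add: left_diff_distrib)
  qed
  hence "a * ?V = \<bar>LINT x:B|m. f x - k\<bar>" using pos by (simp add: a_def abs_mult)
  also have "\<dots> \<le> (LINT x:B|m. \<bar>f x - k\<bar>)"
    using set_integral_norm_bound[OF fk] by simp
  finally have aV: "a * ?V \<le> (LINT x:B|m. \<bar>f x - k\<bar>)" .
  have a: "0 \<le> a" by (simp add: a_def)
  have "p * a powr p * ?V = p * a powr (p - 1) * (a * ?V)"
    using a p powr_mult_base[of a "p - 1"] by (simp add: mult_ac)
  also have "\<dots> \<le> p * a powr (p - 1) * (LINT x:B|m. \<bar>f x - k\<bar>)"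
    using aV p by (intro mult_left_mono) auto
  finally have "ennreal (p * a powr p * ?V) \<le> ennreal (p * a powr (p - 1)) * ennreal (LINT x:B|m. \<bar>f x - k\<bar>)"
    using p by (subst ennreal_mult[symmetric])
      (auto simp: set_lebesgue_integral_def intro!: integral_nonneg ennreal_leI)
  also have "ennreal (LINT x:B|m. \<bar>f x - k\<bar>) = (\<integral>\<^sup>+x\<in>B. ennreal \<bar>f x - k\<bar> \<partial>m)"
    using set_integrable_abs[OF fk] unfolding set_lebesgue_integral_def set_integrable_def
    by (subst nn_integral_eq_integral[symmetric]) (auto simp: indicator_def intro!: nn_integral_cong)
  also have "ennreal (p * a powr (p - 1)) * (\<integral>\<^sup>+x\<in>B. ennreal \<bar>f x - k\<bar> \<partial>m) =
      (\<integral>\<^sup>+x. ennreal (p * a powr (p - 1)) * (ennreal \<bar>f x - k\<bar> * indicator B x) \<partial>m)"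
    by (rule nn_integral_cmult[symmetric]) measurable
  also have "\<dots> \<le> (\<integral>\<^sup>+x. ennreal (\<bar>f x - k\<bar> powr p) * indicator B x + ennreal ((p - 1) * a powr p) * indicator B x \<partial>m)"
  proof (rule nn_integral_mono)
    fix x
    have "p * a powr (p - 1) * \<bar>f x - k\<bar> \<le> \<bar>f x - k\<bar> powr p + (p - 1) * a powr p"
      by (rule powr_tangent_le[OF p]) (use a in auto)
    thus "ennreal (p * a powr (p - 1)) * (ennreal \<bar>f x - k\<bar> * indicator B x) \<le>
        ennreal (\<bar>f x - k\<bar> powr p) * indicator B x + ennreal ((p - 1) * a powr p) * indicator B x"
      using p by (auto simp: indicator_def ennreal_mult[symmetric] ennreal_plus[symmetric] simp del: ennreal_plus)
  qed
  also have "\<dots> = (\<integral>\<^sup>+x\<in>B. ennreal (\<bar>f x - k\<bar> powr p) \<partial>m) + (\<integral>\<^sup>+x. ennreal ((p - 1) * a powr p) * indicator B x \<partial>m)"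
    by (rule nn_integral_add) measurable
  also have "(\<integral>\<^sup>+x. ennreal ((p - 1) * a powr p) * indicator B x \<partial>m) = ennreal ((p - 1) * a powr p) * emeasure m B"
    by (rule nn_integral_cmult_indicator) simp
  also have "emeasure m B = ennreal ?V" using fin by (simp add: emeasure_eq_ennreal_measure less_top)
  also have "ennreal ((p - 1) * a powr p) * ennreal ?V = ennreal ((p - 1) * a powr p * ?V)"
    using p by (simp add: ennreal_mult)
  finally have "ennreal (p * a powr p * ?V - (p - 1) * a powr p * ?V) \<le> (\<integral>\<^sup>+x\<in>B. ennreal (\<bar>f x - k\<bar> powr p) \<partial>m)"
    using p by (intro ennreal_add_le_cancel) auto
  thus ?thesis by (simp add: a_def algebra_simps)
qed

section \<open>The energy norm on \<open>F\<close>: Mazur's lemma and lattice operations\<close>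

context p_energy_space
begin

lemma sets_m_borel [measurable_cong]: "sets m = sets borel"
  using m_radon by (simp add: radon_measure_def)

lemma F_measurable: "u \<in> F \<Longrightarrow> u \<in> borel_measurable borel"
  using F_Lp measurable_cong_sets[OF sets_m_borel refl] by (auto simp: Lp_space_def)

lemma F_measurable_m: "u \<in> F \<Longrightarrow> u \<in> borel_measurable m"
  using F_Lp by (auto simp: Lp_space_def)

abbreviation E_norm :: "('a \<Rightarrow> real) \<Rightarrow> real" where "E_norm u \<equiv> \<E> u powr (1 / p)"

lemmas F_closed = fun_subspaceD[OF F_subspace]
lemmas E_norm_simps = seminorm_onD[OF E_seminorm]

lemma E_norm_powr: "u \<in> F \<Longrightarrow> E_norm u powr p = \<E> u"
  using p_gt_1 E_nonneg by (simp add: powr_powr)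

lemma Lp_seminorm: "seminorm_on F (Lp_norm m p)"
  unfolding seminorm_on_def
proof (intro conjI ballI allI)
  show "0 \<le> Lp_norm m p u" for u by (rule Lp_norm_nonneg)
  show "Lp_norm m p (\<lambda>x. c * u x) = \<bar>c\<bar> * Lp_norm m p u" for c u
    using p_gt_1 by (intro Lp_norm_scale) simp
  show "Lp_norm m p (\<lambda>x. u x + v x) \<le> Lp_norm m p u + Lp_norm m p v" if "u \<in> F" "v \<in> F" for u v
    using Lp_norm_triangle[OF p_gt_1] that F_Lp by blast
qed

lemma energy_norm_seminorm: "seminorm_on F (energy_norm m p \<E>)"
  unfolding seminorm_on_def energy_norm_def
proof (intro conjI ballI allI)
  fix u assume u: "u \<in> F"
  show "0 \<le> Lp_norm m p u + E_norm u" using Lp_norm_nonneg[of m p u] by simp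
  show "Lp_norm m p (\<lambda>x. c * u x) + E_norm (\<lambda>x. c * u x) = \<bar>c\<bar> * (Lp_norm m p u + E_norm u)" for c
    using E_norm_simps(2)[OF u, of c] seminorm_onD(2)[OF Lp_seminorm u, of c]
    by (simp add: distrib_left)
  fix v assume v: "v \<in> F"
  show "Lp_norm m p (\<lambda>x. u x + v x) + E_norm (\<lambda>x. u x + v x) \<le> Lp_norm m p u + E_norm u + (Lp_norm m p v + E_norm v)"
    using E_norm_simps(3)[OF u v] seminorm_onD(3)[OF Lp_seminorm u v] by simp
qed

lemma energy_norm_ge: "Lp_norm m p u \<le> energy_norm m p \<E> u" "E_norm u \<le> energy_norm m p \<E> u"
  using Lp_norm_nonneg[of m p u] by (auto simp: energy_norm_def)

lemma convex_funs_seminorm_ball: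
  assumes N: "seminorm_on F N" and u: "u \<in> F"
  shows "convex_funs {w \<in> F. N (\<lambda>x. w x - u x) \<le> d}"
  unfolding convex_funs_def
proof (intro ballI allI impI, safe)
  fix v w and a b :: real
  assume h: "v \<in> F" "N (\<lambda>x. v x - u x) \<le> d" "w \<in> F" "N (\<lambda>x. w x - u x) \<le> d" "0 \<le> a" "0 \<le> b" "a + b = 1"
  note Ns = seminorm_onD[OF N]
  have vw: "(\<lambda>x. v x - u x) \<in> F" "(\<lambda>x. w x - u x) \<in> F" using F_closed(5) h u by auto
  show "(\<lambda>x. a * v x + b * w x) \<in> F"
    by (rule F_closed(2)[OF F_closed(3)[OF h(1)] F_closed(3)[OF h(3)]])
  have "a * v x + b * w x - u x = a * (v x - u x) + b * (w x - u x)" for x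
  proof -
    have "u x = (a + b) * u x" using h(7) by simp
    thus ?thesis by (simp add: algebra_simps)
  qed
  hence "N (\<lambda>x. a * v x + b * w x - u x) = N (\<lambda>x. a * (v x - u x) + b * (w x - u x))" by simp
  also have "\<dots> \<le> N (\<lambda>x. a * (v x - u x)) + N (\<lambda>x. b * (w x - u x))"
    by (rule Ns(3)[OF F_closed(3)[OF vw(1)] F_closed(3)[OF vw(2)]])
  also have "\<dots> = a * N (\<lambda>x. v x - u x) + b * N (\<lambda>x. w x - u x)"
    using Ns(2)[OF vw(1), of a] Ns(2)[OF vw(2), of b] h by simp
  also have "\<dots> \<le> a * d + b * d" using h by (intro add_mono mult_left_mono) auto
  finally show "N (\<lambda>x. a * v x + b * w x - u x) \<le> d"
    using h(7) by (simp flip: distrib_right)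
qed

text \<open>Reflexivity supplies a weak limit \<open>w\<close>. Balls about \<open>u\<close> in the
  \<open>L^p\<close> seminorm are convex and eventually contain the sequence, so testing against
  them identifies \<open>w\<close> with \<open>u\<close> almost everywhere. The convex set
  \<open>Q\<close> is left general: it carries along whatever the sequence satisfies, such as
  pointwise constraints or a bound on an energy measure.\<close>

theorem bounded_energy_mazur:
  assumes v: "\<And>k::nat. v k \<in> F" and bound: "\<And>k. \<E> (v k) \<le> K" and u: "u \<in> F"
    and lim: "(\<lambda>k. Lp_norm m p (\<lambda>x. v k x - u x)) \<longlonglongrightarrow> 0"
    and Q: "convex_funs Q" "Q \<subseteq> F" "eventually (\<lambda>k. v k \<in> Q) sequentially" and e: "0 < e"
  shows "\<exists>w\<in>Q. energy_norm m p \<E> (\<lambda>x. u x - w x) < e"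
proof -
  let ?N = "energy_norm m p \<E>" and ?L = "Lp_norm m p"
  obtain B where B: "\<And>k. ?L (\<lambda>x. v k x - u x) \<le> B"
  proof -
    obtain B where "\<forall>k. norm (?L (\<lambda>x. v k x - u x)) \<le> B"
      using convergent_imp_Bseq[OF convergentI[OF lim]] by (rule BseqE)
    thus ?thesis by (intro that[of B]) (simp add: abs_le_iff)
  qed
  have bN: "?N (v k) \<le> (?L u + B) + K powr (1 / p)" for k
  proof -
    have "?L (v k) \<le> ?L u + B"
      using seminorm_on_triangle_diff[OF F_subspace Lp_seminorm v[of k] u] B[of k] by simp
    moreover have "E_norm (v k) \<le> K powr (1 / p)"
      using p_gt_1 bound E_nonneg[OF v] by (intro powr_mono2) auto
    ultimately show ?thesis by (simp add: energy_norm_def)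
  qed
  obtain w where w: "w \<in> F" and near: "\<And>Q e. convex_funs Q \<Longrightarrow> Q \<subseteq> F \<Longrightarrow>
      eventually (\<lambda>k. v k \<in> Q) sequentially \<Longrightarrow> 0 < e \<Longrightarrow> \<exists>z\<in>Q. ?N (\<lambda>x. w x - z x) < e"
  proof (rule reflexive_weak_limit[OF F_subspace energy_norm_seminorm reflexive,
        where v = v and K = "(?L u + B) + K powr (1 / p)"])
    show "v k \<in> F" for k by (rule v)
    show "?N (v k) \<le> (?L u + B) + K powr (1 / p)" for k by (rule bN)
  next
    fix w assume w: "w \<in> F" and near: "\<And>Q e. convex_funs Q \<Longrightarrow> Q \<subseteq> F \<Longrightarrow>
      eventually (\<lambda>k. v k \<in> Q) sequentially \<Longrightarrow> 0 < e \<Longrightarrow> \<exists>z\<in>Q. ?N (\<lambda>x. w x - z x) < e"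
    show thesis
    proof (rule that[OF w])
      fix Q and e :: real
      assume "convex_funs Q" "Q \<subseteq> F" "eventually (\<lambda>k. v k \<in> Q) sequentially" "0 < e"
      thus "\<exists>z\<in>Q. ?N (\<lambda>x. w x - z x) < e" by (rule near)
    qed
  qed
  have wu: "(\<lambda>x. w x - u x) \<in> F" using F_closed(5)[OF w u] .
  have "?L (\<lambda>x. w x - u x) \<le> 0"
  proof (rule field_le_epsilon)
    fix d :: real assume d: "0 < d"
    let ?Q = "{z \<in> F. ?L (\<lambda>x. z x - u x) \<le> d / 2}"
    have "eventually (\<lambda>k. ?L (\<lambda>x. v k x - u x) < d / 2) sequentially"
      by (rule order_tendstoD(2)[OF lim]) (use d in simp)
    hence "eventually (\<lambda>k. v k \<in> ?Q) sequentially" by eventually_elim (use v in auto)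
    from near[OF convex_funs_seminorm_ball[OF Lp_seminorm u] _ this, of "d / 2"] d
    obtain z where z: "z \<in> F" "?L (\<lambda>x. z x - u x) \<le> d / 2" "?N (\<lambda>x. w x - z x) < d / 2" by auto
    have "?L (\<lambda>x. (w x - z x) + (z x - u x)) \<le> ?L (\<lambda>x. w x - z x) + ?L (\<lambda>x. z x - u x)"
      by (rule seminorm_onD(3)[OF Lp_seminorm F_closed(5)[OF w z(1)] F_closed(5)[OF z(1) u]])
    thus "?L (\<lambda>x. w x - u x) \<le> 0 + d" using z energy_norm_ge(1)[of "\<lambda>x. w x - z x"] by simp
  qed
  hence "?L (\<lambda>x. w x - u x) = 0" using Lp_norm_nonneg[of m p] by (simp add: antisym)
  hence "(\<integral>x. \<bar>w x - u x\<bar> powr p \<partial>m) = 0"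
    using Lp_norm_powr[of p m "\<lambda>x. w x - u x"] p_gt_1 by simp
  hence "AE x in m. \<bar>w x - u x\<bar> powr p = 0"
    using wu F_Lp by (subst (asm) integral_nonneg_eq_0_iff_AE) (auto simp: Lp_space_iff)
  hence ae: "AE x in m. w x = u x" by eventually_elim (use p_gt_1 in auto)
  obtain z where z: "z \<in> Q" "?N (\<lambda>x. w x - z x) < e" using near[OF Q e] by blast
  have zF: "z \<in> F" using z Q by auto
  have wz: "(\<lambda>x. w x - z x) \<in> F" and uz: "(\<lambda>x. u x - z x) \<in> F" using F_closed(5) w u zF by auto
  have aez: "AE x in m. u x - z x = w x - z x" using ae by eventually_elim simp
  have eq: "?N (\<lambda>x. u x - z x) = ?N (\<lambda>x. w x - z x)"
    unfolding energy_norm_def using E_ae[OF uz wz aez] Lp_norm_cong_AE[OF _ _ aez, of p] uz wz F_measurable_m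
    by simp
  show ?thesis by (rule bexI[OF _ z(1)]) (simp only: eq z(2))
qed

lemma F_abs: "u \<in> F \<Longrightarrow> (\<lambda>x. \<bar>u x\<bar>) \<in> F \<and> E_norm (\<lambda>x. \<bar>u x\<bar>) \<le> E_norm u"
proof -
  assume u: "u \<in> F"
  have "1-lipschitz_on UNIV (abs :: real \<Rightarrow> real)"
    by (auto simp: lipschitz_on_def dist_real_def)
  from contraction[OF u this] show ?thesis
    using p_gt_1 E_nonneg by (auto intro!: powr_mono2)
qed

text \<open>Maximum and minimum are half the sum plus or minus half the modulus of the difference,
  so the contraction property alone controls their energy.\<close>

lemma F_max_min:
  assumes u: "u \<in> F" and v: "v \<in> F"
  shows "(\<lambda>x. max (u x) (v x)) \<in> F \<and> E_norm (\<lambda>x. max (u x) (v x)) \<le> E_norm u + E_norm v"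
    and "(\<lambda>x. min (u x) (v x)) \<in> F \<and> E_norm (\<lambda>x. min (u x) (v x)) \<le> E_norm u + E_norm v"
proof -
  have s: "(\<lambda>x. u x + v x) \<in> F" and d: "(\<lambda>x. u x - v x) \<in> F" using F_closed u v by auto
  have a: "(\<lambda>x. \<bar>u x - v x\<bar>) \<in> F" "E_norm (\<lambda>x. \<bar>u x - v x\<bar>) \<le> E_norm (\<lambda>x. u x - v x)"
    using F_abs[OF d] by auto
  note hs = F_closed(3)[OF s, of "1/2"] and ha = F_closed(3)[OF a(1), of "1/2"]
  have sum_le: "E_norm (\<lambda>x. u x + v x) \<le> E_norm u + E_norm v" by (rule E_norm_simps(3)[OF u v])
  have diff_le: "E_norm (\<lambda>x. u x - v x) \<le> E_norm u + E_norm v"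
    by (rule seminorm_on_diff_le[OF F_subspace E_seminorm u v])
  have eqs: "E_norm (\<lambda>x. 1/2 * (u x + v x)) = 1/2 * E_norm (\<lambda>x. u x + v x)"
    "E_norm (\<lambda>x. 1/2 * \<bar>u x - v x\<bar>) = 1/2 * E_norm (\<lambda>x. \<bar>u x - v x\<bar>)"
    using E_norm_simps(2)[OF s, of "1/2"] E_norm_simps(2)[OF a(1), of "1/2"] by auto
  have mx: "(\<lambda>x. max (u x) (v x)) = (\<lambda>x. 1/2 * (u x + v x) + 1/2 * \<bar>u x - v x\<bar>)"
    by (auto simp: fun_eq_iff max_def field_simps)
  have mn: "(\<lambda>x. min (u x) (v x)) = (\<lambda>x. 1/2 * (u x + v x) - 1/2 * \<bar>u x - v x\<bar>)"
    by (auto simp: fun_eq_iff min_def field_simps)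
  show "(\<lambda>x. max (u x) (v x)) \<in> F \<and> E_norm (\<lambda>x. max (u x) (v x)) \<le> E_norm u + E_norm v"
    unfolding mx using F_closed(2)[OF hs ha] E_norm_simps(3)[OF hs ha] eqs a(2) sum_le diff_le by linarith
  show "(\<lambda>x. min (u x) (v x)) \<in> F \<and> E_norm (\<lambda>x. min (u x) (v x)) \<le> E_norm u + E_norm v"
    unfolding mn using F_closed(5)[OF hs ha] seminorm_on_diff_le[OF F_subspace E_seminorm hs ha] eqs a(2) sum_le diff_le
    by linarith
qed

end

section \<open>Poincare inequality and continuous cutoff functions\<close>

lemma powr_le_powr_add:
  fixes a b c p :: real
  assumes "a \<le> b + c" "0 \<le> b" "0 \<le> c" "0 \<le> a" "0 < p"
  shows "a powr p \<le> 2 powr p * (b powr p + c powr p)"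
proof -
  have "a powr p \<le> \<bar>b + c\<bar> powr p" using assms by (intro powr_mono2) auto
  also have "\<dots> \<le> 2 powr p * (\<bar>b\<bar> powr p + \<bar>c\<bar> powr p)" by (rule powr_abs_add_le[OF assms(5)])
  finally show ?thesis using assms by simp
qed

text \<open>Only small scales matter for the capacity bound, so \<open>diam / A\<^bsub>cap,2\<^esub>\<close> is replaced by some
  \<open>R\<^sub>0 > 0\<close>; the infimum is replaced by a competitor, at the price of a factor in the constant.\<close>

locale energy_poincare =
  p_energy_space m p F \<E> \<Gamma> + doubling_space m c
  for m :: "'a::polish_space measure" and p F \<E> \<Gamma> c +
  fixes \<beta> C\<^sub>P A\<^sub>P C\<^sub>c A\<^sub>1 R\<^sub>0 :: real
  assumes beta_pos: "0 < \<beta>" and CP_pos: "0 < C\<^sub>P" and AP_ge: "1 \<le> A\<^sub>P"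
    and poincare: "u \<in> F \<Longrightarrow> 0 < r \<Longrightarrow>
      (\<integral>\<^sup>+y\<in>ball x r. ennreal (\<bar>u y - mean_value m (ball x r) u\<bar> powr p) \<partial>m)
        \<le> ennreal (C\<^sub>P * r powr \<beta>) * emeasure (\<Gamma> u) (ball x (A\<^sub>P * r))"
    and Cc_pos: "0 < C\<^sub>c" and A1_ge: "1 \<le> A\<^sub>1" and R0_pos: "0 < R\<^sub>0"
    and capacity: "0 < R \<Longrightarrow> R < R\<^sub>0 \<Longrightarrow>
      \<exists>u\<in>F. (AE y in m. y \<in> ball x R \<longrightarrow> u y = 1) \<and> (AE y in m. y \<notin> ball x (A\<^sub>1 * R) \<longrightarrow> u y = 0)
        \<and> \<E> u \<le> C\<^sub>c * vol x R / R powr \<beta>"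
begin

section \<open>The Poincare inequality summed over a net\<close>

lemma p_pos: "0 < p" using p_gt_1 by simp

lemma Gamma_emeasure: "u \<in> F \<Longrightarrow> emeasure (\<Gamma> u) A = ennreal (measure (\<Gamma> u) A)"
  using finite_measure.emeasure_eq_measure[OF Gamma_finite] by blast

text \<open>The factor \<open>C\<^sub>P * 2 powr \<beta>\<close> is that of the Poincare inequality
  at radius \<open>2 * r\<close>, whose dilated balls have radius \<open>2 * A\<^sub>P * r\<close>;
  the leading factors are those of \<open>ks_energy_le_net\<close>.\<close>

definition K_upper :: real where
  "K_upper = c * 2 powr p * (1 + c) * (C\<^sub>P * 2 powr \<beta>) * overlap (2 * A\<^sub>P)"

text \<open>The Poincare inequality is applied on each net ball of radius \<open>2 * r\<close>, and
  the bounded overlap of the dilated balls adds up the energies. These balls may leave \<Omega>,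
  hence the larger set \<open>D\<close>.\<close>

lemma ks_energy_le_Gamma:
  assumes g: "g \<in> F" and [measurable]: "\<Omega> \<in> sets borel" "D \<in> sets borel" and r: "0 < r"
    and D: "\<And>s. \<Omega> \<inter> ball s r \<noteq> {} \<Longrightarrow> ball s (2 * A\<^sub>P * r) \<subseteq> D"
  shows "ks_energy m p r \<Omega> g \<le> ennreal (K_upper * r powr \<beta>) * emeasure (\<Gamma> g) D"
proof -
  obtain S :: "'a set" where S: "is_net r S" using net_exists[OF r] by blast
  let ?T = "{s \<in> S. \<Omega> \<inter> ball s r \<noteq> {}}"
  let ?K = "c * 2 powr p * (1 + c)"
  have [measurable]: "g \<in> borel_measurable borel" by (rule F_measurable[OF g])
  have sets: "sets (\<Gamma> g) = sets borel" by (rule Gamma_borel[OF g])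
  have "ks_energy m p r \<Omega> g \<le> ennreal ?K *
      (\<integral>\<^sup>+s. (\<integral>\<^sup>+x\<in>ball s (2 * r). ennreal (\<bar>g x - mean_value m (ball s (2 * r)) g\<bar> powr p) \<partial>m)
        \<partial>count_space ?T)"
    by (rule ks_energy_le_net) (use S r p_pos in auto)
  also have "\<dots> \<le> ennreal ?K * (\<integral>\<^sup>+s. ennreal (C\<^sub>P * (2 * r) powr \<beta>) *
      (\<integral>\<^sup>+x\<in>ball s ((2 * A\<^sub>P) * r). 1 \<partial>\<Gamma> g) \<partial>count_space ?T)"
  proof (intro mult_left_mono nn_integral_mono)
    fix s
    have "(\<integral>\<^sup>+x\<in>ball s ((2 * A\<^sub>P) * r). 1 \<partial>\<Gamma> g) = emeasure (\<Gamma> g) (ball s (A\<^sub>P * (2 * r)))"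
      using sets by (simp add: mult_ac)
    thus "(\<integral>\<^sup>+x\<in>ball s (2 * r). ennreal (\<bar>g x - mean_value m (ball s (2 * r)) g\<bar> powr p) \<partial>m) \<le>
        ennreal (C\<^sub>P * (2 * r) powr \<beta>) * (\<integral>\<^sup>+x\<in>ball s ((2 * A\<^sub>P) * r). 1 \<partial>\<Gamma> g)"
      using poincare[OF g, of "2 * r" s] r by simp
  qed simp
  also have "\<dots> = ennreal ?K * (ennreal (C\<^sub>P * (2 * r) powr \<beta>) *
      (\<integral>\<^sup>+s. (\<integral>\<^sup>+x\<in>ball s ((2 * A\<^sub>P) * r). 1 \<partial>\<Gamma> g) \<partial>count_space ?T))"
    by (subst nn_integral_cmult) auto
  also have "\<dots> \<le> ennreal ?K * (ennreal (C\<^sub>P * (2 * r) powr \<beta>) *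
      (of_nat (overlap (2 * A\<^sub>P)) * (\<integral>\<^sup>+x\<in>D. 1 \<partial>\<Gamma> g)))"
    by (intro mult_left_mono nn_integral_net_overlap[OF S r _ sets]) (use AP_ge D in auto)
  also have "(\<integral>\<^sup>+x\<in>D. 1 \<partial>\<Gamma> g) = emeasure (\<Gamma> g) D" using sets by simp
  also have "ennreal ?K * (ennreal (C\<^sub>P * (2 * r) powr \<beta>) * (of_nat (overlap (2 * A\<^sub>P)) * emeasure (\<Gamma> g) D))
      = ennreal (K_upper * r powr \<beta>) * emeasure (\<Gamma> g) D"
  proof -
    have "ennreal (K_upper * r powr \<beta>) =
        ennreal ?K * (ennreal (C\<^sub>P * (2 * r) powr \<beta>) * ennreal (overlap (2 * A\<^sub>P)))"
      using c CP_pos by (simp add: K_upper_def powr_mult ennreal_mult[symmetric] mult_ac)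
    thus ?thesis by (simp add: ennreal_of_nat_eq_real_of_nat mult.assoc)
  qed
  finally show ?thesis .
qed

lemma K_upper_nonneg: "0 \<le> K_upper"
  using c CP_pos by (simp add: K_upper_def)

lemma ks_energy_le_energy:
  assumes g: "g \<in> F" and r: "0 < r" and "\<Omega> \<in> sets borel"
  shows "ks_energy m p r \<Omega> g \<le> ennreal (K_upper * r powr \<beta> * \<E> g)"
proof -
  have "ks_energy m p r \<Omega> g \<le> ennreal (K_upper * r powr \<beta>) * emeasure (\<Gamma> g) UNIV"
    by (rule ks_energy_le_Gamma) (use assms in auto)
  also have "\<dots> = ennreal (K_upper * r powr \<beta> * \<E> g)"
    using Gamma_emeasure[OF g] E_eq_Gamma[OF g] E_nonneg[OF g] K_upper_nonneg by (simp add: ennreal_mult)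
  finally show ?thesis .
qed

section \<open>Continuous cutoff functions\<close>

lemma Cc_combine:
  fixes w :: "'a \<Rightarrow> real"
  assumes "u \<in> Cc" "v \<in> Cc" "continuous_on UNIV w" "\<And>x. u x = 0 \<Longrightarrow> v x = 0 \<Longrightarrow> w x = 0"
  shows "w \<in> Cc"
proof -
  have "{x. w x \<noteq> 0} \<subseteq> {x. u x \<noteq> 0} \<union> {x. v x \<noteq> 0}" using assms(4) by auto
  thus ?thesis using assms(1-3) unfolding mem_Cc_iff by (meson bounded_Un bounded_subset)
qed

lemma Cc_continuous: "u \<in> Cc \<Longrightarrow> continuous_on UNIV (u :: 'a \<Rightarrow> real)"
  by (simp add: mem_Cc_iff)

text \<open>A tent of height \<open>3\<close> is approximated uniformly within \<open>1\<close> by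
  an element of \<open>F \<inter> Cc\<close>. Its values exceed \<open>2\<close> on the inner ball
  and stay below \<open>1\<close> outside the outer one, so the contraction
  \<open>t \<mapsto> max 0 (min 1 (t - 1))\<close> makes it exactly \<open>1\<close> and
  \<open>0\<close> there. Its energy is not controlled.\<close>

lemma bump_exists:
  fixes x :: 'a
  assumes ab: "0 < a" "a < b"
  shows "\<exists>\<psi>\<in>F \<inter> Cc. (\<forall>y. 0 \<le> \<psi> y \<and> \<psi> y \<le> 1) \<and> (\<forall>y\<in>ball x a. \<psi> y = 1) \<and> (\<forall>y. y \<notin> ball x b \<longrightarrow> \<psi> y = 0)"
proof -
  define f where "f y = 3 * max 0 (min 1 ((b - dist x y) / (b - a)))" for y
  have cf: "continuous_on UNIV f" unfolding f_def using ab by (intro continuous_intros) auto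
  have f0: "f y = 0" if "y \<notin> ball x b" for y
  proof -
    have "(b - dist x y) / (b - a) \<le> 0" using that ab by (intro divide_nonpos_pos) auto
    thus ?thesis by (simp add: f_def)
  qed
  have f3: "f y = 3" if "y \<in> ball x a" for y
    using that ab by (auto simp: f_def max_def min_def field_simps)
  have "{y. f y \<noteq> 0} \<subseteq> ball x b" using f0 by blast
  hence "f \<in> Cc" using cf bounded_subset[OF bounded_ball] by (auto simp: mem_Cc_iff)
  from dense_Cc[OF this, of 1] obtain v where v: "v \<in> F" "v \<in> Cc" "\<And>y. \<bar>f y - v y\<bar> < 1" by auto
  define \<phi> where "\<phi> t = max 0 (min 1 (t - 1))" for t :: real
  have "1-lipschitz_on UNIV \<phi>"
    by (auto simp: lipschitz_on_def dist_real_def \<phi>_def)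
  from contraction[OF v(1) this] have F: "(\<lambda>y. \<phi> (v y)) \<in> F" by (simp add: \<phi>_def)
  have "continuous_on UNIV (\<lambda>y. \<phi> (v y))"
    unfolding \<phi>_def using Cc_continuous[OF v(2)] by (intro continuous_intros) auto
  hence "(\<lambda>y. \<phi> (v y)) \<in> Cc"
    by (intro Cc_combine[OF v(2) v(2)]) (auto simp: \<phi>_def)
  moreover have "\<phi> (v y) = 1" if "y \<in> ball x a" for y
    using f3[OF that] v(3)[of y] by (auto simp: \<phi>_def)
  moreover have "\<phi> (v y) = 0" if "y \<notin> ball x b" for y
    using f0[OF that] v(3)[of y] by (auto simp: \<phi>_def)
  moreover have "0 \<le> \<phi> t \<and> \<phi> t \<le> 1" for t by (auto simp: \<phi>_def)
  ultimately show ?thesis using F by (intro bexI[of _ "\<lambda>y. \<phi> (v y)"]) auto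
qed

text \<open>A competitor for the capacity need not be continuous. Continuous approximations of it, truncated
  between two bump functions, keep bounded energy, and convex combinations of them converge to it.\<close>

lemma continuous_cutoff:
  fixes x :: 'a
  assumes r: "0 < r" "2 * r < R\<^sub>0"
  shows "\<exists>\<phi>\<in>F \<inter> Cc. (\<forall>y. 0 \<le> \<phi> y \<and> \<phi> y \<le> 1) \<and> (\<forall>y\<in>ball x r. \<phi> y = 1)
    \<and> (\<forall>y. y \<notin> ball x (4 * A\<^sub>1 * r) \<longrightarrow> \<phi> y = 0) \<and> \<E> \<phi> \<le> 2 powr p * C\<^sub>c * c * vol x r / r powr \<beta>"
proof -
  let ?R = "2 * r"
  \<comment> \<open>This is both the bound for \<open>E_norm f\<close> and the tolerance in the
    approximation of \<open>f\<close>, which explains the factor \<open>2 powr p\<close> in the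
    result.\<close>
  define \<kappa> where "\<kappa> = (C\<^sub>c * vol x ?R / ?R powr \<beta>) powr (1 / p)"
  have \<kappa>: "0 < \<kappa>" using Cc_pos r vol_pos[of ?R x] by (simp add: \<kappa>_def)
  obtain u where u: "u \<in> F" "AE y in m. y \<in> ball x ?R \<longrightarrow> u y = 1"
      "AE y in m. y \<notin> ball x (A\<^sub>1 * ?R) \<longrightarrow> u y = 0" "\<E> u \<le> C\<^sub>c * vol x ?R / ?R powr \<beta>"
    using capacity[of ?R x] r by auto
  define clamp where "clamp t = max 0 (min 1 t)" for t :: real
  define f where "f y = clamp (u y)" for y
  have "1-lipschitz_on UNIV clamp" by (auto simp: lipschitz_on_def dist_real_def clamp_def)
  from contraction[OF u(1) this] have f: "f \<in> F" "\<E> f \<le> \<E> u" by (auto simp: f_def[abs_def] clamp_def)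
  have "E_norm f \<le> \<kappa>"
    unfolding \<kappa>_def using f u(4) E_nonneg[OF f(1)] p_pos by (intro powr_mono2) auto
  have "r < ?R" using r by simp
  from bump_exists[OF r(1) this, of x] obtain a where
    a: "a \<in> F" "a \<in> Cc" "\<And>y. 0 \<le> a y \<and> a y \<le> 1" "\<And>y. y \<in> ball x r \<Longrightarrow> a y = 1" "\<And>y. y \<notin> ball x ?R \<Longrightarrow> a y = 0"
    by blast
  have "0 < A\<^sub>1 * ?R" "A\<^sub>1 * ?R < 4 * A\<^sub>1 * r" using r A1_ge by (auto simp: mult_ac)
  from bump_exists[OF this, of x] obtain b where
    b: "b \<in> F" "b \<in> Cc" "\<And>y. 0 \<le> b y \<and> b y \<le> 1" "\<And>y. y \<in> ball x (A\<^sub>1 * ?R) \<Longrightarrow> b y = 1"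
      "\<And>y. y \<notin> ball x (4 * A\<^sub>1 * r) \<Longrightarrow> b y = 0"
    by blast
  \<comment> \<open>The bumps impose the required values near and far from \<open>x\<close> on any
    \<open>v\<close>. They leave \<open>f\<close> unchanged almost everywhere: \<open>f\<close> is
    \<open>1\<close> where \<open>a\<close> may be nonzero and \<open>0\<close> where
    \<open>b\<close> may differ from \<open>1\<close>.\<close>
  define T where "T v y = min (max (v y) (a y)) (b y)" for v y
  have TF: "T v \<in> F \<and> E_norm (T v) \<le> E_norm v + E_norm a + E_norm b" if "v \<in> F" for v
  proof -
    note 1 = F_max_min(1)[OF that a(1)]
    have "(\<lambda>y. max (v y) (a y)) \<in> F" using 1 by blast
    from F_max_min(2)[OF this b(1)] show ?thesis using 1 unfolding T_def by linarith
  qed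
  have "AE y in m. T f y = f y"
    using u(2,3)
  proof eventually_elim
    case (elim y)
    have "ball x ?R \<subseteq> ball x (A\<^sub>1 * ?R)" using A1_ge r by (intro subset_ball) simp
    thus ?case using elim a(3)[of y] a(5)[of y] b(3)[of y] b(4)[of y]
      by (cases "y \<in> ball x ?R"; cases "y \<in> ball x (A\<^sub>1 * ?R)") (auto simp: T_def f_def clamp_def)
  qed
  note Tf = this
  have "\<exists>v. \<forall>n::nat. v n \<in> F \<inter> Cc \<and> energy_norm m p \<E> (\<lambda>x. f x - v n x) < inverse (real (Suc n))"
  proof (intro choice allI)
    fix n
    show "\<exists>w. w \<in> F \<inter> Cc \<and> energy_norm m p \<E> (\<lambda>x. f x - w x) < inverse (real (Suc n))"
      using dense_F[OF f(1), of "inverse (real (Suc n))"] by auto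
  qed
  then obtain v where v: "\<And>n::nat. v n \<in> F" "\<And>n. v n \<in> Cc"
    "\<And>n. energy_norm m p \<E> (\<lambda>x. f x - v n x) < inverse (real (Suc n))" by blast
  define Q where "Q = {w \<in> F \<inter> Cc. (\<forall>y. 0 \<le> w y \<and> w y \<le> 1) \<and> (\<forall>y\<in>ball x r. w y = 1)
    \<and> (\<forall>y. y \<notin> ball x (4 * A\<^sub>1 * r) \<longrightarrow> w y = 0)}"
  \<comment> \<open>The energies of \<open>a\<close> and \<open>b\<close> enter the bound
    \<open>K\<close> for the sequence, but there only finiteness matters. The quantitative bound on
    \<open>w\<close> comes from its closeness to \<open>f\<close>.\<close>
  have "\<exists>w\<in>Q. energy_norm m p \<E> (\<lambda>x. f x - w x) < \<kappa>"
  proof (rule bounded_energy_mazur[where v = "\<lambda>n. T (v n)"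
        and K = "(E_norm f + 1 + E_norm a + E_norm b) powr p"])
    fix n
    show "T (v n) \<in> F" using TF v(1) by blast
    have "inverse (real (Suc n)) \<le> 1" by (simp add: field_simps)
    hence "E_norm (\<lambda>x. f x - v n x) \<le> 1"
      using v(3)[of n] energy_norm_ge(2)[of "\<lambda>x. f x - v n x"] by linarith
    hence "E_norm (v n) \<le> E_norm f + 1"
      using seminorm_on_triangle_diff[OF F_subspace E_seminorm v(1)[of n] f(1)]
        seminorm_on_diff_commute[OF F_subspace E_seminorm f(1) v(1)[of n]] by linarith
    hence "E_norm (T (v n)) \<le> E_norm f + 1 + E_norm a + E_norm b" using TF[OF v(1)[of n]] by linarith
    hence "E_norm (T (v n)) powr p \<le> (E_norm f + 1 + E_norm a + E_norm b) powr p"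
      using p_pos by (intro powr_mono2) auto
    thus "\<E> (T (v n)) \<le> (E_norm f + 1 + E_norm a + E_norm b) powr p"
      using E_norm_powr TF[OF v(1)[of n]] by auto
  next
    show "f \<in> F" by fact
    have le: "Lp_norm m p (\<lambda>x. T (v n) x - f x) \<le> inverse (real (Suc n))" for n
    proof -
      have mem: "(\<lambda>x. T (v n) x - f x) \<in> F" "(\<lambda>x. T (v n) x - T f x) \<in> F" "(\<lambda>x. f x - v n x) \<in> F"
        using F_closed(5) TF v(1) f(1) by auto
      have "Lp_norm m p (\<lambda>x. T (v n) x - f x) = Lp_norm m p (\<lambda>x. T (v n) x - T f x)"
        by (rule Lp_norm_cong_AE) (use mem F_measurable_m Tf in auto)
      also have "\<dots> \<le> Lp_norm m p (\<lambda>x. f x - v n x)"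
        by (rule Lp_norm_mono[OF p_pos]) (use mem F_measurable_m F_Lp in \<open>auto simp: T_def\<close>)
      also have "\<dots> \<le> inverse (real (Suc n))"
        using v(3)[of n] energy_norm_ge(1)[of "\<lambda>x. f x - v n x"] by linarith
      finally show ?thesis .
    qed
    show "(\<lambda>n. Lp_norm m p (\<lambda>x. T (v n) x - f x)) \<longlonglongrightarrow> 0"
      by (rule tendsto_sandwich[OF _ _ tendsto_const LIMSEQ_inverse_real_of_nat])
         (use le in \<open>auto simp: Lp_norm_nonneg\<close>)
    show "convex_funs Q"
      unfolding convex_funs_def
    proof (intro ballI allI impI)
      fix w z and s t :: real assume h: "w \<in> Q" "z \<in> Q" "0 \<le> s \<and> 0 \<le> t \<and> s + t = 1"
      have wz: "w \<in> F" "w \<in> Cc" "z \<in> F" "z \<in> Cc" using h by (auto simp: Q_def)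
      have 1: "(\<lambda>x. s * w x + t * z x) \<in> F"
        by (rule F_closed(2)[OF F_closed(3)[OF wz(1)] F_closed(3)[OF wz(3)]])
      have 2: "(\<lambda>x. s * w x + t * z x) \<in> Cc"
        by (rule Cc_combine[OF wz(2,4)])
          (use Cc_continuous[OF wz(2)] Cc_continuous[OF wz(4)] in \<open>auto intro!: continuous_intros\<close>)
      have 3: "0 \<le> s * w y + t * z y \<and> s * w y + t * z y \<le> 1" for y
      proof -
        have "0 \<le> w y \<and> w y \<le> 1" "0 \<le> z y \<and> z y \<le> 1" using h by (auto simp: Q_def)
        moreover have "s * w y + t * z y \<le> s * 1 + t * 1"
          using calculation h(3) by (intro add_mono mult_left_mono) auto
        ultimately show ?thesis using h(3) by auto
      qed
      show "(\<lambda>x. s * w x + t * z x) \<in> Q"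
        using 1 2 3 h by (auto simp: Q_def)
    qed
    have "T (v n) \<in> Q" for n
    proof -
      have "T (v n) \<in> Cc"
        by (rule Cc_combine[OF a(2) b(2)])
          (use Cc_continuous[OF a(2)] Cc_continuous[OF b(2)] Cc_continuous[OF v(2)[of n]] a(3) b(5) in
            \<open>auto simp: T_def[abs_def] intro!: continuous_intros\<close>)
      moreover have "0 \<le> T (v n) y \<and> T (v n) y \<le> 1" for y
        using a(3)[of y] b(3)[of y] by (auto simp: T_def)
      moreover have "T (v n) y = 1" if "y \<in> ball x r" for y
      proof -
        have "ball x r \<subseteq> ball x (A\<^sub>1 * ?R)" using mult_mono[of 1 A\<^sub>1 r ?R] A1_ge r by (intro subset_ball) simp
        thus ?thesis using that a(4) b(4) by (auto simp: T_def)
      qed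
      moreover have "T (v n) y = 0" if "y \<notin> ball x (4 * A\<^sub>1 * r)" for y
        using b(5)[OF that] a(3)[of y] by (auto simp: T_def)
      ultimately show ?thesis using TF[OF v(1)[of n]] by (auto simp: Q_def)
    qed
    thus "eventually (\<lambda>n. T (v n) \<in> Q) sequentially" by simp
    show "Q \<subseteq> F" by (auto simp: Q_def)
  qed (rule \<kappa>)
  then obtain w where w: "w \<in> Q" "energy_norm m p \<E> (\<lambda>x. f x - w x) < \<kappa>" by blast
  have wF: "w \<in> F" using w by (auto simp: Q_def)
  have "E_norm w \<le> E_norm f + E_norm (\<lambda>x. f x - w x)"
    using seminorm_on_triangle_diff[OF F_subspace E_seminorm wF f(1)]
      seminorm_on_diff_commute[OF F_subspace E_seminorm f(1) wF] by linarith
  hence "E_norm w \<le> 2 * \<kappa>"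
    using w(2) energy_norm_ge(2)[of "\<lambda>x. f x - w x"] \<open>E_norm f \<le> \<kappa>\<close> by linarith
  hence "E_norm w powr p \<le> (2 * \<kappa>) powr p" using p_pos by (intro powr_mono2) auto
  also have "\<dots> = 2 powr p * (C\<^sub>c * vol x ?R / ?R powr \<beta>)"
    using \<kappa> p_pos Cc_pos by (simp add: powr_mult \<kappa>_def powr_powr)
  also have "\<dots> \<le> 2 powr p * (C\<^sub>c * (c * vol x r) / r powr \<beta>)"
    using doubling[OF r(1), of x] Cc_pos r beta_pos c
    by (intro mult_left_mono frac_le powr_mono2 mult_nonneg_nonneg) auto
  finally have "\<E> w \<le> 2 powr p * C\<^sub>c * c * vol x r / r powr \<beta>"
    using E_norm_powr[OF wF] by (simp add: mult_ac)
  thus ?thesis using w(1) by (auto simp: Q_def)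
qed

end

section \<open>Partitions of unity\<close>

text \<open>The inserted \<open>0\<close> covers the empty set and allows functions vanishing at
  \<open>x\<close> to be dropped from \<open>J\<close>.\<close>

definition running_max :: "('s \<Rightarrow> 'a \<Rightarrow> real) \<Rightarrow> 's set \<Rightarrow> 'a \<Rightarrow> real" where
  "running_max \<phi> J x = Max (insert 0 ((\<lambda>s. \<phi> s x) ` J))"

lemma running_max_empty [simp]: "running_max \<phi> {} x = 0"
  by (simp add: running_max_def)

lemma running_max_insert:
  "finite J \<Longrightarrow> running_max \<phi> (insert s J) x = max (\<phi> s x) (running_max \<phi> J x)"
  by (simp add: running_max_def insert_commute[of 0])

lemma running_max_cong:
  assumes "J' \<subseteq> J" "\<And>s. s \<in> J - J' \<Longrightarrow> \<phi> s x = 0"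
  shows "running_max \<phi> J x = running_max \<phi> J' x"
proof -
  have "insert 0 ((\<lambda>s. \<phi> s x) ` J) = insert 0 ((\<lambda>s. \<phi> s x) ` J')"
    using assms by (auto simp: image_iff)
  thus ?thesis by (simp add: running_max_def)
qed

lemma running_max_bounds:
  assumes "finite J" "\<And>s. s \<in> J \<Longrightarrow> \<phi> s x \<le> 1"
  shows "0 \<le> running_max \<phi> J x" "running_max \<phi> J x \<le> 1" "\<And>s. s \<in> J \<Longrightarrow> \<phi> s x \<le> running_max \<phi> J x"
  using assms by (auto simp: running_max_def)

lemma running_max_mono:
  assumes "finite J" "J' \<subseteq> J"
  shows "running_max \<phi> J' x \<le> running_max \<phi> J x"
  unfolding running_max_def using assms by (intro Max_mono) auto

context energy_poincare
begin

lemma running_max_F: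
  assumes "finite J" "\<And>s. s \<in> J \<Longrightarrow> \<phi> s \<in> F \<inter> Cc"
  shows "running_max \<phi> J \<in> F \<inter> Cc \<and> E_norm (running_max \<phi> J) \<le> (\<Sum>s\<in>J. E_norm (\<phi> s))"
  using assms
proof (induction J rule: finite_induct)
  case empty
  have "running_max \<phi> {} = (\<lambda>x. 0)" by auto
  thus ?case
    using F_closed(1) seminorm_on_zero[OF F_subspace E_seminorm] by (simp add: mem_Cc_iff)
next
  case (insert s J)
  have eq: "running_max \<phi> (insert s J) = (\<lambda>x. max (\<phi> s x) (running_max \<phi> J x))"
    by (rule ext) (rule running_max_insert[OF insert(1)])
  have J: "running_max \<phi> J \<in> F" "running_max \<phi> J \<in> Cc" "E_norm (running_max \<phi> J) \<le> (\<Sum>s\<in>J. E_norm (\<phi> s))"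
    and s: "\<phi> s \<in> F" "\<phi> s \<in> Cc" using insert by auto
  have "(\<lambda>x. max (\<phi> s x) (running_max \<phi> J x)) \<in> Cc"
    by (rule Cc_combine[OF s(2) J(2)])
      (use Cc_continuous[OF s(2)] Cc_continuous[OF J(2)] in \<open>auto intro!: continuous_intros\<close>)
  thus ?case
    unfolding eq using F_max_min(1)[OF s(1) J(1)] J(3) insert(1,2) by auto
qed

text \<open>Cutoffs are supported in balls of radius \<open>4 * A\<^sub>1 * r\<close>, so two of
  them can both be nonzero at a point only if their centres are closer than twice that
  radius.\<close>

abbreviation neighbours :: "'a set \<Rightarrow> real \<Rightarrow> 'a \<Rightarrow> 'a set" where
  "neighbours S r s \<equiv> {t \<in> S. dist t s < (8 * A\<^sub>1) * r}"

definition K_nbr :: nat where "K_nbr = overlap (8 * A\<^sub>1)"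
text \<open>The number 25 is 9 + 16: in \<open>mean_value_diff_le\<close> a ball of radius
  \<open>16 * A\<^sub>1 * r\<close> is compared with one of radius \<open>r\<close> whose centre is
  less than \<open>9 * A\<^sub>1 * r\<close> away.\<close>

definition K_vol :: real where "K_vol = c ^ nat \<lceil>25 * A\<^sub>1\<rceil>"
text \<open>Each member of the partition is a difference of two maxima of at most
  \<open>K_nbr\<close> cutoffs, hence \<open>2 * real K_nbr\<close>; the rest bounds the energy of a
  single neighbouring cutoff.\<close>

definition K_unity :: real where
  "K_unity = (2 * real K_nbr) powr p * (2 powr p * C\<^sub>c * c * K_vol)"

lemma neighbours_finite:
  assumes "is_net r S" "0 < r"
  shows "finite (neighbours S r s)" "card (neighbours S r s) \<le> K_nbr"
  using net_overlap[OF assms, of "8 * A\<^sub>1" s] A1_ge by (auto simp: K_nbr_def)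

lemma K_vol_ge: "1 \<le> K_vol" using c by (simp add: K_vol_def)

lemma vol_le_K_vol:
  assumes "0 < r" "dist x y + R \<le> 25 * A\<^sub>1 * r"
  shows "vol x R \<le> K_vol * vol y r"
  unfolding K_vol_def
proof (rule vol_le[OF assms(1)])
  let ?k = "nat \<lceil>25 * A\<^sub>1\<rceil>"
  have "25 * A\<^sub>1 \<le> real ?k" by linarith
  also have "real ?k \<le> 2 ^ ?k" by (rule less_imp_le[OF of_nat_less_two_power])
  finally have "25 * A\<^sub>1 * r \<le> 2 ^ ?k * r" using assms(1) by (intro mult_right_mono) auto
  thus "dist x y + R \<le> 2 ^ ?k * r" using assms(2) by linarith
qed

text \<open>Without a Leibniz rule the cutoffs cannot be divided by their sum. Instead \<open>\<psi> s\<close> is the increment at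
  \<open>s\<close> of the running maximum of the cutoffs in some enumeration of the net; it only depends on the
  cutoffs of neighbours of \<open>s\<close>.\<close>

lemma partition_of_unity:
  fixes S :: "'a set"
  assumes S: "is_net r S" and r: "0 < r" "2 * r < R\<^sub>0"
  obtains \<psi> where "\<And>s. s \<in> S \<Longrightarrow> \<psi> s \<in> F \<inter> Cc"
    "\<And>s. s \<in> S \<Longrightarrow> \<E> (\<psi> s) \<le> K_unity * vol s r / r powr \<beta>"
    "\<And>s x. s \<in> S \<Longrightarrow> 0 \<le> \<psi> s x \<and> \<psi> s x \<le> 1"
    "\<And>s x. s \<in> S \<Longrightarrow> 4 * A\<^sub>1 * r \<le> dist s x \<Longrightarrow> \<psi> s x = 0"
    "\<And>s x. s \<in> S \<Longrightarrow> x \<in> ball s r \<Longrightarrow> (\<Sum>t\<in>neighbours S r s. \<psi> t x) = 1"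
proof -
  define KC where "KC = 2 powr p * C\<^sub>c * c"
  have KC: "0 < KC" using Cc_pos c by (simp add: KC_def)
  have "\<exists>\<phi>. \<forall>s. \<phi> s \<in> F \<inter> Cc \<and> (\<forall>y. 0 \<le> \<phi> s y \<and> \<phi> s y \<le> 1) \<and> (\<forall>y\<in>ball s r. \<phi> s y = 1)
      \<and> (\<forall>y. y \<notin> ball s (4 * A\<^sub>1 * r) \<longrightarrow> \<phi> s y = 0) \<and> \<E> (\<phi> s) \<le> KC * vol s r / r powr \<beta>"
    unfolding KC_def using continuous_cutoff[OF r] by (intro choice allI) blast
  then obtain \<phi> where \<phi>: "\<And>s. \<phi> s \<in> F \<inter> Cc" "\<And>s y. 0 \<le> \<phi> s y \<and> \<phi> s y \<le> 1"
    "\<And>s y. y \<in> ball s r \<Longrightarrow> \<phi> s y = 1" "\<And>s y. y \<notin> ball s (4 * A\<^sub>1 * r) \<Longrightarrow> \<phi> s y = 0"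
    "\<And>s. \<E> (\<phi> s) \<le> KC * vol s r / r powr \<beta>" by blast
  define e where "e = to_nat_on S"
  have inj: "inj_on e S" unfolding e_def by (rule inj_on_to_nat_on[OF net_countable[OF S r(1)]])
  have fin: "finite {t \<in> S. e t < n}" for n
  proof (rule finite_imageD)
    show "finite (e ` {t \<in> S. e t < n})" by (rule finite_subset[of _ "{..<n}"]) auto
    show "inj_on e {t \<in> S. e t < n}" by (rule inj_on_subset[OF inj]) auto
  qed
  define P where "P n = running_max \<phi> {t \<in> S. e t < n}" for n
  define \<psi> where "\<psi> s x = P (Suc (e s)) x - P (e s) x" for s x
  have Suc_set: "{t \<in> S. e t < Suc (e s)} = insert s {t \<in> S. e t < e s}" if "s \<in> S" for s
    using inj_onD[OF inj _ _ that] that by (auto simp: less_Suc_eq)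
  have zero: "\<psi> s x = 0" if "s \<in> S" "\<phi> s x = 0" for s x
  proof -
    have "P (Suc (e s)) x = P (e s) x"
      unfolding P_def by (rule running_max_cong) (use that Suc_set[OF that(1)] in auto)
    thus ?thesis by (simp add: \<psi>_def)
  qed
  have nz: "dist s x < 4 * A\<^sub>1 * r" if "\<phi> s x \<noteq> 0" for s x
    using that \<phi>(4)[of x s] by force
  let ?N = "neighbours S r"
  \<comment> \<open>The running maxima before and after \<open>s\<close> involve all earlier
    cutoffs, an unbounded number. Their difference is unchanged if only neighbours are kept, and
    this version has controlled energy.\<close>
  define L where "L s = running_max \<phi> {t \<in> ?N s. e t < e s}" for s
  define U where "U s = running_max \<phi> (insert s {t \<in> ?N s. e t < e s})" for s
  have local: "\<psi> s = (\<lambda>x. U s x - L s x)" if s: "s \<in> S" for s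
  proof
    fix x
    have finL: "finite {t \<in> ?N s. e t < e s}" by (rule finite_subset[OF _ fin[of "e s"]]) auto
    show "\<psi> s x = U s x - L s x"
    proof (cases "\<phi> s x = 0")
      case True
      have "U s x = L s x"
        unfolding U_def L_def by (rule running_max_cong) (use True in auto)
      thus ?thesis using zero[OF s True] by simp
    next
      case False
      have far: "\<phi> t x = 0" if "t \<in> S" "t \<notin> ?N s" for t
      proof (rule ccontr)
        assume "\<phi> t x \<noteq> 0"
        from nz[OF this] nz[OF False] have "dist t s < (8 * A\<^sub>1) * r"
          using dist_triangle[of t s x] by (simp add: dist_commute)
        thus False using that by simp
      qed
      have "P (e s) x = L s x"
        unfolding P_def L_def by (rule running_max_cong) (use far in auto)
      moreover have "P (Suc (e s)) x = U s x"
        unfolding P_def U_def Suc_set[OF s] by (rule running_max_cong) (use far in auto)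
      ultimately show ?thesis by (simp add: \<psi>_def)
    qed
  qed
  have Nself: "s \<in> ?N s" if "s \<in> S" for s using that r A1_ge by simp
  have FU: "\<psi> s \<in> F \<inter> Cc \<and> E_norm (\<psi> s) \<le> 2 * (\<Sum>t\<in>?N s. E_norm (\<phi> t))" if s: "s \<in> S" for s
  proof -
    note finN = neighbours_finite(1)[OF S r(1), of s]
    have sub: "insert s {t \<in> ?N s. e t < e s} \<subseteq> ?N s" "{t \<in> ?N s. e t < e s} \<subseteq> ?N s" using Nself[OF s] by auto
    have Uf: "U s \<in> F" "U s \<in> Cc" "E_norm (U s) \<le> (\<Sum>t\<in>insert s {t \<in> ?N s. e t < e s}. E_norm (\<phi> t))"
      using running_max_F[OF finite_subset[OF sub(1) finN], of \<phi>] \<phi>(1) by (auto simp: U_def)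
    have Lf: "L s \<in> F" "L s \<in> Cc" "E_norm (L s) \<le> (\<Sum>t\<in>{t \<in> ?N s. e t < e s}. E_norm (\<phi> t))"
      using running_max_F[OF finite_subset[OF sub(2) finN], of \<phi>] \<phi>(1) by (auto simp: L_def)
    have m1: "(\<Sum>t\<in>insert s {t \<in> ?N s. e t < e s}. E_norm (\<phi> t)) \<le> (\<Sum>t\<in>?N s. E_norm (\<phi> t))"
      by (rule sum_mono2[OF finN sub(1)]) simp
    have m2: "(\<Sum>t\<in>{t \<in> ?N s. e t < e s}. E_norm (\<phi> t)) \<le> (\<Sum>t\<in>?N s. E_norm (\<phi> t))"
      by (rule sum_mono2[OF finN sub(2)]) simp
    have "(\<lambda>x. U s x - L s x) \<in> F" using F_closed(5) Uf Lf by auto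
    moreover have "(\<lambda>x. U s x - L s x) \<in> Cc"
      by (rule Cc_combine[OF Uf(2) Lf(2)])
        (use Cc_continuous[OF Uf(2)] Cc_continuous[OF Lf(2)] in \<open>auto intro!: continuous_intros\<close>)
    moreover have "E_norm (\<lambda>x. U s x - L s x) \<le> E_norm (U s) + E_norm (L s)"
      by (rule seminorm_on_diff_le[OF F_subspace E_seminorm Uf(1) Lf(1)])
    ultimately show ?thesis unfolding local[OF s] using Uf(3) Lf(3) m1 m2 by auto
  qed
  have energy: "\<E> (\<psi> s) \<le> K_unity * vol s r / r powr \<beta>" if s: "s \<in> S" for s
  proof -
    \<comment> \<open>A common energy bound for the cutoffs of all neighbours of \<open>s\<close>,
      their volumes being comparable.\<close>
    define B where "B = KC * (K_vol * vol s r) / r powr \<beta>"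
    have B: "0 \<le> B" using KC K_vol_ge by (simp add: B_def)
    have "E_norm (\<phi> t) \<le> B powr (1 / p)" if "t \<in> ?N s" for t
    proof -
      have "dist t s + r \<le> 25 * A\<^sub>1 * r"
      proof -
        have "r \<le> A\<^sub>1 * r" using A1_ge r by simp
        moreover have "dist t s < (8 * A\<^sub>1) * r" using that by simp
        ultimately show ?thesis using r by linarith
      qed
      hence "vol t r \<le> K_vol * vol s r" by (rule vol_le_K_vol[OF r(1)])
      hence "KC * vol t r / r powr \<beta> \<le> B"
        unfolding B_def using KC by (intro divide_right_mono mult_left_mono) auto
      thus ?thesis using \<phi>(5)[of t] \<phi>(1)[of t] E_nonneg[of "\<phi> t"] p_pos
        by (intro powr_mono2) auto
    qed
    hence "(\<Sum>t\<in>?N s. E_norm (\<phi> t)) \<le> (\<Sum>t\<in>?N s. B powr (1 / p))" by (rule sum_mono)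
    also have "\<dots> = real (card (?N s)) * B powr (1 / p)" by simp
    also have "\<dots> \<le> real K_nbr * B powr (1 / p)"
      using neighbours_finite(2)[OF S r(1), of s] by (intro mult_right_mono) auto
    finally have "E_norm (\<psi> s) \<le> (2 * real K_nbr) * B powr (1 / p)" using FU[OF s] by simp
    hence "E_norm (\<psi> s) powr p \<le> ((2 * real K_nbr) * B powr (1 / p)) powr p"
      using p_pos by (intro powr_mono2) auto
    also have "\<dots> = (2 * real K_nbr) powr p * B"
      using p_pos B by (simp add: powr_mult powr_powr)
    also have "\<dots> = K_unity * vol s r / r powr \<beta>"
      by (simp add: K_unity_def B_def KC_def)
    finally show ?thesis using E_norm_powr FU[OF s] by simp
  qed
  have \<phi>1: "\<phi> s x \<le> 1" for s x using \<phi>(2) by blast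
  have P01: "0 \<le> P n x \<and> P n x \<le> 1" for n x
    unfolding P_def by (intro conjI running_max_bounds(1,2) fin \<phi>1)
  have bounds: "0 \<le> \<psi> s x \<and> \<psi> s x \<le> 1" for s x
  proof -
    have "P (e s) x \<le> P (Suc (e s)) x" unfolding P_def by (rule running_max_mono[OF fin]) auto
    thus ?thesis using P01[of "e s" x] P01[of "Suc (e s)" x] by (simp add: \<psi>_def)
  qed
  have telescope: "(\<Sum>t\<in>{t \<in> S. e t < n}. \<psi> t x) = P n x" for n x
  proof (induction n)
    case 0
    thus ?case by (simp add: P_def)
  next
    case (Suc n)
    show ?case
    proof (cases "\<exists>s\<in>S. e s = n")
      case True
      then obtain s where s: "s \<in> S" "e s = n" by blast
      have "{t \<in> S. e t < Suc n} = insert s {t \<in> S. e t < n}" using Suc_set[OF s(1)] s(2) by simp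
      thus ?thesis using Suc fin[of n] s by (simp add: \<psi>_def)
    next
      \<comment> \<open>The enumeration misses the number \<open>n\<close> when the net is finite
        and already exhausted.\<close>
      case False
      hence "{t \<in> S. e t < Suc n} = {t \<in> S. e t < n}" by (auto simp: less_Suc_eq)
      thus ?thesis using Suc by (simp add: P_def)
    qed
  qed
  have unity: "(\<Sum>t\<in>?N s. \<psi> t x) = 1" if s: "s \<in> S" and x: "x \<in> ball s r" for s x
  proof -
    note finN = neighbours_finite(1)[OF S r(1), of s]
    \<comment> \<open>Past all neighbours of \<open>s\<close> in the enumeration; the other indices
      below \<open>n\<close> contribute nothing at \<open>x\<close>, because their cutoffs vanish
      there.\<close>
    define n where "n = Suc (Max (e ` ?N s))"
    have n: "e t < n" if "t \<in> ?N s" for t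
      unfolding n_def using that finN by (simp add: le_imp_less_Suc)
    have "(\<Sum>t\<in>?N s. \<psi> t x) = (\<Sum>t\<in>{t \<in> S. e t < n}. \<psi> t x)"
    proof (rule sum.mono_neutral_left[OF fin])
      show "?N s \<subseteq> {t \<in> S. e t < n}" using n by auto
      show "\<forall>t\<in>{t \<in> S. e t < n} - ?N s. \<psi> t x = 0"
      proof
        fix t assume t: "t \<in> {t \<in> S. e t < n} - ?N s"
        have "\<phi> t x = 0"
        proof (rule ccontr)
          assume "\<phi> t x \<noteq> 0"
          from nz[OF this] have "dist t s < 4 * A\<^sub>1 * r + r"
            using x dist_triangle[of t s x] by (simp add: dist_commute)
          moreover have "r \<le> A\<^sub>1 * r" using A1_ge r by simp
          ultimately have "dist t s < (8 * A\<^sub>1) * r" using r by linarith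
          thus False using t by auto
        qed
        thus "\<psi> t x = 0" using zero t by simp
      qed
    qed
    also have "\<dots> = P n x" by (rule telescope)
    also have "P n x = 1"
    proof (rule antisym)
      show "P n x \<le> 1" using P01 by blast
      have "\<phi> s x \<le> P n x"
        unfolding P_def by (rule running_max_bounds(3)[where \<phi>=\<phi>, OF fin \<phi>1]) (use s n[OF Nself[OF s]] in simp)
      thus "1 \<le> P n x" using \<phi>(3)[OF x] by simp
    qed
    finally show ?thesis .
  qed
  show ?thesis
  proof (rule that)
    show "\<psi> s x = 0" if "s \<in> S" "4 * A\<^sub>1 * r \<le> dist s x" for s x
      using zero[OF that(1)] nz[of s x] that(2) by force
  qed (use FU energy bounds unity in auto)
qed

end

section \<open>Discrete convolutions\<close>

text \<open>A crude form of Hoelder's inequality: every term is at most the largest one, which is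
  itself a summand on the right.\<close>

lemma sum_powr_le:
  fixes x :: "'i \<Rightarrow> real"
  assumes "finite I" "\<And>i. i \<in> I \<Longrightarrow> 0 \<le> x i" "0 < p" "card I \<le> N"
  shows "(\<Sum>i\<in>I. x i) powr p \<le> real N powr p * (\<Sum>i\<in>I. x i powr p)"
proof (cases "I = {}")
  case False
  define M where "M = Max (x ` I)"
  have M: "x i \<le> M" if "i \<in> I" for i using assms(1) that by (simp add: M_def)
  have "M \<in> x ` I" unfolding M_def using assms(1) False by (intro Max_in) auto
  then obtain j where j: "j \<in> I" "x j = M" by auto
  have M0: "0 \<le> M" using assms(2)[OF j(1)] j(2) by simp
  have "(\<Sum>i\<in>I. x i) \<le> real (card I) * M" using sum_bounded_above[of I x M] M by simp
  also have "\<dots> \<le> real N * M" using assms(4) M0 by (intro mult_right_mono) auto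
  finally have "(\<Sum>i\<in>I. x i) powr p \<le> (real N * M) powr p"
    using assms by (intro powr_mono2 sum_nonneg) auto
  also have "\<dots> = real N powr p * x j powr p" using M0 j by (simp add: powr_mult)
  also have "x j powr p \<le> (\<Sum>i\<in>I. x i powr p)" by (rule member_le_sum[OF j(1) _ assms(1)]) simp
  finally show ?thesis by (simp add: mult_left_mono)
qed simp

lemma Lp_set_integrable:
  assumes u: "u \<in> Lp_space m p" and p: "1 < p" and B[measurable]: "B \<in> sets m" and fin: "emeasure m B < \<infinity>"
  shows "set_integrable m B u"
proof -
  have [measurable]: "u \<in> borel_measurable m" and i: "integrable m (\<lambda>x. \<bar>u x\<bar> powr p)"
    using u by (auto simp: Lp_space_iff)
  have "integrable m (\<lambda>x. indicat_real B x + \<bar>u x\<bar> powr p)"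
    using i fin by (intro Bochner_Integration.integrable_add integrable_real_indicator) auto
  thus ?thesis
    unfolding set_integrable_def
  proof (rule Bochner_Integration.integrable_bound)
    have "\<bar>t\<bar> \<le> 1 + \<bar>t\<bar> powr p" for t :: real
    proof (cases "\<bar>t\<bar> \<le> 1")
      case False
      hence "\<bar>t\<bar> powr 1 \<le> \<bar>t\<bar> powr p" using p by (intro powr_mono) auto
      thus ?thesis using False by simp
    qed (simp add: add_increasing2)
    thus "AE x in m. norm (indicat_real B x *\<^sub>R u x) \<le> norm (indicat_real B x + \<bar>u x\<bar> powr p)"
      by (auto simp: indicator_def)
  qed measurable
qed

context energy_poincare
begin

abbreviation ks_inner :: "real \<Rightarrow> 'a set \<Rightarrow> ('a \<Rightarrow> real) \<Rightarrow> 'a \<Rightarrow> ennreal" where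
  "ks_inner R \<Omega> g y \<equiv> (\<integral>\<^sup>+x\<in>\<Omega> \<inter> ball y R. ennreal (\<bar>g x - g y\<bar> powr p) \<partial>m) / emeasure m (ball y R)"

lemma F_jensen:
  assumes g: "g \<in> F" and r: "0 < r"
  shows "ennreal (\<bar>mean_value m (ball s r) g - k\<bar> powr p * vol s r) \<le>
    (\<integral>\<^sup>+x\<in>ball s r. ennreal (\<bar>g x - k\<bar> powr p) \<partial>m)"
  by (rule jensen_mean_value[OF p_gt_1])
    (use g r F_measurable_m F_Lp p_gt_1 ball_finite vol_pos in \<open>auto intro!: Lp_set_integrable[of _ _ p]\<close>)

text \<open>Jensen's inequality on \<open>ball t r\<close>, which lies in the ball of radius
  \<open>16 * A\<^sub>1 * r\<close> about \<open>y\<close>; the two volumes differ by at most the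
  factor \<open>K_vol\<close>. The right side is the density of \<open>ks_energy\<close> at
  \<open>y\<close>.\<close>

lemma mean_value_diff_le:
  assumes g: "g \<in> F" and r: "0 < r" and t: "dist t s < (8 * A\<^sub>1) * r" and y: "y \<in> ball s r"
    and \<Omega>: "ball t r \<subseteq> \<Omega>"
  shows "ennreal (\<bar>mean_value m (ball t r) g - g y\<bar> powr p) \<le> ennreal K_vol * ks_inner (16 * A\<^sub>1 * r) \<Omega> g y"
proof -
  let ?R = "16 * A\<^sub>1 * r" and ?a = "mean_value m (ball t r) g"
  have R: "0 < ?R" using A1_ge r by simp
  have v: "0 < vol t r" "0 < vol y ?R" using vol_pos r R by auto
  have rA: "r \<le> A\<^sub>1 * r" using A1_ge r by simp
  have dty: "dist y t < 9 * A\<^sub>1 * r"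
  proof -
    have "dist s y < r" using y by simp
    thus ?thesis using t rA dist_triangle[of y t s] dist_commute[of t s] dist_commute[of s y] by linarith
  qed
  have sub: "ball t r \<subseteq> \<Omega> \<inter> ball y ?R"
  proof
    fix x assume x: "x \<in> ball t r"
    have "dist t x < r" using x by simp
    hence "dist y x < ?R" using dty rA dist_triangle[of y x t] r by linarith
    thus "x \<in> \<Omega> \<inter> ball y ?R" using x \<Omega> by auto
  qed
  have "vol y ?R \<le> K_vol * vol t r"
    by (rule vol_le_K_vol[OF r]) (use dty in simp)
  hence vv: "1 / vol t r \<le> K_vol * (1 / vol y ?R)" using v by (simp add: field_simps)
  have "ennreal (\<bar>?a - g y\<bar> powr p) = ennreal (1 / vol t r) * ennreal (\<bar>?a - g y\<bar> powr p * vol t r)"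
    using v by (simp add: ennreal_mult[symmetric])
  also have "\<dots> \<le> ennreal (1 / vol t r) * (\<integral>\<^sup>+x\<in>ball t r. ennreal (\<bar>g x - g y\<bar> powr p) \<partial>m)"
    by (intro mult_left_mono F_jensen[OF g r]) simp
  also have "\<dots> \<le> ennreal (K_vol * (1 / vol y ?R)) * (\<integral>\<^sup>+x\<in>\<Omega> \<inter> ball y ?R. ennreal (\<bar>g x - g y\<bar> powr p) \<partial>m)"
    by (intro mult_mono ennreal_leI vv nn_integral_mono) (use sub in \<open>auto simp: indicator_def\<close>)
  also have "\<dots> = ennreal K_vol * ks_inner ?R \<Omega> g y"
    unfolding emeasure_ball divide_ennreal_eq_mult[OF v(2)]
    using K_vol_ge v(2) by (subst ennreal_mult) (auto simp: mult_ac)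
  finally show ?thesis .
qed

text \<open>In the factor \<open>1 + K_unity * K_vol\<close>, the first summand accounts for the
  \<open>L^p\<close> error of the discrete convolution and the second for its energy.\<close>

definition K_conv :: real where
  "K_conv = real K_nbr powr p * (1 + K_unity * K_vol) * real K_nbr * K_vol * overlap 1"

lemma sum_ks_inner_le:
  fixes S :: "'a set"
  assumes S: "is_net r S" "0 < r" and g: "g \<in> F" and [measurable]: "\<Omega> \<in> sets borel" and T: "T \<subseteq> S"
    and K: "0 \<le> K"
  shows "(\<integral>\<^sup>+s. ennreal K * (\<integral>\<^sup>+y\<in>ball s r. ks_inner R \<Omega> g y * indicator \<Omega> y \<partial>m) \<partial>count_space T)
    \<le> ennreal (K * overlap 1) * ks_energy m p R \<Omega> g"
proof -
  have [measurable]: "g \<in> borel_measurable borel" by (rule F_measurable[OF g])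
  have "(\<integral>\<^sup>+s. ennreal K * (\<integral>\<^sup>+y\<in>ball s r. ks_inner R \<Omega> g y * indicator \<Omega> y \<partial>m) \<partial>count_space T)
      = ennreal K * (\<integral>\<^sup>+s. (\<integral>\<^sup>+y\<in>ball s (1 * r). ks_inner R \<Omega> g y * indicator \<Omega> y \<partial>m) \<partial>count_space T)"
    by (subst nn_integral_cmult) auto
  also have "\<dots> \<le> ennreal K * (of_nat (overlap 1) * (\<integral>\<^sup>+y\<in>UNIV. ks_inner R \<Omega> g y * indicator \<Omega> y \<partial>m))"
    by (intro mult_left_mono nn_integral_net_overlap[OF S]) (use T in auto)
  also have "\<dots> = ennreal (K * overlap 1) * ks_energy m p R \<Omega> g"
    using K by (simp add: ks_energy_def ennreal_mult ennreal_of_nat_eq_real_of_nat mult.assoc)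
  finally show ?thesis .
qed

lemma sum_Cc:
  fixes f :: "'i \<Rightarrow> 'a \<Rightarrow> real"
  assumes "finite I" "\<And>i. i \<in> I \<Longrightarrow> f i \<in> Cc"
  shows "(\<lambda>x. \<Sum>i\<in>I. k i * f i x) \<in> Cc"
  using assms
proof (induction I rule: finite_induct)
  case empty
  thus ?case by (simp add: mem_Cc_iff)
next
  case (insert i I)
  hence 1: "f i \<in> Cc" "(\<lambda>x. \<Sum>i\<in>I. k i * f i x) \<in> Cc" by auto
  have "(\<lambda>x. k i * f i x + (\<Sum>i\<in>I. k i * f i x)) \<in> Cc"
    by (rule Cc_combine[OF 1])
      (use Cc_continuous[OF 1(1)] Cc_continuous[OF 1(2)] in \<open>auto intro!: continuous_intros\<close>)
  thus ?case using insert by simp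
qed

lemma sum_scaled_F:
  assumes "finite I" "\<And>i. i \<in> I \<Longrightarrow> f i \<in> F"
  shows "(\<lambda>x. \<Sum>i\<in>I. k i * f i x) \<in> F" "E_norm (\<lambda>x. \<Sum>i\<in>I. k i * f i x) \<le> (\<Sum>i\<in>I. \<bar>k i\<bar> * E_norm (f i))"
proof -
  have m: "(\<lambda>x. k i * f i x) \<in> F" if "i \<in> I" for i using F_closed(3)[OF assms(2)[OF that]] .
  note * = seminorm_on_sum_le[OF F_subspace E_seminorm assms(1), of "\<lambda>i x. k i * f i x", OF m]
  show "(\<lambda>x. \<Sum>i\<in>I. k i * f i x) \<in> F" using * by blast
  have "E_norm (\<lambda>x. k i * f i x) = \<bar>k i\<bar> * E_norm (f i)" if "i \<in> I" for i
    using E_norm_simps(2)[OF assms(2)[OF that]] .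
  thus "E_norm (\<lambda>x. \<Sum>i\<in>I. k i * f i x) \<le> (\<Sum>i\<in>I. \<bar>k i\<bar> * E_norm (f i))" using * by simp
qed

text \<open>Because the partition sums to one near \<open>s\<close>, both \<open>h - g\<close> and
  \<open>h - a s\<close> become combinations of neighbouring members with coefficients
  \<open>a t - g\<close> and \<open>a t - a s\<close>. These differences are oscillations of
  \<open>g\<close> at scale \<open>16 * A\<^sub>1 * r\<close>, so one estimate yields the
  \<open>L^p\<close> error and, by locality, the energy on \<open>ball s r\<close>.\<close>

lemma discrete_convolution:
  assumes g: "g \<in> F \<inter> Cc" and r: "0 < r" "2 * r < R\<^sub>0"
  obtains h where "h \<in> F \<inter> Cc"
    "(\<integral>\<^sup>+x. ennreal (\<bar>h x - g x\<bar> powr p) \<partial>m) \<le> ennreal K_conv * ks_energy m p (16 * A\<^sub>1 * r) UNIV g"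
    "\<And>\<Omega> D. \<Omega> \<in> sets borel \<Longrightarrow> D \<in> sets borel \<Longrightarrow> (\<And>x. x \<in> D \<Longrightarrow> ball x (16 * A\<^sub>1 * r) \<subseteq> \<Omega>) \<Longrightarrow>
       emeasure (\<Gamma> h) D \<le> ennreal (K_conv / r powr \<beta>) * ks_energy m p (16 * A\<^sub>1 * r) \<Omega> g"
proof -
  let ?R = "16 * A\<^sub>1 * r"
  have gF: "g \<in> F" and gC: "g \<in> Cc" using g by auto
  have [measurable]: "g \<in> borel_measurable borel" by (rule F_measurable[OF gF])
  have rA: "r \<le> A\<^sub>1 * r" using A1_ge r by simp
  obtain S :: "'a set" where S: "is_net r S" using net_exists[OF r(1)] by blast
  let ?N = "neighbours S r"
  note finN = neighbours_finite[OF S r(1)]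
  obtain \<psi> where \<psi>: "\<And>s. s \<in> S \<Longrightarrow> \<psi> s \<in> F \<inter> Cc"
    and \<psi>E: "\<And>s. s \<in> S \<Longrightarrow> \<E> (\<psi> s) \<le> K_unity * vol s r / r powr \<beta>"
    and \<psi>01: "\<And>s x. s \<in> S \<Longrightarrow> 0 \<le> \<psi> s x \<and> \<psi> s x \<le> 1"
    and \<psi>0: "\<And>s x. s \<in> S \<Longrightarrow> 4 * A\<^sub>1 * r \<le> dist s x \<Longrightarrow> \<psi> s x = 0"
    and unity: "\<And>s x. s \<in> S \<Longrightarrow> x \<in> ball s r \<Longrightarrow> (\<Sum>t\<in>?N s. \<psi> t x) = 1"
    by (rule partition_of_unity[OF S r]) blast
  define a where "a s = mean_value m (ball s r) g" for s
  \<comment> \<open>A ball that misses the support of \<open>g\<close> has mean zero. Dropping such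
    net points leaves a finite sum, so \<open>h\<close> lies in \<open>F\<close> by
    linearity.\<close>
  define I where "I = {s \<in> S. a s \<noteq> 0}"
  have "finite I"
  proof -
    have "bounded {x. g x \<noteq> 0}" using gC by (simp add: mem_Cc_iff)
    then obtain x0 \<rho>0 where "\<forall>x\<in>{x. g x \<noteq> 0}. dist x0 x \<le> \<rho>0" unfolding bounded_def by blast
    moreover define \<rho> where "\<rho> = \<bar>\<rho>0\<bar> + 1"
    ultimately have \<rho>: "{x. g x \<noteq> 0} \<subseteq> cball x0 \<rho>" "0 < \<rho>" by fastforce+
    have "I \<subseteq> {s \<in> S. dist s x0 < ((\<rho> + r) / r) * r}"
    proof
      fix s assume s: "s \<in> I"
      have "\<exists>x\<in>ball s r. g x \<noteq> 0"
      proof (rule ccontr)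
        assume "\<not> ?thesis"
        hence "(\<lambda>x. indicat_real (ball s r) x *\<^sub>R g x) = (\<lambda>x. 0)" by (auto simp: indicator_def)
        hence "a s = 0" by (simp add: a_def mean_value_def set_lebesgue_integral_def)
        thus False using s by (simp add: I_def)
      qed
      then obtain x where "x \<in> ball s r" "g x \<noteq> 0" by blast
      hence "dist s x < r" "dist x0 x \<le> \<rho>" using \<rho> by auto
      hence "dist s x0 < \<rho> + r" using dist_triangle[of s x0 x] by (simp add: dist_commute)
      thus "s \<in> {s \<in> S. dist s x0 < ((\<rho> + r) / r) * r}" using s r by (simp add: I_def)
    qed
    moreover have "finite {s \<in> S. dist s x0 < ((\<rho> + r) / r) * r}"
      using net_overlap[OF S r(1), of "(\<rho> + r) / r" x0] r \<rho> by auto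
    ultimately show ?thesis by (rule finite_subset)
  qed
  define h where "h x = (\<Sum>t\<in>I. a t * \<psi> t x)" for x
  have \<psi>F: "\<psi> s \<in> F" and \<psi>C: "\<psi> s \<in> Cc" if "s \<in> S" for s using \<psi>[OF that] by auto
  have IS: "I \<subseteq> S" by (auto simp: I_def)
  have hF: "h \<in> F" unfolding h_def[abs_def]
    by (rule sum_scaled_F(1)[OF \<open>finite I\<close>]) (use \<psi>F IS in auto)
  have hC: "h \<in> Cc" unfolding h_def[abs_def]
    by (rule sum_Cc[OF \<open>finite I\<close>]) (use \<psi>C IS in auto)
  have h_local: "h x = (\<Sum>t\<in>?N s. a t * \<psi> t x)" if s: "s \<in> S" and x: "x \<in> ball s r" for s x
  proof -
    have z: "\<psi> t x = 0" if "t \<in> S" "t \<notin> ?N s" for t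
    proof (rule \<psi>0[OF that(1)])
      have "(8 * A\<^sub>1) * r \<le> dist t s" using that by simp
      moreover have "dist t s < dist t x + r"
        using x dist_triangle[of t s x] by (simp add: dist_commute)
      ultimately show "4 * A\<^sub>1 * r \<le> dist t x" using rA r by linarith
    qed
    have "h x = (\<Sum>t\<in>I \<union> ?N s. a t * \<psi> t x)"
      unfolding h_def by (rule sum.mono_neutral_left) (use \<open>finite I\<close> finN in \<open>auto simp: I_def\<close>)
    also have "\<dots> = (\<Sum>t\<in>?N s. a t * \<psi> t x)"
      by (rule sum.mono_neutral_right) (use \<open>finite I\<close> finN z IS in auto)
    finally show ?thesis .
  qed
  \<comment> \<open>The common quantity of both estimates: it bounds the \<open>L^p\<close> error on
    \<open>ball s r\<close> directly, and \<open>\<bar>a t - a s\<bar> powr p * vol s r\<close>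
    through Jensen's inequality.\<close>
  define X where "X s t = (\<integral>\<^sup>+y\<in>ball s r. ennreal (\<bar>a t - g y\<bar> powr p) \<partial>m)" for s t
  define w where "w \<Omega> s = (\<integral>\<^sup>+y\<in>ball s r. ks_inner ?R \<Omega> g y * indicator \<Omega> y \<partial>m)" for \<Omega> s
  have X_le: "X s t \<le> ennreal K_vol * w \<Omega> s"
    if "s \<in> S" "t \<in> ?N s" "ball s r \<subseteq> \<Omega>" "ball t r \<subseteq> \<Omega>" "\<Omega> \<in> sets borel" for s t \<Omega>
  proof -
    have [measurable]: "\<Omega> \<in> sets borel" by fact
    have "X s t \<le> (\<integral>\<^sup>+y. ennreal K_vol * (ks_inner ?R \<Omega> g y * indicator \<Omega> y * indicator (ball s r) y) \<partial>m)"
      unfolding X_def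
    proof (rule nn_integral_mono)
      fix y
      show "ennreal (\<bar>a t - g y\<bar> powr p) * indicator (ball s r) y \<le>
          ennreal K_vol * (ks_inner ?R \<Omega> g y * indicator \<Omega> y * indicator (ball s r) y)"
      proof (cases "y \<in> ball s r")
        case True
        hence "y \<in> \<Omega>" using that(3) by blast
        thus ?thesis
          using mean_value_diff_le[OF gF r(1) _ True that(4)] that(2) True by (simp add: a_def)
      qed simp
    qed
    also have "\<dots> = ennreal K_vol * w \<Omega> s" unfolding w_def by (rule nn_integral_cmult) measurable
    finally show ?thesis .
  qed
  have sum_X: "(\<Sum>t\<in>?N s. X s t) \<le> ennreal (real K_nbr * K_vol) * w \<Omega> s"
    if s: "s \<in> S" and sub: "\<And>t. t \<in> ?N s \<Longrightarrow> ball t r \<subseteq> \<Omega>" and \<Omega>: "\<Omega> \<in> sets borel" for s \<Omega>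
  proof -
    have ss: "s \<in> ?N s" using s r A1_ge by simp
    have "(\<Sum>t\<in>?N s. X s t) \<le> (\<Sum>t\<in>?N s. ennreal K_vol * w \<Omega> s)"
      by (intro sum_mono X_le s sub ss \<Omega>)
    also have "\<dots> = of_nat (card (?N s)) * (ennreal K_vol * w \<Omega> s)" by simp
    also have "\<dots> \<le> of_nat K_nbr * (ennreal K_vol * w \<Omega> s)"
      using finN(2)[of s] by (intro mult_right_mono) auto
    also have "\<dots> = ennreal (real K_nbr * K_vol) * w \<Omega> s"
      using K_vol_ge by (simp add: ennreal_mult ennreal_of_nat_eq_real_of_nat mult.assoc)
    finally show ?thesis .
  qed
  show ?thesis
  proof (rule that)
    show "h \<in> F \<inter> Cc" using hF hC by simp
    have [measurable]: "h \<in> borel_measurable borel" by (rule F_measurable[OF hF])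
    let ?M = "real K_nbr powr p"
    have Lp_local: "(\<integral>\<^sup>+y\<in>ball s r. ennreal (\<bar>h y - g y\<bar> powr p) \<partial>m) \<le>
        ennreal (?M * (real K_nbr * K_vol)) * w UNIV s" if s: "s \<in> S" for s
    proof -
      have "(\<integral>\<^sup>+y\<in>ball s r. ennreal (\<bar>h y - g y\<bar> powr p) \<partial>m) \<le>
          (\<integral>\<^sup>+y. ennreal ?M * (\<Sum>t\<in>?N s. ennreal (\<bar>a t - g y\<bar> powr p) * indicator (ball s r) y) \<partial>m)"
      proof (rule nn_integral_mono)
        fix y
        show "ennreal (\<bar>h y - g y\<bar> powr p) * indicator (ball s r) y \<le>
            ennreal ?M * (\<Sum>t\<in>?N s. ennreal (\<bar>a t - g y\<bar> powr p) * indicator (ball s r) y)"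
        proof (cases "y \<in> ball s r")
          case True
          have "h y - g y = (\<Sum>t\<in>?N s. a t * \<psi> t y) - g y * (\<Sum>t\<in>?N s. \<psi> t y)"
            using h_local[OF s True] unity[OF s True] by simp
          also have "\<dots> = (\<Sum>t\<in>?N s. (a t - g y) * \<psi> t y)"
            by (simp add: sum_distrib_left sum_subtractf[symmetric] left_diff_distrib)
          finally have "\<bar>h y - g y\<bar> \<le> (\<Sum>t\<in>?N s. \<bar>(a t - g y) * \<psi> t y\<bar>)" by simp
          also have "\<dots> \<le> (\<Sum>t\<in>?N s. \<bar>a t - g y\<bar>)"
          proof (rule sum_mono)
            fix t assume "t \<in> ?N s"
            hence "0 \<le> \<psi> t y" "\<psi> t y \<le> 1" using \<psi>01[of t y] by auto
            thus "\<bar>(a t - g y) * \<psi> t y\<bar> \<le> \<bar>a t - g y\<bar>"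
              by (simp add: abs_mult mult_left_le)
          qed
          finally have "\<bar>h y - g y\<bar> powr p \<le> (\<Sum>t\<in>?N s. \<bar>a t - g y\<bar>) powr p"
            using p_pos by (intro powr_mono2) auto
          also have "\<dots> \<le> ?M * (\<Sum>t\<in>?N s. \<bar>a t - g y\<bar> powr p)"
            by (rule sum_powr_le) (use finN p_pos in auto)
          finally show ?thesis using True
            by (simp add: sum_ennreal ennreal_mult[symmetric] sum_nonneg ennreal_leI)
        qed simp
      qed
      also have "\<dots> = ennreal ?M * (\<Sum>t\<in>?N s. X s t)"
        unfolding X_def by (subst nn_integral_cmult, measurable, subst nn_integral_sum) auto
      also have "\<dots> \<le> ennreal ?M * (ennreal (real K_nbr * K_vol) * w UNIV s)"
        by (intro mult_left_mono sum_X s) auto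
      also have "\<dots> = ennreal (?M * (real K_nbr * K_vol)) * w UNIV s"
        using K_vol_ge by (simp add: ennreal_mult mult.assoc)
      finally show ?thesis .
    qed
    have K_le: "?M * (real K_nbr * K_vol) * overlap 1 \<le> K_conv"
      and K_le': "?M * (K_unity * K_vol) * (real K_nbr * K_vol) * overlap 1 \<le> K_conv"
    proof -
      have 0: "0 \<le> K_unity * K_vol" using Cc_pos c K_vol_ge by (simp add: K_unity_def)
      have 1: "0 \<le> ?M * (real K_nbr * K_vol) * overlap 1" using K_vol_ge by simp
      have eq: "K_conv = (1 + K_unity * K_vol) * (?M * (real K_nbr * K_vol) * overlap 1)"
        by (simp add: K_conv_def)
      show "?M * (real K_nbr * K_vol) * overlap 1 \<le> K_conv"
        "?M * (K_unity * K_vol) * (real K_nbr * K_vol) * overlap 1 \<le> K_conv"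
        unfolding eq using mult_nonneg_nonneg[OF 0 1] 1 by (auto simp: algebra_simps)
    qed
    have "(\<integral>\<^sup>+x. ennreal (\<bar>h x - g x\<bar> powr p) \<partial>m) = (\<integral>\<^sup>+x\<in>UNIV. ennreal (\<bar>h x - g x\<bar> powr p) \<partial>m)" by simp
    also have "\<dots> \<le> (\<integral>\<^sup>+s. (\<integral>\<^sup>+x\<in>UNIV \<inter> ball s r. ennreal (\<bar>h x - g x\<bar> powr p) \<partial>m)
        \<partial>count_space {s \<in> S. UNIV \<inter> ball s r \<noteq> {}})"
      by (rule nn_integral_net_cover[OF S r(1)]) auto
    also have "\<dots> \<le> (\<integral>\<^sup>+s. ennreal (?M * (real K_nbr * K_vol)) * w UNIV s
        \<partial>count_space {s \<in> S. UNIV \<inter> ball s r \<noteq> {}})"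
      by (rule nn_integral_mono) (use Lp_local in auto)
    also have "\<dots> \<le> ennreal (?M * (real K_nbr * K_vol) * overlap 1) * ks_energy m p ?R UNIV g"
      unfolding w_def by (rule sum_ks_inner_le[OF S r(1) gF]) (use K_vol_ge in auto)
    also have "\<dots> \<le> ennreal K_conv * ks_energy m p ?R UNIV g"
      by (intro mult_right_mono ennreal_leI K_le) auto
    finally show "(\<integral>\<^sup>+x. ennreal (\<bar>h x - g x\<bar> powr p) \<partial>m) \<le> ennreal K_conv * ks_energy m p ?R UNIV g" .
    fix \<Omega> D :: "'a set"
    assume \<Omega>[measurable]: "\<Omega> \<in> sets borel" and D[measurable]: "D \<in> sets borel"
      and inside: "\<And>x. x \<in> D \<Longrightarrow> ball x ?R \<subseteq> \<Omega>"
    let ?T = "{s \<in> S. D \<inter> ball s r \<noteq> {}}"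
    have sets: "sets (\<Gamma> h) = sets borel" by (rule Gamma_borel[OF hF])
    let ?K = "?M * (K_unity * K_vol) * (real K_nbr * K_vol) / r powr \<beta>"
    have step: "emeasure (\<Gamma> h) (D \<inter> ball s r) \<le> ennreal ?K * w \<Omega> s" if s: "s \<in> ?T" for s
    proof -
      have sS: "s \<in> S" using s by simp
      \<comment> \<open>constants are invisible to the energy measure, but need not belong to \<open>F\<close>\<close>
      define k where "k x = (\<Sum>t\<in>?N s. (a t - a s) * \<psi> t x)" for x
      have kF: "k \<in> F" unfolding k_def[abs_def] by (rule sum_scaled_F(1)[OF finN(1)]) (simp add: \<psi>F)
      have kE: "E_norm k \<le> (\<Sum>t\<in>?N s. \<bar>a t - a s\<bar> * E_norm (\<psi> t))"
        unfolding k_def[abs_def] by (rule sum_scaled_F(2)[OF finN(1)]) (simp add: \<psi>F)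
      have kC: "k \<in> Cc" unfolding k_def[abs_def] by (rule sum_Cc[OF finN(1)]) (simp add: \<psi>C)
      have "h x - k x = a s" if x: "x \<in> ball s r" for x
      proof -
        have "h x - k x = (\<Sum>t\<in>?N s. a s * \<psi> t x)"
          unfolding h_local[OF sS x] k_def sum_subtractf[symmetric] by (simp add: left_diff_distrib)
        also have "\<dots> = a s" using unity[OF sS x] by (simp flip: sum_distrib_left)
        finally show ?thesis .
      qed
      hence "emeasure (\<Gamma> h) (D \<inter> ball s r) = emeasure (\<Gamma> k) (D \<inter> ball s r)"
        using hF hC kF kC by (intro Gamma_local[of _ _ "ball s r"]) auto
      also have "\<dots> \<le> emeasure (\<Gamma> k) UNIV"
        using Gamma_borel[OF kF] by (intro emeasure_mono) auto
      also have "\<dots> = ennreal (\<E> k)" using Gamma_emeasure[OF kF] E_eq_Gamma[OF kF] by simp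
      also have "\<dots> \<le> ennreal (?M * (K_unity * K_vol / r powr \<beta>) * (\<Sum>t\<in>?N s. \<bar>a t - a s\<bar> powr p * vol s r))"
      proof (rule ennreal_leI)
        have "E_norm k powr p \<le> (\<Sum>t\<in>?N s. \<bar>a t - a s\<bar> * E_norm (\<psi> t)) powr p"
          using kE p_pos by (intro powr_mono2) auto
        also have "\<dots> \<le> ?M * (\<Sum>t\<in>?N s. (\<bar>a t - a s\<bar> * E_norm (\<psi> t)) powr p)"
          by (rule sum_powr_le) (use finN p_pos in auto)
        also have "\<dots> \<le> ?M * (\<Sum>t\<in>?N s. (K_unity * K_vol / r powr \<beta>) * (\<bar>a t - a s\<bar> powr p * vol s r))"
        proof (intro mult_left_mono sum_mono)
          fix t assume t: "t \<in> ?N s"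
          have "vol t r \<le> K_vol * vol s r"
          proof (rule vol_le_K_vol[OF r(1)])
            have "dist t s < (8 * A\<^sub>1) * r" using t by simp
            thus "dist t s + r \<le> 25 * A\<^sub>1 * r" using rA r by linarith
          qed
          moreover have "0 \<le> K_unity" using Cc_pos c K_vol_ge by (simp add: K_unity_def)
          ultimately have "K_unity * vol t r / r powr \<beta> \<le> K_unity * (K_vol * vol s r) / r powr \<beta>"
            by (intro divide_right_mono mult_left_mono) auto
          hence "\<E> (\<psi> t) \<le> K_unity * (K_vol * vol s r) / r powr \<beta>" using \<psi>E[of t] t by auto
          hence "\<bar>a t - a s\<bar> powr p * \<E> (\<psi> t) \<le> \<bar>a t - a s\<bar> powr p * (K_unity * (K_vol * vol s r) / r powr \<beta>)"
            by (intro mult_left_mono) auto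
          thus "(\<bar>a t - a s\<bar> * E_norm (\<psi> t)) powr p \<le> (K_unity * K_vol / r powr \<beta>) * (\<bar>a t - a s\<bar> powr p * vol s r)"
            using E_norm_powr[OF \<psi>F[of t]] t by (simp add: powr_mult mult_ac)
        qed simp
        finally show "\<E> k \<le> ?M * (K_unity * K_vol / r powr \<beta>) * (\<Sum>t\<in>?N s. \<bar>a t - a s\<bar> powr p * vol s r)"
          using E_norm_powr[OF kF] by (simp add: sum_distrib_left mult.assoc)
      qed
      also have "\<dots> = ennreal (?M * (K_unity * K_vol / r powr \<beta>)) * (\<Sum>t\<in>?N s. ennreal (\<bar>a t - a s\<bar> powr p * vol s r))"
        using Cc_pos c K_vol_ge by (subst ennreal_mult) (auto simp: sum_ennreal K_unity_def intro!: sum_nonneg)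
      also have "\<dots> \<le> ennreal (?M * (K_unity * K_vol / r powr \<beta>)) * (\<Sum>t\<in>?N s. X s t)"
      proof (intro mult_left_mono sum_mono)
        fix t
        show "ennreal (\<bar>a t - a s\<bar> powr p * vol s r) \<le> X s t"
          using F_jensen[OF gF r(1), of s "a t"]
          by (simp add: X_def a_def[of s, symmetric] abs_minus_commute[of _ "a t"])
      qed simp
      also have "\<dots> \<le> ennreal (?M * (K_unity * K_vol / r powr \<beta>)) * (ennreal (real K_nbr * K_vol) * w \<Omega> s)"
      proof (intro mult_left_mono sum_X sS \<Omega>)
        fix t assume t: "t \<in> ?N s"
        \<comment> \<open>The chain from \<open>d\<close> through \<open>s\<close> and
          \<open>t\<close> to \<open>x\<close> is shorter than \<open>10 * A\<^sub>1 * r\<close>, so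
          it stays within the radius \<open>?R\<close> about a point of \<open>D\<close>.\<close>
        obtain d where d: "d \<in> D" "d \<in> ball s r" using s by auto
        show "ball t r \<subseteq> \<Omega>"
        proof
          fix x assume x: "x \<in> ball t r"
          have "dist d x \<le> dist d s + dist s t + dist t x"
            using dist_triangle[of d x s] dist_triangle[of s x t] by linarith
          also have "\<dots> < ?R"
          proof -
            have "dist s d < r" "dist t x < r" "dist t s < (8 * A\<^sub>1) * r" using d x t by auto
            thus ?thesis using rA r dist_commute[of d s] dist_commute[of s t] by linarith
          qed
          finally show "x \<in> \<Omega>" using inside[OF d(1)] by auto
        qed
      qed simp
      also have "\<dots> = ennreal ?K * w \<Omega> s"
        using Cc_pos c K_vol_ge by (simp add: ennreal_mult[symmetric] mult.assoc[symmetric] K_unity_def)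
      finally show ?thesis .
    qed
    have "emeasure (\<Gamma> h) D = (\<integral>\<^sup>+x\<in>D. 1 \<partial>\<Gamma> h)" using sets by simp
    also have "\<dots> \<le> (\<integral>\<^sup>+s. (\<integral>\<^sup>+x\<in>D \<inter> ball s r. 1 \<partial>\<Gamma> h) \<partial>count_space ?T)"
      by (rule nn_integral_net_cover[OF S r(1) sets]) auto
    also have "\<dots> \<le> (\<integral>\<^sup>+s. ennreal ?K * w \<Omega> s \<partial>count_space ?T)"
      by (rule nn_integral_mono) (use step sets in auto)
    also have "\<dots> \<le> ennreal (?K * overlap 1) * ks_energy m p ?R \<Omega> g"
      unfolding w_def by (rule sum_ks_inner_le[OF S r(1) gF \<Omega>])
        (use K_vol_ge Cc_pos c in \<open>auto simp: K_unity_def\<close>)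
    also have "\<dots> \<le> ennreal (K_conv / r powr \<beta>) * ks_energy m p ?R \<Omega> g"
      using divide_right_mono[OF K_le', of "r powr \<beta>"] by (intro mult_right_mono ennreal_leI) auto
    finally show "emeasure (\<Gamma> h) D \<le> ennreal (K_conv / r powr \<beta>) * ks_energy m p ?R \<Omega> g" .
  qed
qed

end

section \<open>The energy measure is controlled by the Korevaar--Schoen energy\<close>

context energy_poincare
begin

text \<open>The power of \<open>16 * A\<^sub>1\<close> arises because the energy at scale
  \<open>s\<close> is compared with the convolution at scale
  \<open>s / (16 * A\<^sub>1)\<close>.\<close>

definition K_lsc :: real where "K_lsc = K_conv * (16 * A\<^sub>1) powr \<beta>"

lemma K_conv_nonneg: "0 \<le> K_conv"
  using K_vol_ge Cc_pos c by (simp add: K_conv_def K_unity_def)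

lemma K_lsc_nonneg: "0 \<le> K_lsc"
  using K_conv_nonneg by (simp add: K_lsc_def)

abbreviation G_norm :: "'a set \<Rightarrow> ('a \<Rightarrow> real) \<Rightarrow> real" where
  "G_norm D u \<equiv> measure (\<Gamma> u) D powr (1 / p)"

lemma G_norm_powr: "G_norm D u powr p = measure (\<Gamma> u) D"
  using p_pos by (simp add: powr_powr)

lemma G_norm_le_E_norm:
  assumes "u \<in> F" "D \<in> sets borel"
  shows "G_norm D u \<le> E_norm u"
proof -
  interpret finite_measure "\<Gamma> u" by (rule Gamma_finite[OF assms(1)])
  have "measure (\<Gamma> u) D \<le> measure (\<Gamma> u) UNIV"
    using assms(2) Gamma_borel[OF assms(1)] by (intro finite_measure_mono) auto
  thus ?thesis using E_eq_Gamma[OF assms(1)] p_pos by (auto intro!: powr_mono2)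
qed

text \<open>The convolutions at the scales \<open>r k / (16 * A\<^sub>1)\<close> converge to
  \<open>g\<close> in \<open>L^p\<close>. Their total energy is bounded through the Poincare
  inequality, as weak compactness requires, while on \<open>D\<close> the sharper bound
  \<open>K_lsc * L\<close> holds. The functions obeying the latter form a convex set, so Mazur's
  lemma finds one arbitrarily close to \<open>g\<close> in the energy norm.\<close>

lemma energy_le_ks_liminf_Cc:
  assumes g: "g \<in> F \<inter> Cc" and \<Omega>: "\<Omega> \<in> sets borel" and D: "D \<in> sets borel"
    and \<delta>: "0 < \<delta>" "\<And>x. x \<in> D \<Longrightarrow> ball x \<delta> \<subseteq> \<Omega>" and L: "0 \<le> L"
    and r: "\<And>k::nat. 0 < r k" "r \<longlonglongrightarrow> 0"
    and bound: "\<And>k. ks_energy m p (r k) \<Omega> g \<le> ennreal (L * r k powr \<beta>)"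
  shows "measure (\<Gamma> g) D \<le> K_lsc * L"
proof -
  define B where "B = 16 * A\<^sub>1"
  have B: "0 < B" using A1_ge by (simp add: B_def)
  have gF: "g \<in> F" using g by simp
  have "eventually (\<lambda>k. r k < min \<delta> (B * R\<^sub>0 / 2)) sequentially"
    using order_tendstoD(2)[OF r(2), of "min \<delta> (B * R\<^sub>0 / 2)"] \<delta>(1) B R0_pos by simp
  then obtain N where N: "\<And>k. N \<le> k \<Longrightarrow> r k < min \<delta> (B * R\<^sub>0 / 2)"
    unfolding eventually_sequentially by blast
  \<comment> \<open>The dropped initial terms ensure that balls of radius \<open>s k\<close> about
    points of \<open>D\<close> stay in \<Omega> and that cutoffs exist at the scale
    \<open>s k / B\<close>.\<close>
  define s where "s k = r (k + N)" for k
  have s: "0 < s k" "s k < \<delta>" "2 * (s k / B) < R\<^sub>0" for k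
    using r(1) N[of "k + N"] B by (auto simp: s_def field_simps)
  have s0: "s \<longlonglongrightarrow> 0" unfolding s_def using LIMSEQ_ignore_initial_segment[OF r(2)] by simp
  have powr_s: "K_conv / (s k / B) powr \<beta> * s k powr \<beta> = K_lsc" for k
    using s(1)[of k] B by (simp add: K_lsc_def B_def powr_divide)
  have "\<exists>h. h \<in> F \<and>
      (\<integral>\<^sup>+x. ennreal (\<bar>h x - g x\<bar> powr p) \<partial>m) \<le> ennreal (K_conv * (K_upper * s k powr \<beta> * \<E> g)) \<and>
      emeasure (\<Gamma> h) D \<le> ennreal (K_lsc * L) \<and> emeasure (\<Gamma> h) UNIV \<le> ennreal (K_lsc * (K_upper * \<E> g))" (is "\<exists>h. ?P k h") for k
  proof -
    have rk: "0 < s k / B" "16 * A\<^sub>1 * (s k / B) = s k" using s(1)[of k] B by (auto simp: B_def)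
    obtain h where h: "h \<in> F \<inter> Cc"
      "(\<integral>\<^sup>+x. ennreal (\<bar>h x - g x\<bar> powr p) \<partial>m) \<le> ennreal K_conv * ks_energy m p (s k) UNIV g"
      "\<And>\<Omega> D. \<Omega> \<in> sets borel \<Longrightarrow> D \<in> sets borel \<Longrightarrow> (\<And>x. x \<in> D \<Longrightarrow> ball x (s k) \<subseteq> \<Omega>) \<Longrightarrow>
       emeasure (\<Gamma> h) D \<le> ennreal (K_conv / (s k / B) powr \<beta>) * ks_energy m p (s k) \<Omega> g"
      using discrete_convolution[OF g rk(1) s(3)[of k]] unfolding rk(2) by blast
    have up: "ks_energy m p (s k) UNIV g \<le> ennreal (K_upper * s k powr \<beta> * \<E> g)"
      by (rule ks_energy_le_energy[OF gF s(1)]) simp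
    have up0: "0 \<le> K_upper * s k powr \<beta> * \<E> g" using K_upper_nonneg E_nonneg[OF gF] by simp
    have "ennreal K_conv * ks_energy m p (s k) UNIV g \<le> ennreal K_conv * ennreal (K_upper * s k powr \<beta> * \<E> g)"
      by (intro mult_left_mono up) simp
    hence 1: "(\<integral>\<^sup>+x. ennreal (\<bar>h x - g x\<bar> powr p) \<partial>m) \<le> ennreal (K_conv * (K_upper * s k powr \<beta> * \<E> g))"
      using h(2) K_conv_nonneg up0 by (simp add: ennreal_mult)
    have "ball x (s k) \<subseteq> \<Omega>" if "x \<in> D" for x
      using \<delta>(2)[OF that] s(2)[of k] subset_ball[of "s k" \<delta> x] by (meson less_imp_le order_trans)
    hence "emeasure (\<Gamma> h) D \<le> ennreal (K_conv / (s k / B) powr \<beta>) * ks_energy m p (s k) \<Omega> g"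
      by (rule h(3)[OF \<Omega> D])
    also have "\<dots> \<le> ennreal (K_conv / (s k / B) powr \<beta>) * ennreal (L * s k powr \<beta>)"
      unfolding s_def by (intro mult_left_mono bound) simp
    also have "\<dots> = ennreal (K_conv / (s k / B) powr \<beta> * s k powr \<beta> * L)"
      using K_conv_nonneg L by (simp add: ennreal_mult[symmetric] mult_ac)
    finally have 2: "emeasure (\<Gamma> h) D \<le> ennreal (K_lsc * L)" unfolding powr_s .
    have "emeasure (\<Gamma> h) UNIV \<le> ennreal (K_conv / (s k / B) powr \<beta>) * ks_energy m p (s k) UNIV g"
      by (rule h(3)) auto
    also have "\<dots> \<le> ennreal (K_conv / (s k / B) powr \<beta>) * ennreal (K_upper * s k powr \<beta> * \<E> g)"
      by (intro mult_left_mono up) simp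
    also have "\<dots> = ennreal (K_conv / (s k / B) powr \<beta> * s k powr \<beta> * (K_upper * \<E> g))"
      using K_conv_nonneg up0 by (simp add: ennreal_mult[symmetric] mult_ac)
    finally have 3: "emeasure (\<Gamma> h) UNIV \<le> ennreal (K_lsc * (K_upper * \<E> g))" unfolding powr_s .
    show ?thesis using h(1) 1 2 3 by blast
  qed
  hence "\<exists>h. \<forall>k. ?P k (h k)" by (intro choice allI)
  then obtain h where h: "\<And>k. h k \<in> F"
    and hLp: "\<And>k. (\<integral>\<^sup>+x. ennreal (\<bar>h k x - g x\<bar> powr p) \<partial>m) \<le> ennreal (K_conv * (K_upper * s k powr \<beta> * \<E> g))"
    and hD: "\<And>k. emeasure (\<Gamma> (h k)) D \<le> ennreal (K_lsc * L)"
    and hU: "\<And>k. emeasure (\<Gamma> (h k)) UNIV \<le> ennreal (K_lsc * (K_upper * \<E> g))"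
    by blast
  define M where "M = (K_lsc * L) powr (1 / p)"
  define Q where "Q = {w \<in> F. G_norm D w \<le> M}"
  have GS: "seminorm_on F (G_norm D)" by (rule Gamma_seminorm[OF D])
  have KL: "0 \<le> K_lsc * L" using K_lsc_nonneg L by simp
  have KE: "0 \<le> K_lsc * (K_upper * \<E> g)" using K_lsc_nonneg K_upper_nonneg E_nonneg[OF gF] by simp
  have near: "\<exists>w\<in>Q. energy_norm m p \<E> (\<lambda>x. g x - w x) < e" if e: "0 < e" for e
  proof (rule bounded_energy_mazur[where v = h and K = "K_lsc * (K_upper * \<E> g)"])
    show "\<E> (h k) \<le> K_lsc * (K_upper * \<E> g)" for k
      using hU[of k] E_eq_Gamma[OF h] Gamma_emeasure[OF h] KE by simp
    have le: "Lp_norm m p (\<lambda>x. h k x - g x) \<le> (K_conv * (K_upper * s k powr \<beta> * \<E> g)) powr (1 / p)" for k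
    proof (rule Lp_norm_leI[OF p_pos])
      have "(\<lambda>x. h k x - g x) \<in> Lp_space m p" using F_closed(5)[OF h gF] F_Lp by blast
      hence "ennreal (Lp_norm m p (\<lambda>x. h k x - g x) powr p) \<le> ennreal (K_conv * (K_upper * s k powr \<beta> * \<E> g))"
        using hLp[of k] nn_integral_Lp[OF _ p_pos] by metis
      moreover have "0 \<le> K_conv * (K_upper * s k powr \<beta> * \<E> g)"
        using K_conv_nonneg K_upper_nonneg E_nonneg[OF gF] by simp
      ultimately show "(\<integral>x. \<bar>h k x - g x\<bar> powr p \<partial>m) \<le>
          ((K_conv * (K_upper * s k powr \<beta> * \<E> g)) powr (1 / p)) powr p"
        using p_pos by (simp add: Lp_norm_powr powr_powr)
    qed simp
    have "(\<lambda>k. (K_conv * (K_upper * s k powr \<beta> * \<E> g)) powr (1 / p)) \<longlonglongrightarrow>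
        (K_conv * (K_upper * 0 powr \<beta> * \<E> g)) powr (1 / p)"
    proof (rule tendsto_powr2)
      show "(\<lambda>k. K_conv * (K_upper * s k powr \<beta> * \<E> g)) \<longlonglongrightarrow> K_conv * (K_upper * 0 powr \<beta> * \<E> g)"
        using s0 s(1) beta_pos by (intro tendsto_intros tendsto_powr2 always_eventually) (auto simp: less_imp_le)
      show "eventually (\<lambda>k. 0 \<le> K_conv * (K_upper * s k powr \<beta> * \<E> g)) sequentially"
        using K_conv_nonneg K_upper_nonneg E_nonneg[OF gF] by simp
    qed (use p_pos in auto)
    hence lim: "(\<lambda>k. (K_conv * (K_upper * s k powr \<beta> * \<E> g)) powr (1 / p)) \<longlonglongrightarrow> 0" by simp
    show "(\<lambda>k. Lp_norm m p (\<lambda>x. h k x - g x)) \<longlonglongrightarrow> 0"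
      by (rule tendsto_sandwich[OF _ _ tendsto_const lim]) (use le in \<open>auto simp: Lp_norm_nonneg\<close>)
    show "convex_funs Q"
      using convex_funs_seminorm_ball[OF GS F_closed(1), of M] by (simp add: Q_def)
    have "G_norm D (h k) \<le> M" for k
      unfolding M_def using hD[of k] Gamma_emeasure[OF h] KL p_pos by (intro powr_mono2) auto
    thus "eventually (\<lambda>k. h k \<in> Q) sequentially" using h by (simp add: Q_def)
  qed (use h gF e in \<open>auto simp: Q_def\<close>)
  have "G_norm D g \<le> M"
  proof (rule field_le_epsilon)
    fix e :: real assume "0 < e"
    from near[OF this] obtain w where w: "w \<in> F" "G_norm D w \<le> M" "energy_norm m p \<E> (\<lambda>x. g x - w x) < e"
      by (auto simp: Q_def)
    have "G_norm D g \<le> G_norm D w + G_norm D (\<lambda>x. g x - w x)"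
      by (rule seminorm_on_triangle_diff[OF F_subspace GS gF w(1)])
    also have "G_norm D (\<lambda>x. g x - w x) \<le> E_norm (\<lambda>x. g x - w x)"
      by (rule G_norm_le_E_norm[OF F_closed(5)[OF gF w(1)] D])
    finally show "G_norm D g \<le> M + e" using w energy_norm_ge(2)[of "\<lambda>x. g x - w x"] by linarith
  qed
  hence "G_norm D g powr p \<le> M powr p" using p_pos by (intro powr_mono2) auto
  thus ?thesis using G_norm_powr[where D = D and u = g] KL p_pos by (simp add: M_def powr_powr)
qed

text \<open>One factor \<open>2 powr p\<close> is paid for passing from \<open>g\<close> to a
  continuous approximation inside \<open>ks_energy\<close>, the other for returning inside the
  energy measure.\<close>

definition K_low :: real where "K_low = 2 powr p * 2 powr p * K_lsc"

text \<open>A continuous \<open>v\<close> close to \<open>g\<close> changes \<open>ks_energy\<close>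
  at every scale by at most a small multiple of \<open>r powr \<beta>\<close>, so the bound for
  \<open>v\<close> is uniform in the scale and the error \<open>t\<close> can be removed at the end.
  A sequence of scales suffices, hence \<open>frequently\<close>.\<close>

lemma energy_le_ks_liminf:
  assumes g: "g \<in> F" and \<Omega>: "\<Omega> \<in> sets borel" and D: "D \<in> sets borel"
    and \<delta>: "0 < \<delta>" "\<And>x. x \<in> D \<Longrightarrow> ball x \<delta> \<subseteq> \<Omega>" and L: "0 \<le> L"
    and freq: "frequently (\<lambda>r. ks_energy m p r \<Omega> g \<le> ennreal (L * r powr \<beta>)) (at_right 0)"
  shows "measure (\<Gamma> g) D \<le> K_low * L"
proof -
  have "\<exists>r. 0 < r \<and> r < inverse (real (Suc n)) \<and> ks_energy m p r \<Omega> g \<le> ennreal (L * r powr \<beta>)" for n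
  proof -
    have "eventually (\<lambda>r. r \<in> {0<..<inverse (real (Suc n))}) (at_right 0)"
      by (rule eventually_at_right_real) simp
    from frequently_ex[OF frequently_eventually_conj[OF freq this]] show ?thesis by auto
  qed
  then obtain r where r: "\<And>n. 0 < r n" "\<And>n. r n < inverse (real (Suc n))"
    and kr: "\<And>n. ks_energy m p (r n) \<Omega> g \<le> ennreal (L * r n powr \<beta>)" by metis
  have r0: "r \<longlonglongrightarrow> 0"
    by (rule tendsto_sandwich[OF _ _ tendsto_const LIMSEQ_inverse_real_of_nat])
      (use r in \<open>auto intro!: always_eventually less_imp_le\<close>)
  define K' where "K' = 2 powr p * (2 powr p * K_lsc * K_upper + 1)"
  have K': "0 < K'" using K_lsc_nonneg K_upper_nonneg by (simp add: K'_def add_nonneg_pos)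
  have main: "measure (\<Gamma> g) D \<le> K_low * L + K' * t" if t: "0 < t" for t
  proof -
    define e where "e = t powr (1 / p)"
    have e: "0 < e" "e powr p = t" using t p_pos by (auto simp: e_def powr_powr)
    obtain v where v: "v \<in> F" "v \<in> Cc" "energy_norm m p \<E> (\<lambda>x. g x - v x) < e"
      using dense_F[OF g e(1)] by blast
    have gv: "(\<lambda>x. g x - v x) \<in> F" using F_closed(5)[OF g v(1)] .
    have en: "E_norm (\<lambda>x. g x - v x) \<le> e" using v(3) energy_norm_ge(2)[of "\<lambda>x. g x - v x"] by linarith
    hence "E_norm (\<lambda>x. g x - v x) powr p \<le> e powr p" using p_pos by (intro powr_mono2) auto
    hence Et: "\<E> (\<lambda>x. g x - v x) \<le> t" using E_norm_powr[OF gv] e by simp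
    have ks: "ks_energy m p (r k) \<Omega> v \<le> ennreal ((2 powr p * (L + K_upper * t)) * r k powr \<beta>)" for k
    proof -
      have "ks_energy m p (r k) \<Omega> (\<lambda>x. g x - (g x - v x)) \<le>
          ennreal (2 powr p) * (ks_energy m p (r k) \<Omega> g + ks_energy m p (r k) \<Omega> (\<lambda>x. g x - v x))"
        by (rule ks_energy_diff_le) (use F_measurable g gv \<Omega> p_pos in auto)
      also have "\<dots> \<le> ennreal (2 powr p) * (ennreal (L * r k powr \<beta>) + ennreal (K_upper * r k powr \<beta> * t))"
      proof (intro mult_left_mono add_mono kr)
        have "ks_energy m p (r k) \<Omega> (\<lambda>x. g x - v x) \<le> ennreal (K_upper * r k powr \<beta> * \<E> (\<lambda>x. g x - v x))"
          by (rule ks_energy_le_energy[OF gv r(1) \<Omega>])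
        also have "\<dots> \<le> ennreal (K_upper * r k powr \<beta> * t)"
          using Et K_upper_nonneg by (intro ennreal_leI mult_left_mono) auto
        finally show "ks_energy m p (r k) \<Omega> (\<lambda>x. g x - v x) \<le> ennreal (K_upper * r k powr \<beta> * t)" .
      qed simp
      also have "\<dots> = ennreal ((2 powr p * (L + K_upper * t)) * r k powr \<beta>)"
        using L K_upper_nonneg t
        by (simp add: ennreal_mult[symmetric] ennreal_plus[symmetric] algebra_simps del: ennreal_plus)
      finally show ?thesis by simp
    qed
    have "measure (\<Gamma> v) D \<le> K_lsc * (2 powr p * (L + K_upper * t))"
      by (rule energy_le_ks_liminf_Cc[OF _ \<Omega> D \<delta> _ r(1) r0 ks]) (use v L K_upper_nonneg t in auto)
    moreover have "measure (\<Gamma> g) D \<le> 2 powr p * (measure (\<Gamma> v) D + t)"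
    proof -
      have "G_norm D g \<le> G_norm D v + G_norm D (\<lambda>x. g x - v x)"
        by (rule seminorm_on_triangle_diff[OF F_subspace Gamma_seminorm[OF D] g v(1)])
      hence "G_norm D g \<le> G_norm D v + e" using G_norm_le_E_norm[OF gv D] en by linarith
      hence "G_norm D g powr p \<le> 2 powr p * (G_norm D v powr p + e powr p)"
        by (rule powr_le_powr_add) (use e p_pos in auto)
      thus ?thesis unfolding G_norm_powr e(2) .
    qed
    ultimately have "measure (\<Gamma> g) D \<le> 2 powr p * (K_lsc * (2 powr p * (L + K_upper * t)) + t)"
      by (smt (verit) mult_left_mono powr_ge_zero)
    thus ?thesis by (simp add: K_low_def K'_def algebra_simps)
  qed
  show ?thesis
  proof (rule field_le_epsilon)
    fix e :: real assume "0 < e"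
    thus "measure (\<Gamma> g) D \<le> K_low * L + e" using main[of "e / K'"] K' by simp
  qed
qed

text \<open>Stated with balls instead of the distance to the complement, which also makes sense when
  the complement is empty.\<close>

definition inner_set :: "'a set \<Rightarrow> nat \<Rightarrow> 'a set" where
  "inner_set U n = {x. ball x (inverse (real (Suc n))) \<subseteq> U}"

lemma inner_set_closed: "closed (inner_set U n)"
proof -
  have "- inner_set U n = (\<Union>y\<in>-U. ball y (inverse (real (Suc n))))"
    by (auto simp: inner_set_def dist_commute)
  thus ?thesis unfolding closed_def by (simp only:) auto
qed

lemma inner_set_borel [measurable]: "inner_set U n \<in> sets borel"
  by (rule borel_closed[OF inner_set_closed])

lemma inner_set_subset: "inner_set U n \<subseteq> U"
proof
  fix x assume "x \<in> inner_set U n"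
  moreover have "x \<in> ball x (inverse (real (Suc n)))" by simp
  ultimately show "x \<in> U" unfolding inner_set_def by blast
qed

lemma inner_set_incseq: "incseq (inner_set U)"
proof (rule incseq_SucI)
  fix n
  have "ball x (inverse (real (Suc (Suc n)))) \<subseteq> ball x (inverse (real (Suc n)))" for x :: 'a
    by (intro subset_ball) (simp add: field_simps)
  thus "inner_set U n \<subseteq> inner_set U (Suc n)" unfolding inner_set_def by blast
qed

lemma UN_inner_set:
  assumes "open U" shows "(\<Union>n. inner_set U n) = U"
proof
  show "U \<subseteq> (\<Union>n. inner_set U n)"
  proof
    fix x assume "x \<in> U"
    then obtain e where e: "0 < e" "ball x e \<subseteq> U" using assms openE by blast
    obtain n where "inverse (real (Suc n)) < e" using reals_Archimedean[OF e(1)] by blast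
    hence "ball x (inverse (real (Suc n))) \<subseteq> U" using e(2) subset_ball[of "inverse (real (Suc n))" e x] by force
    thus "x \<in> (\<Union>n. inner_set U n)" by (auto simp: inner_set_def)
  qed
qed (use inner_set_subset in blast)

text \<open>If the inequality failed at arbitrarily small scales, \<open>energy_le_ks_liminf\<close>
  would bound the energy on every inner set, hence on \<Omega> by monotone limits. The
  contrapositive gives a lower bound at all small scales, as a dyadic sum needs.\<close>

lemma ks_energy_eventually_gt:
  assumes g: "g \<in> F" and \<Omega>: "open \<Omega>" and L: "0 \<le> L" "K_low * L < measure (\<Gamma> g) \<Omega>"
  shows "eventually (\<lambda>r. ennreal (L * r powr \<beta>) < ks_energy m p r \<Omega> g) (at_right 0)"
proof (rule ccontr)
  assume "\<not> ?thesis"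
  hence freq: "frequently (\<lambda>r. ks_energy m p r \<Omega> g \<le> ennreal (L * r powr \<beta>)) (at_right 0)"
    by (simp add: frequently_def not_le)
  interpret finite_measure "\<Gamma> g" by (rule Gamma_finite[OF g])
  have sets: "sets (\<Gamma> g) = sets borel" by (rule Gamma_borel[OF g])
  have "(\<lambda>n. measure (\<Gamma> g) (inner_set \<Omega> n)) \<longlonglongrightarrow> measure (\<Gamma> g) (\<Union>n. inner_set \<Omega> n)"
    by (rule finite_Lim_measure_incseq) (use sets inner_set_incseq in auto)
  hence lim: "(\<lambda>n. measure (\<Gamma> g) (inner_set \<Omega> n)) \<longlonglongrightarrow> measure (\<Gamma> g) \<Omega>"
    unfolding UN_inner_set[OF \<Omega>] .
  have "measure (\<Gamma> g) (inner_set \<Omega> n) \<le> K_low * L" for n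
  proof (rule energy_le_ks_liminf[OF g _ inner_set_borel _ _ L(1) freq])
    show "ball x (inverse (real (Suc n))) \<subseteq> \<Omega>" if "x \<in> inner_set \<Omega> n" for x
      using that by (simp add: inner_set_def)
  qed (use \<Omega> in auto)
  hence "measure (\<Gamma> g) \<Omega> \<le> K_low * L" by (intro LIMSEQ_le_const2[OF lim]) auto
  thus False using L(2) by simp
qed

text \<open>Locality is assumed on \<open>F \<inter> Cc\<close> only; on all of \<open>F\<close> it follows from the previous bound.\<close>

lemma Gamma_zero_of_zero:
  assumes w: "w \<in> F" and U: "open U" and zero: "AE x in m. x \<in> U \<longrightarrow> w x = 0"
  shows "measure (\<Gamma> w) U = 0"
proof (rule ccontr)
  assume "measure (\<Gamma> w) U \<noteq> 0"
  hence "K_low * 0 < measure (\<Gamma> w) U" by (simp add: zero_less_measure_iff)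
  \<comment> \<open>For \<open>L = 0\<close> the lower bound just says that the energy at small
    scales is positive, while a function vanishing on \<open>U\<close> has none.\<close>
  from ks_energy_eventually_gt[OF w U order_refl this]
  have ev: "eventually (\<lambda>r. 0 < ks_energy m p r U w) (at_right 0)" by simp
  have "ks_energy m p r U w = ks_energy m p r U (\<lambda>x. 0)" for r
    by (rule ks_energy_cong) (use zero in auto)
  hence "ks_energy m p r U w = 0" for r
    using p_pos by (simp add: ks_energy_def)
  thus False using ev by (simp add: trivial_limit_at_right_real)
qed

text \<open>The difference has no energy on \<open>U\<close>, and the triangle inequality for the
  seminorm attached to \<open>A\<close> compares the two measures in both directions.\<close>

lemma Gamma_eq_of_eq:
  assumes uv: "u \<in> F" "v \<in> F" and U: "open U" and eq: "AE x in m. x \<in> U \<longrightarrow> u x = v x"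
    and A: "A \<in> sets borel" "A \<subseteq> U"
  shows "emeasure (\<Gamma> u) A = emeasure (\<Gamma> v) A"
proof -
  have le: "measure (\<Gamma> u) A \<le> measure (\<Gamma> v) A"
    if uv: "u \<in> F" "v \<in> F" and eq: "AE x in m. x \<in> U \<longrightarrow> u x = v x" for u v
  proof -
    have d: "(\<lambda>x. u x - v x) \<in> F" by (rule F_closed(5)[OF uv])
    interpret finite_measure "\<Gamma> (\<lambda>x. u x - v x)" by (rule Gamma_finite[OF d])
    have "measure (\<Gamma> (\<lambda>x. u x - v x)) A \<le> measure (\<Gamma> (\<lambda>x. u x - v x)) U"
      using A U Gamma_borel[OF d] by (intro finite_measure_mono) auto
    also have "\<dots> = 0" by (rule Gamma_zero_of_zero[OF d U]) (use eq in auto)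
    finally have "G_norm A (\<lambda>x. u x - v x) = 0" by (simp add: measure_le_0_iff)
    hence "G_norm A u \<le> G_norm A v"
      using seminorm_on_triangle_diff[OF F_subspace Gamma_seminorm[OF A(1)] uv] by simp
    hence "G_norm A u powr p \<le> G_norm A v powr p" by (rule powr_mono2[rotated 2]) (use p_pos in auto)
    thus ?thesis unfolding G_norm_powr .
  qed
  have "AE x in m. x \<in> U \<longrightarrow> v x = u x" using eq by eventually_elim auto
  from le[OF uv eq] le[OF uv(2,1) this] show ?thesis
    using Gamma_emeasure uv by simp
qed

text \<open>Closed bounded sets are compact here, so closed inner sets cut down by large balls are
  relatively compact in \<open>U\<close>; interiors make the members open.\<close>

lemma relcompact_exhaustion:
  fixes U :: "'a set"
  assumes U: "open U"
  obtains A where "incseq A" "(\<Union>n::nat. A n) = U" "\<forall>n. open (A n) \<and> relcompact_in (A n) U"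
proof -
  fix x0 :: 'a
  define A where "A n = interior (inner_set U n) \<inter> ball x0 (real n)" for n
  have rc: "relcompact_in (A n) U" for n
    unfolding relcompact_in_def
  proof
    show "compact (closure (A n))"
      by (rule bounded_closed_compact) (auto simp: A_def intro!: bounded_closure bounded_Int)
    have "closure (A n) \<subseteq> inner_set U n"
      unfolding A_def by (rule closure_minimal[OF _ inner_set_closed]) (use interior_subset in blast)
    thus "closure (A n) \<subseteq> U" using inner_set_subset by blast
  qed
  have op: "open (A n)" for n by (auto simp: A_def)
  have inc: "incseq A"
  proof (rule incseq_SucI)
    fix n
    have "inner_set U n \<subseteq> inner_set U (Suc n)" using inner_set_incseq by (rule incseq_SucD)
    hence "interior (inner_set U n) \<subseteq> interior (inner_set U (Suc n))" by (rule interior_mono)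
    moreover have "ball x0 (real n) \<subseteq> ball x0 (real (Suc n))" by (intro subset_ball) simp
    ultimately show "A n \<subseteq> A (Suc n)" unfolding A_def by blast
  qed
  have UN: "(\<Union>n. A n) = U"
  proof
    show "U \<subseteq> (\<Union>n. A n)"
    proof
      fix x assume "x \<in> U"
      then obtain e where e: "0 < e" "ball x e \<subseteq> U" using U openE by blast
      obtain n where n: "inverse (real (Suc n)) < e / 2" using reals_Archimedean[of "e / 2"] e by auto
      have sub: "ball x (e / 2) \<subseteq> inner_set U k" if "n \<le> k" for k
      proof
        fix y assume y: "y \<in> ball x (e / 2)"
        have "ball y (inverse (real (Suc n))) \<subseteq> ball x e"
        proof
          fix z assume "z \<in> ball y (inverse (real (Suc n)))"
          thus "z \<in> ball x e" using y n dist_triangle[of x z y] by simp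
        qed
        hence "y \<in> inner_set U n" using e(2) by (auto simp: inner_set_def)
        thus "y \<in> inner_set U k" using inner_set_incseq[of U] that unfolding incseq_def by blast
      qed
      obtain j :: nat where j: "dist x0 x < real j" using reals_Archimedean2 by blast
      have "x \<in> interior (inner_set U (max n j))"
        by (rule interiorI[OF open_ball _ sub]) (use e in auto)
      moreover have "x \<in> ball x0 (real (max n j))" using j by auto
      ultimately show "x \<in> (\<Union>n. A n)" unfolding A_def by blast
    qed
    show "(\<Union>n. A n) \<subseteq> U" unfolding A_def using inner_set_subset interior_subset by blast
  qed
  show ?thesis by (rule that[OF inc UN]) (simp add: op rc)
qed

text \<open>On each relatively compact open set the chosen representative agrees with
  \<open>g\<close> almost everywhere, so locality replaces it by \<open>g\<close>. What remains is a
  supremum along an exhaustion, that is, the restriction of the energy measure of \<open>g\<close>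
  to \<open>U\<close>.\<close>

lemma Gamma_loc_eq:
  assumes g: "g \<in> F" and U: "open U" and ug: "AE x in m. x \<in> U \<longrightarrow> u x = g x"
  shows "emeasure (Gamma_loc m F \<Gamma> U u) U = emeasure (\<Gamma> g) U"
proof -
  let ?R = "{A. open A \<and> relcompact_in A U}"
  have sets: "sets (\<Gamma> g) = sets borel" by (rule Gamma_borel[OF g])
  have sp: "space (\<Gamma> g) = UNIV" using sets_eq_imp_space_eq[OF sets] by simp
  obtain A where A: "incseq A" "(\<Union>n::nat. A n) = U" "\<forall>n. open (A n) \<and> relcompact_in (A n) U"
    by (rule relcompact_exhaustion[OF U]) blast
  have eq: "(SUP A\<in>?R. emeasure (\<Gamma> (local_rep m F A u)) (E \<inter> A)) = emeasure (\<Gamma> g) E"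
    if E: "E \<in> sets borel" "E \<subseteq> U" for E
  proof -
    have rep: "emeasure (\<Gamma> (local_rep m F B u)) (E \<inter> B) = emeasure (\<Gamma> g) (E \<inter> B)" if B: "B \<in> ?R" for B
    proof -
      have BU: "B \<subseteq> U" using B closure_subset by (auto simp: relcompact_in_def)
      have "\<exists>v. v \<in> F \<and> (AE x in m. x \<in> B \<longrightarrow> u x = v x)"
        by (rule exI[of _ g]) (use g ug BU in \<open>auto elim!: eventually_mono\<close>)
      hence v: "local_rep m F B u \<in> F" "AE x in m. x \<in> B \<longrightarrow> u x = local_rep m F B u x"
        unfolding local_rep_def by (rule someI2_ex, blast)+
      have "AE x in m. x \<in> B \<longrightarrow> local_rep m F B u x = g x"
        using v(2) ug by eventually_elim (use BU in auto)
      thus ?thesis using B E by (intro Gamma_eq_of_eq[OF v(1) g]) auto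
    qed
    have "(SUP A\<in>?R. emeasure (\<Gamma> (local_rep m F A u)) (E \<inter> A)) = (SUP A\<in>?R. emeasure (\<Gamma> g) (E \<inter> A))"
      using rep by (intro SUP_cong) auto
    also have "\<dots> = emeasure (\<Gamma> g) E"
    proof (rule antisym)
      show "(SUP A\<in>?R. emeasure (\<Gamma> g) (E \<inter> A)) \<le> emeasure (\<Gamma> g) E"
        using E sets by (intro SUP_least emeasure_mono) auto
      have "emeasure (\<Gamma> g) E = emeasure (\<Gamma> g) (\<Union>n. E \<inter> A n)" using A(2) E by (intro arg_cong2[where f=emeasure]) auto
      also have "\<dots> = (SUP n. emeasure (\<Gamma> g) (E \<inter> A n))"
      proof (rule SUP_emeasure_incseq[symmetric])
        show "range (\<lambda>n. E \<inter> A n) \<subseteq> sets (\<Gamma> g)" using E A(3) sets by auto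
        show "incseq (\<lambda>n. E \<inter> A n)" using A(1) unfolding incseq_def by blast
      qed
      also have "\<dots> \<le> (SUP A\<in>?R. emeasure (\<Gamma> g) (E \<inter> A))"
        using A(3) by (intro SUP_mono) auto
      finally show "emeasure (\<Gamma> g) E \<le> (SUP A\<in>?R. emeasure (\<Gamma> g) (E \<inter> A))" .
    qed
    finally show ?thesis .
  qed
  have mem: "E \<in> sets (restrict_space borel U) \<longleftrightarrow> E \<in> sets borel \<and> E \<subseteq> U" for E :: "'a set"
    using U by (subst sets_restrict_space_iff) auto
  let ?N = "restrict_space (\<Gamma> g) U"
  have setsN: "sets ?N = sets (restrict_space borel U)"
    by (rule sets_restrict_space_cong[OF sets])
  \<comment> \<open>\<open>measure_of\<close> keeps the values of a set function only if they form a
    measure, which is ensured by identifying them with those of \<open>?N\<close>.\<close>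
  have "Gamma_loc m F \<Gamma> U u = measure_of U (sets ?N) (emeasure ?N)"
    unfolding Gamma_loc_def setsN[symmetric]
  proof (rule measure_of_eq)
    show "sets ?N \<subseteq> Pow U" using mem setsN by auto
    fix E assume "E \<in> sigma_sets U (sets ?N)"
    hence "E \<in> sets ?N" using sets.sigma_sets_eq[of ?N] by (simp add: space_restrict_space sp)
    hence E: "E \<in> sets borel" "E \<subseteq> U" using mem setsN by auto
    show "(SUP A\<in>?R. emeasure (\<Gamma> (local_rep m F A u)) (E \<inter> A)) = emeasure ?N E"
      using eq[OF E] E U sets by (subst emeasure_restrict_space) (auto simp: sp)
  qed
  also have "\<dots> = ?N" using measure_of_of_measure[of ?N] by (simp add: space_restrict_space sp)
  finally show ?thesis using U sets by (simp add: emeasure_restrict_space sp)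
qed

end

section \<open>Dyadic decomposition of the nonlocal energy\<close>

text \<open>A geometric series of ratio \<open>2 powr (- t)\<close> has sum comparable to
  \<open>1 / t\<close>; with \<open>t = p * (\<theta>\<^sub>p - \<theta>)\<close> this is what the
  normalising factor compensates. The lower bound is the weighted inequality of arithmetic and
  geometric means.\<close>

lemma one_minus_powr_bounds:
  fixes t :: real
  assumes "0 < t" "t \<le> 1"
  shows "t / 2 \<le> 1 - 2 powr (- t)" "1 - 2 powr (- t) \<le> t"
proof -
  have "(1 / 2) powr t * 1 powr (1 - t) \<le> t * (1 / 2) + (1 - t) * (1::real)"
    by (rule Youngs_inequality_0) (use assms in auto)
  thus "t / 2 \<le> 1 - 2 powr (- t)" by (simp add: powr_minus powr_divide field_simps)
  have "1 + (- t * ln 2) \<le> exp (- t * ln 2)" by (rule exp_ge_add_one_self)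
  moreover have "t * ln 2 \<le> t * 1" using assms ln_2_less_1 by (intro mult_left_mono) auto
  ultimately show "1 - 2 powr (- t) \<le> t" by (simp add: powr_def)
qed

lemma dyadic_powr_sums:
  fixes \<delta> t :: real
  assumes "0 < \<delta>" "0 < t"
  shows "(\<Sum>k. ennreal ((\<delta> / 2 ^ k) powr t)) = ennreal (\<delta> powr t / (1 - 2 powr (- t)))"
proof (rule suminf_ennreal_eq)
  have "(\<lambda>k. \<delta> powr t * (2 powr (- t)) ^ k) sums (\<delta> powr t * (1 / (1 - 2 powr (- t))))"
  proof (intro sums_mult geometric_sums)
    have "2 powr (- t) < 2 powr 0" by (rule powr_less_mono) (use assms in auto)
    thus "norm (2 powr (- t)) < 1" by simp
  qed
  moreover have "(\<delta> / 2 ^ k) powr t = \<delta> powr t * (2 powr (- t)) ^ k" for k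
    using assms by (simp add: powr_divide powr_minus powr_power powr_realpow[symmetric] powr_powr field_simps)
  ultimately show "(\<lambda>k. (\<delta> / 2 ^ k) powr t) sums (\<delta> powr t / (1 - 2 powr (- t)))" by simp
qed simp

text \<open>Scales up to \<delta> and beyond \<delta> are kept apart because their sums are
  estimated by different means. The index \<open>Suc k\<close> makes the second family start exactly
  at distance \<delta>.\<close>

lemma dyadic_scale:
  fixes d \<delta> :: real
  assumes "0 < d" "0 < \<delta>"
  obtains k where "\<delta> / 2 ^ k / 2 \<le> d" "d < \<delta> / 2 ^ k" | k where "\<delta> * 2 ^ Suc k / 2 \<le> d" "d < \<delta> * 2 ^ Suc k"
proof (cases "d < \<delta>")
  case True
  have "\<exists>k. \<delta> / 2 ^ Suc k \<le> d"
  proof -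
    obtain k :: nat where "\<delta> / d < real k" using reals_Archimedean2 by blast
    also have "real k < 2 ^ k" by (rule of_nat_less_two_power)
    also have "(2::real) ^ k \<le> 2 ^ Suc k" by simp
    finally show ?thesis using assms by (intro exI[of _ k]) (simp add: field_simps)
  qed
  define k where "k = (LEAST k. \<delta> / 2 ^ Suc k \<le> d)"
  have 1: "\<delta> / 2 ^ Suc k \<le> d" unfolding k_def by (rule LeastI_ex) fact
  have 2: "d < \<delta> / 2 ^ k"
  proof (cases k)
    case (Suc j)
    hence "\<not> \<delta> / 2 ^ Suc j \<le> d" using not_less_Least[of j "\<lambda>k. \<delta> / 2 ^ Suc k \<le> d"] by (simp add: k_def)
    thus ?thesis using Suc by simp
  qed (use True in simp)
  show ?thesis by (rule that(1)[of k]) (use 1 2 in \<open>auto simp: mult.commute\<close>)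
next
  case False
  have "\<exists>k. d < \<delta> * 2 ^ Suc k"
  proof -
    obtain k :: nat where "d / \<delta> < real k" using reals_Archimedean2 by blast
    also have "real k < 2 ^ k" by (rule of_nat_less_two_power)
    also have "(2::real) ^ k \<le> 2 ^ Suc k" by simp
    finally show ?thesis using assms by (intro exI[of _ k]) (simp add: field_simps)
  qed
  define k where "k = (LEAST k. d < \<delta> * 2 ^ Suc k)"
  have 1: "d < \<delta> * 2 ^ Suc k" unfolding k_def by (rule LeastI_ex) fact
  have 2: "\<delta> * 2 ^ k \<le> d"
  proof (cases k)
    case (Suc j)
    hence "\<not> d < \<delta> * 2 ^ Suc j" using not_less_Least[of j "\<lambda>k. d < \<delta> * 2 ^ Suc k"] by (simp add: k_def)
    thus ?thesis using Suc by simp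
  qed (use False in simp)
  show ?thesis by (rule that(2)[of k]) (use 1 2 in auto)
qed

text \<open>The terms grow by the factor \<open>2 powr s \<ge> 2\<close>, so the sum is at most
  twice its last nonzero term, which belongs to a scale still larger than \<open>d\<close>.\<close>

lemma dyadic_partial_sum_le:
  fixes d \<delta> s :: real
  assumes d: "0 < d" and \<delta>: "0 < \<delta>" and s: "1 \<le> s"
  shows "(\<Sum>k<n. if d < \<delta> / 2 ^ k then (\<delta> / 2 ^ k) powr (- s) else 0) \<le> 2 * d powr (- s)"
proof (induction n)
  case (Suc n)
  show ?case
  proof (cases "d < \<delta> / 2 ^ n")
    case True
    define q where "q = 2 powr s"
    have q: "2 \<le> q" using powr_mono[of 1 s 2] s by (simp add: q_def)
    have eq: "(\<delta> / 2 ^ k) powr (- s) = \<delta> powr (- s) * q ^ k" for k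
      using \<delta> by (simp add: q_def powr_divide powr_minus powr_power powr_realpow[symmetric] powr_powr field_simps)
    have geo: "(\<Sum>k<Suc n. q ^ k) \<le> 2 * q ^ n" for n
    proof (induction n)
      case (Suc n)
      have "2 * q ^ n \<le> q * q ^ n" using q by (intro mult_right_mono) auto
      thus ?case using Suc by simp
    qed simp
    have "(\<Sum>k<Suc n. if d < \<delta> / 2 ^ k then (\<delta> / 2 ^ k) powr (- s) else 0) \<le> (\<Sum>k<Suc n. \<delta> powr (- s) * q ^ k)"
      using q by (intro sum_mono) (auto simp: eq)
    also have "\<dots> = \<delta> powr (- s) * (\<Sum>k<Suc n. q ^ k)" by (simp only: sum_distrib_left)
    also have "\<dots> \<le> \<delta> powr (- s) * (2 * q ^ n)" by (intro mult_left_mono geo) simp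
    also have "\<dots> = 2 * (\<delta> / 2 ^ n) powr (- s)" by (simp add: eq)
    also have "\<dots> \<le> 2 * d powr (- s)"
      using True d s by (intro mult_left_mono powr_mono2') auto
    finally show ?thesis .
  next
    case False
    thus ?thesis using Suc by simp
  qed
qed simp

lemma (in doubling_space) nonlocal_energy_cong:
  assumes "AE x in m. x \<in> \<Omega> \<longrightarrow> f x = g x"
  shows "nonlocal_energy m p \<theta> \<Omega> f = nonlocal_energy m p \<theta> \<Omega> g"
  unfolding nonlocal_energy_def
proof (rule nn_integral_cong_AE, use assms in eventually_elim)
  case (elim y)
  let ?k = "\<lambda>x. ennreal (dist x y powr (p * \<theta>)) * emeasure m (ball y (dist x y))"
  have "(\<integral>\<^sup>+x\<in>\<Omega> - {y}. ennreal (\<bar>f x - f y\<bar> powr p) / ?k x \<partial>m) =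
      (\<integral>\<^sup>+x\<in>\<Omega> - {y}. ennreal (\<bar>g x - g y\<bar> powr p) / ?k x \<partial>m)" if "y \<in> \<Omega>"
    by (rule nn_integral_cong_AE, use assms in eventually_elim) (use elim that in \<open>auto simp: indicator_def\<close>)
  thus ?case by (auto simp: indicator_def)
qed

section \<open>Comparison of the nonlocal energy with dyadic sums\<close>

context energy_poincare
begin

lemma nn_integral_suminf_ks_inner:
  assumes [measurable]: "g \<in> borel_measurable borel" "\<Omega> \<in> sets borel"
  shows "(\<integral>\<^sup>+x. (\<Sum>k. a k * (ennreal (\<bar>g x - g y\<bar> powr p) * indicator (\<Omega> \<inter> ball y (R k)) x / emeasure m (ball y (R k)))) \<partial>m)
    = (\<Sum>k. a k * ks_inner (R k) \<Omega> g y)"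
proof -
  have "(\<integral>\<^sup>+x. a k * (ennreal (\<bar>g x - g y\<bar> powr p) * indicator (\<Omega> \<inter> ball y (R k)) x / emeasure m (ball y (R k))) \<partial>m)
      = a k * ks_inner (R k) \<Omega> g y" for k
  proof -
    have [measurable]: "(\<lambda>x. ennreal (\<bar>g x - g y\<bar> powr p) * indicator (\<Omega> \<inter> ball y (R k)) x) \<in> borel_measurable m"
      by measurable
    show ?thesis by (subst nn_integral_cmult) (auto simp: nn_integral_divide)
  qed
  thus ?thesis by (subst nn_integral_suminf) auto
qed

lemma nn_integral_suminf_ks_energy:
  assumes [measurable]: "g \<in> borel_measurable borel" "\<Omega> \<in> sets borel"
  shows "(\<integral>\<^sup>+y\<in>\<Omega>. (\<Sum>k. a k * ks_inner (R k) \<Omega> g y) \<partial>m) = (\<Sum>k. a k * ks_energy m p (R k) \<Omega> g)"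
proof -
  have "(\<integral>\<^sup>+y\<in>\<Omega>. (\<Sum>k. a k * ks_inner (R k) \<Omega> g y) \<partial>m) =
      (\<integral>\<^sup>+y. (\<Sum>k. a k * (ks_inner (R k) \<Omega> g y * indicator \<Omega> y)) \<partial>m)"
    by (simp add: ennreal_suminf_multc[symmetric] mult.assoc)
  also have "\<dots> = (\<Sum>k. a k * ks_energy m p (R k) \<Omega> g)"
    unfolding ks_energy_def by (subst nn_integral_suminf) (auto simp: nn_integral_cmult)
  finally show ?thesis .
qed

text \<open>On a dyadic annulus the kernel is comparable to its value at the outer radius: one
  doubling for the ball, and \<open>2 powr s \<le> 2 powr \<beta>\<close> for the power, which makes
  the constant independent of \<theta>.\<close>

lemma kernel_le:
  assumes R: "R / 2 \<le> dist x y" "dist x y < R" "x \<noteq> y" and s: "0 < s" "s \<le> \<beta>"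
  shows "1 / (ennreal (dist x y powr s) * emeasure m (ball y (dist x y))) \<le>
    ennreal (2 powr \<beta> * c * R powr (- s)) * (1 / emeasure m (ball y R))"
proof -
  let ?d = "dist x y"
  have d: "0 < ?d" using R by simp
  have R0: "0 < R" using R d by linarith
  have v: "0 < vol y ?d" "0 < vol y R" using vol_pos d R0 by auto
  have "vol y R \<le> c ^ 1 * vol y ?d" by (rule vol_le[OF d]) (use R in auto)
  hence 1: "1 / vol y ?d \<le> c * (1 / vol y R)" using v by (simp add: field_simps)
  have "?d powr (- s) \<le> (R / 2) powr (- s)" using R R0 s by (intro powr_mono2') auto
  also have "\<dots> = 2 powr s * R powr (- s)"
    using R0 by (simp add: powr_divide powr_minus field_simps)
  also have "\<dots> \<le> 2 powr \<beta> * R powr (- s)" using s by (intro mult_right_mono powr_mono) auto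
  finally have 2: "?d powr (- s) \<le> 2 powr \<beta> * R powr (- s)" .
  have "1 / (ennreal (?d powr s) * emeasure m (ball y ?d)) = ennreal (?d powr (- s) * (1 / vol y ?d))"
    using d v unfolding emeasure_ball
    by (subst ennreal_mult[symmetric]) (auto simp: ennreal_1[symmetric] divide_ennreal powr_minus field_simps simp del: ennreal_1)
  also have "\<dots> \<le> ennreal ((2 powr \<beta> * R powr (- s)) * (c * (1 / vol y R)))"
    by (intro ennreal_leI mult_mono 1 2) (use v in auto)
  also have "\<dots> = ennreal (2 powr \<beta> * c * R powr (- s)) * (1 / emeasure m (ball y R))"
    using v c unfolding emeasure_ball divide_ennreal_eq_mult[OF v(2)]
    by (simp add: ennreal_mult[symmetric] mult_ac)
  finally show ?thesis .
qed

text \<open>Each pair of distinct points lies in an annulus of one of the two families. Enlarging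
  annuli to full balls turns the terms into \<open>ks_energy\<close> and only increases the
  sum.\<close>

lemma nonlocal_energy_le_dyadic:
  assumes [measurable]: "g \<in> borel_measurable borel" "\<Omega> \<in> sets borel"
    and s: "0 < p * \<theta>" "p * \<theta> \<le> \<beta>" and \<delta>: "0 < \<delta>"
  defines "a \<equiv> \<lambda>R. ennreal (2 powr \<beta> * c * R powr (- (p * \<theta>)))"
  shows "nonlocal_energy m p \<theta> \<Omega> g \<le>
    (\<Sum>k. a (\<delta> / 2 ^ k) * ks_energy m p (\<delta> / 2 ^ k) \<Omega> g) +
    (\<Sum>k. a (\<delta> * 2 ^ Suc k) * ks_energy m p (\<delta> * 2 ^ Suc k) \<Omega> g)"
proof -
  define T where "T R y x = a R * (ennreal (\<bar>g x - g y\<bar> powr p) * indicator (\<Omega> \<inter> ball y R) x / emeasure m (ball y R))" for R y x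
  have [measurable]: "T R y \<in> borel_measurable m" for R y
    unfolding T_def by measurable
  have le_suminf: "f j \<le> (\<Sum>k. f k)" for f :: "nat \<Rightarrow> ennreal" and j
    using sum_le_suminf[of f "{j}"] by simp
  have T_ge: "ennreal (\<bar>g x - g y\<bar> powr p) / (ennreal (dist x y powr (p * \<theta>)) * emeasure m (ball y (dist x y))) \<le> T R y x"
    if "x \<noteq> y" "x \<in> \<Omega>" "R / 2 \<le> dist x y" "dist x y < R" for R x y
  proof -
    have "ennreal (\<bar>g x - g y\<bar> powr p) * (1 / (ennreal (dist x y powr (p * \<theta>)) * emeasure m (ball y (dist x y)))) \<le>
        ennreal (\<bar>g x - g y\<bar> powr p) * (a R * (1 / emeasure m (ball y R)))"
      unfolding a_def by (intro mult_left_mono kernel_le s that) auto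
    thus ?thesis using that by (simp add: T_def ennreal_times_divide dist_commute mult_ac divide_ennreal_def)
  qed
  have "nonlocal_energy m p \<theta> \<Omega> g \<le>
      (\<integral>\<^sup>+y\<in>\<Omega>. (\<integral>\<^sup>+x. (\<Sum>k. T (\<delta> / 2 ^ k) y x) + (\<Sum>k. T (\<delta> * 2 ^ Suc k) y x) \<partial>m) \<partial>m)"
    unfolding nonlocal_energy_def
  proof (rule nn_integral_mono, rule mult_right_mono, rule nn_integral_mono)
    fix y x
    show "ennreal (\<bar>g x - g y\<bar> powr p) / (ennreal (dist x y powr (p * \<theta>)) * emeasure m (ball y (dist x y))) *
        indicator (\<Omega> - {y}) x \<le> (\<Sum>k. T (\<delta> / 2 ^ k) y x) + (\<Sum>k. T (\<delta> * 2 ^ Suc k) y x)"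
    proof (cases "x \<in> \<Omega> - {y}")
      case True
      hence xy: "x \<noteq> y" "x \<in> \<Omega>" by auto
      have "0 < dist x y" using xy by simp
      from this \<delta> show ?thesis
      proof (rule dyadic_scale)
        fix k assume "\<delta> / 2 ^ k / 2 \<le> dist x y" "dist x y < \<delta> / 2 ^ k"
        from order_trans[OF T_ge[OF xy this] le_suminf[of "\<lambda>k. T (\<delta> / 2 ^ k) y x" k]]
        show ?thesis using True by (simp add: add_increasing2)
      next
        fix k assume "\<delta> * 2 ^ Suc k / 2 \<le> dist x y" "dist x y < \<delta> * 2 ^ Suc k"
        from order_trans[OF T_ge[OF xy this] le_suminf[of "\<lambda>k. T (\<delta> * 2 ^ Suc k) y x" k]]
        show ?thesis using True by (simp add: add_increasing)
      qed
    qed simp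
  qed simp
  also have "\<dots> = (\<integral>\<^sup>+y\<in>\<Omega>. (\<Sum>k. a (\<delta> / 2 ^ k) * ks_inner (\<delta> / 2 ^ k) \<Omega> g y)
      + (\<Sum>k. a (\<delta> * 2 ^ Suc k) * ks_inner (\<delta> * 2 ^ Suc k) \<Omega> g y) \<partial>m)"
  proof (intro nn_integral_cong arg_cong2[where f = "(*)"] refl)
    fix y
    have "(\<integral>\<^sup>+x. (\<Sum>k. T (\<delta> / 2 ^ k) y x) + (\<Sum>k. T (\<delta> * 2 ^ Suc k) y x) \<partial>m) =
        (\<integral>\<^sup>+x. (\<Sum>k. T (\<delta> / 2 ^ k) y x) \<partial>m) + (\<integral>\<^sup>+x. (\<Sum>k. T (\<delta> * 2 ^ Suc k) y x) \<partial>m)"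
      by (rule nn_integral_add) measurable
    thus "(\<integral>\<^sup>+x. (\<Sum>k. T (\<delta> / 2 ^ k) y x) + (\<Sum>k. T (\<delta> * 2 ^ Suc k) y x) \<partial>m) =
        (\<Sum>k. a (\<delta> / 2 ^ k) * ks_inner (\<delta> / 2 ^ k) \<Omega> g y)
      + (\<Sum>k. a (\<delta> * 2 ^ Suc k) * ks_inner (\<delta> * 2 ^ Suc k) \<Omega> g y)"
      unfolding T_def using nn_integral_suminf_ks_inner[OF assms(1,2)] by simp
  qed
  also have "\<dots> = (\<integral>\<^sup>+y\<in>\<Omega>. (\<Sum>k. a (\<delta> / 2 ^ k) * ks_inner (\<delta> / 2 ^ k) \<Omega> g y) \<partial>m)
      + (\<integral>\<^sup>+y\<in>\<Omega>. (\<Sum>k. a (\<delta> * 2 ^ Suc k) * ks_inner (\<delta> * 2 ^ Suc k) \<Omega> g y) \<partial>m)"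
    unfolding distrib_right by (rule nn_integral_add) measurable
  also have "\<dots> = (\<Sum>k. a (\<delta> / 2 ^ k) * ks_energy m p (\<delta> / 2 ^ k) \<Omega> g) +
    (\<Sum>k. a (\<delta> * 2 ^ Suc k) * ks_energy m p (\<delta> * 2 ^ Suc k) \<Omega> g)"
    using nn_integral_suminf_ks_energy[OF assms(1,2)] by simp
  finally show ?thesis .
qed

text \<open>A pair at distance \<open>d\<close> is counted at every scale above \<open>d\<close>.
  The multiplicity is harmless: the weights sum to at most
  \<open>2 * d powr (- (p * \<theta>))\<close>, and larger balls have larger volume.\<close>

lemma nonlocal_energy_ge_dyadic:
  assumes [measurable]: "g \<in> borel_measurable borel" "\<Omega> \<in> sets borel"
    and s: "1 \<le> p * \<theta>" and \<delta>: "0 < \<delta>"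
  shows "(\<Sum>k. ennreal ((\<delta> / 2 ^ k) powr (- (p * \<theta>))) * ks_energy m p (\<delta> / 2 ^ k) \<Omega> g)
    \<le> 2 * nonlocal_energy m p \<theta> \<Omega> g"
proof -
  let ?s = "p * \<theta>"
  define f where "f y x = ennreal (\<bar>g x - g y\<bar> powr p) / (ennreal (dist x y powr ?s) * emeasure m (ball y (dist x y))) *
      indicator (\<Omega> - {y}) x" for y x
  have kernel: "(\<Sum>k. ennreal ((\<delta> / 2 ^ k) powr (- ?s)) *
      (ennreal (\<bar>g x - g y\<bar> powr p) * indicator (\<Omega> \<inter> ball y (\<delta> / 2 ^ k)) x / emeasure m (ball y (\<delta> / 2 ^ k)))) \<le> 2 * f y x"
    for x y
  proof (cases "x \<in> \<Omega> \<and> x \<noteq> y")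
    case False
    thus ?thesis using p_pos by (cases "x = y") auto
  next
    case True
    let ?d = "dist x y"
    have d: "0 < ?d" using True by simp
    have v: "0 < vol y ?d" by (rule vol_pos[OF d])
    let ?G = "\<bar>g x - g y\<bar> powr p"
    have "(\<Sum>k<n. ennreal ((\<delta> / 2 ^ k) powr (- ?s)) *
      (ennreal ?G * indicator (\<Omega> \<inter> ball y (\<delta> / 2 ^ k)) x / emeasure m (ball y (\<delta> / 2 ^ k)))) \<le> 2 * f y x" for n
    proof -
      have "(\<Sum>k<n. ennreal ((\<delta> / 2 ^ k) powr (- ?s)) *
          (ennreal ?G * indicator (\<Omega> \<inter> ball y (\<delta> / 2 ^ k)) x / emeasure m (ball y (\<delta> / 2 ^ k)))) \<le>
          (\<Sum>k<n. ennreal ((if ?d < \<delta> / 2 ^ k then (\<delta> / 2 ^ k) powr (- ?s) else 0) * (?G / vol y ?d)))"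
      proof (rule sum_mono)
        fix k
        let ?R = "\<delta> / 2 ^ k"
        show "ennreal (?R powr (- ?s)) * (ennreal ?G * indicator (\<Omega> \<inter> ball y ?R) x / emeasure m (ball y ?R)) \<le>
            ennreal ((if ?d < ?R then ?R powr (- ?s) else 0) * (?G / vol y ?d))"
        proof (cases "?d < ?R")
          case R: True
          have "vol y ?d \<le> vol y ?R" using R by (intro vol_mono subset_ball) simp
          hence "?G / vol y ?R \<le> ?G / vol y ?d" using v by (intro divide_left_mono) auto
          hence "?R powr (- ?s) * (?G / vol y ?R) \<le> ?R powr (- ?s) * (?G / vol y ?d)"
            by (rule mult_left_mono) simp
          moreover have "0 < vol y ?R" using \<delta> by (intro vol_pos) simp
          ultimately show ?thesis using R True v
            by (simp add: emeasure_ball divide_ennreal ennreal_mult[symmetric] dist_commute ennreal_leI mult_left_mono)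
        next
          case False
          thus ?thesis by (simp add: dist_commute)
        qed
      qed
      also have "\<dots> = ennreal ((\<Sum>k<n. if ?d < \<delta> / 2 ^ k then (\<delta> / 2 ^ k) powr (- ?s) else 0) * (?G / vol y ?d))"
        using v by (subst sum_ennreal) (simp_all only: sum_distrib_right, simp)
      also have "\<dots> \<le> ennreal (2 * ?d powr (- ?s) * (?G / vol y ?d))"
        using v by (intro ennreal_leI mult_right_mono dyadic_partial_sum_le[OF d \<delta> s]) auto
      also have "\<dots> = ennreal (2 * (?G / (?d powr ?s * vol y ?d)))"
        by (simp add: powr_minus divide_inverse mult_ac)
      also have "\<dots> = 2 * f y x"
      proof -
        have "f y x = ennreal (?G / (?d powr ?s * vol y ?d))"
          using True d v by (simp add: f_def emeasure_ball ennreal_mult[symmetric] divide_ennreal)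
        moreover have "ennreal (2 * (?G / (?d powr ?s * vol y ?d))) = ennreal 2 * ennreal (?G / (?d powr ?s * vol y ?d))"
          using v by (intro ennreal_mult) auto
        ultimately show ?thesis by simp
      qed
      finally show ?thesis .
    qed
    thus ?thesis by (intro suminf_le_const summableI)
  qed
  have "(\<Sum>k. ennreal ((\<delta> / 2 ^ k) powr (- ?s)) * ks_energy m p (\<delta> / 2 ^ k) \<Omega> g) =
      (\<integral>\<^sup>+y\<in>\<Omega>. (\<integral>\<^sup>+x. (\<Sum>k. ennreal ((\<delta> / 2 ^ k) powr (- ?s)) *
      (ennreal (\<bar>g x - g y\<bar> powr p) * indicator (\<Omega> \<inter> ball y (\<delta> / 2 ^ k)) x / emeasure m (ball y (\<delta> / 2 ^ k)))) \<partial>m) \<partial>m)"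
    unfolding nn_integral_suminf_ks_inner[OF assms(1,2)] nn_integral_suminf_ks_energy[OF assms(1,2)] ..
  also have "\<dots> \<le> (\<integral>\<^sup>+y\<in>\<Omega>. (\<integral>\<^sup>+x. 2 * f y x \<partial>m) \<partial>m)"
    by (rule nn_integral_mono, rule mult_right_mono, rule nn_integral_mono, rule kernel) simp
  also have "\<dots> = 2 * nonlocal_energy m p \<theta> \<Omega> g"
  proof -
    have m1: "(\<lambda>z. emeasure m (ball (fst z) (dist (snd z) (fst z)))) \<in> borel_measurable (borel \<Otimes>\<^sub>M (borel :: 'a measure))"
      by (rule borel_measurable_emeasure_ball_dist)
    have "{z :: 'a \<times> 'a. snd z \<noteq> fst z} \<in> sets (borel \<Otimes>\<^sub>M borel)"
      unfolding borel_prod by (intro borel_open open_Collect_neq continuous_intros)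
    hence m2: "(indicator {z :: 'a \<times> 'a. snd z \<noteq> fst z} :: _ \<Rightarrow> ennreal) \<in> borel_measurable (borel \<Otimes>\<^sub>M borel)"
      by (rule borel_measurable_indicator)
    have "(\<lambda>z. ennreal (\<bar>g (snd z) - g (fst z)\<bar> powr p) / (ennreal (dist (snd z) (fst z) powr ?s) *
        emeasure m (ball (fst z) (dist (snd z) (fst z)))) * (indicator \<Omega> (snd z) * indicator {z. snd z \<noteq> fst z} z))
        \<in> borel_measurable (borel \<Otimes>\<^sub>M (borel :: 'a measure))"
      using m1 m2 by measurable
    moreover have "indicator \<Omega> (snd z) * indicator {z. snd z \<noteq> fst z} z = (indicator (\<Omega> - {fst z}) (snd z) :: ennreal)"
      for z :: "'a \<times> 'a" by (auto simp: indicator_def)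
    ultimately have fm: "(\<lambda>z. f (fst z) (snd z)) \<in> borel_measurable (borel \<Otimes>\<^sub>M (borel :: 'a measure))"
      by (simp add: f_def)
    have [measurable]: "f y \<in> borel_measurable borel" for y
      using measurable_Pair2[OF fm, of y] by simp
    have [measurable]: "(\<lambda>y. \<integral>\<^sup>+x. f y x \<partial>m) \<in> borel_measurable borel"
      by (rule borel_measurable_nn_integral) (use fm in \<open>simp add: case_prod_beta'\<close>)
    have "(\<integral>\<^sup>+y\<in>\<Omega>. (\<integral>\<^sup>+x. 2 * f y x \<partial>m) \<partial>m) = (\<integral>\<^sup>+y. 2 * ((\<integral>\<^sup>+x. f y x \<partial>m) * indicator \<Omega> y) \<partial>m)"
      by (simp add: nn_integral_cmult mult.assoc)
    also have "\<dots> = 2 * (\<integral>\<^sup>+y\<in>\<Omega>. (\<integral>\<^sup>+x. f y x \<partial>m) \<partial>m)"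
      by (rule nn_integral_cmult) measurable
    finally show ?thesis by (simp add: nonlocal_energy_def f_def)
  qed
  finally show ?thesis .
qed

end

section \<open>The limit of the nonlocal energies\<close>

context energy_poincare
begin

text \<open>The factor \<open>2\<close> bounds
  \<open>(\<theta>\<^sub>p - \<theta>) / (1 - 2 powr (- t))\<close>, which is at most
  \<open>2 / p\<close>.\<close>

definition K_limsup :: real where "K_limsup = 2 * (2 powr \<beta> * c * K_upper)"
text \<open>Bounds the sum over all scales beyond \<delta>. It depends on \<open>g\<close> and
  \<delta>, but not on \<theta>, and is finally multiplied by
  \<open>\<theta>\<^sub>p - \<theta>\<close>.\<close>

definition K_far :: "real \<Rightarrow> ('a \<Rightarrow> real) \<Rightarrow> real" where
  "K_far \<delta> g = 2 powr \<beta> * c * (c * 2 powr p * (1 + c) * overlap 2) * Lp_norm m p g powr p * \<delta> powr (- \<beta>)"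

lemma K_limsup_nonneg: "0 \<le> K_limsup"
  using K_upper_nonneg c by (simp add: K_limsup_def)

text \<open>Scales up to \<delta> are treated by the Poincare inequality, whose balls stay in the
  neighbourhood \<open>D\<close>, and larger scales by the \<open>L^p\<close> norm of
  \<open>g\<close>.\<close>

lemma nonlocal_energy_upper:
  assumes g: "g \<in> F" and \<Omega>: "open \<Omega>" and \<beta>: "\<beta> = p * \<theta>\<^sub>p" and \<delta>: "0 < \<delta>" "\<delta> \<le> 1"
    and \<theta>: "1 \<le> p * \<theta>" "\<theta> < \<theta>\<^sub>p" "p * (\<theta>\<^sub>p - \<theta>) \<le> 1"
    and D: "D \<in> sets borel" "(\<Union>y\<in>\<Omega>. ball y ((2 * A\<^sub>P + 1) * \<delta>)) \<subseteq> D"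
  shows "ennreal (\<theta>\<^sub>p - \<theta>) * nonlocal_energy m p \<theta> \<Omega> g \<le>
    ennreal (K_limsup * measure (\<Gamma> g) D + (\<theta>\<^sub>p - \<theta>) * K_far \<delta> g)"
proof -
  define s where "s = p * \<theta>"
  define t where "t = p * (\<theta>\<^sub>p - \<theta>)"
  have st: "1 \<le> s" "s \<le> \<beta>" "0 < t" "t \<le> 1" "\<beta> - s = t"
    using \<theta> p_pos by (auto simp: s_def t_def \<beta> algebra_simps)
  have \<Omega>b: "\<Omega> \<in> sets borel" using \<Omega> by simp
  have gm: "g \<in> borel_measurable borel" by (rule F_measurable[OF g])
  let ?c = "2 powr \<beta> * c"
  let ?G = "measure (\<Gamma> g) D"
  let ?L = "(c * 2 powr p * (1 + c) * overlap 2) * Lp_norm m p g powr p"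
  have near: "(\<Sum>k. ennreal (?c * (\<delta> / 2 ^ k) powr (- s)) * ks_energy m p (\<delta> / 2 ^ k) \<Omega> g)
      \<le> ennreal (?c * K_upper * ?G * (\<delta> powr t / (1 - 2 powr (- t))))"
  proof -
    have "ennreal (?c * (\<delta> / 2 ^ k) powr (- s)) * ks_energy m p (\<delta> / 2 ^ k) \<Omega> g \<le>
        ennreal (?c * K_upper * ?G) * ennreal ((\<delta> / 2 ^ k) powr t)" for k
    proof -
      let ?R = "\<delta> / 2 ^ k"
      have R: "0 < ?R" "?R \<le> \<delta>" using \<delta> by (auto simp: field_simps)
      have "ks_energy m p ?R \<Omega> g \<le> ennreal (K_upper * ?R powr \<beta>) * emeasure (\<Gamma> g) D"
      proof (rule ks_energy_le_Gamma[OF g \<Omega>b D(1) R(1)])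
        fix z assume "\<Omega> \<inter> ball z ?R \<noteq> {}"
        then obtain y where y: "y \<in> \<Omega>" "dist z y < ?R" by auto
        have "ball z (2 * A\<^sub>P * ?R) \<subseteq> ball y ((2 * A\<^sub>P + 1) * \<delta>)"
        proof
          fix w assume "w \<in> ball z (2 * A\<^sub>P * ?R)"
          hence "dist z w < 2 * A\<^sub>P * ?R" by simp
          also have "\<dots> \<le> 2 * A\<^sub>P * \<delta>" using R AP_ge by (intro mult_left_mono) auto
          finally have "dist y w < \<delta> + 2 * A\<^sub>P * \<delta>"
            using y R dist_triangle[of y w z] by (simp add: dist_commute)
          thus "w \<in> ball y ((2 * A\<^sub>P + 1) * \<delta>)" by (simp add: algebra_simps)
        qed
        thus "ball z (2 * A\<^sub>P * ?R) \<subseteq> D" using D(2) y(1) by blast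
      qed
      hence "ennreal (?c * ?R powr (- s)) * ks_energy m p ?R \<Omega> g \<le>
          ennreal (?c * ?R powr (- s)) * (ennreal (K_upper * ?R powr \<beta>) * emeasure (\<Gamma> g) D)"
        by (rule mult_left_mono) simp
      also have "\<dots> = ennreal (?c * K_upper * ?G * (?R powr (- s) * ?R powr \<beta>))"
        using c K_upper_nonneg unfolding Gamma_emeasure[OF g]
        by (simp add: ennreal_mult[symmetric] mult_ac)
      also have "?R powr (- s) * ?R powr \<beta> = ?R powr t"
        using st(5) by (simp add: powr_add[symmetric])
      also have "ennreal (?c * K_upper * ?G * ?R powr t) = ennreal (?c * K_upper * ?G) * ennreal (?R powr t)"
        using c K_upper_nonneg by (intro ennreal_mult) auto
      finally show ?thesis .
    qed
    hence "(\<Sum>k. ennreal (?c * (\<delta> / 2 ^ k) powr (- s)) * ks_energy m p (\<delta> / 2 ^ k) \<Omega> g) \<le>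
        (\<Sum>k. ennreal (?c * K_upper * ?G) * ennreal ((\<delta> / 2 ^ k) powr t))"
      by (intro suminf_le summableI)
    also have "\<dots> = ennreal (?c * K_upper * ?G) * ennreal (\<delta> powr t / (1 - 2 powr (- t)))"
      using dyadic_powr_sums[OF \<delta>(1) st(3)] by (simp add: ennreal_suminf_cmult)
    also have "\<dots> = ennreal (?c * K_upper * ?G * (\<delta> powr t / (1 - 2 powr (- t))))"
      using c K_upper_nonneg one_minus_powr_bounds(1)[OF st(3,4)] st(3)
      by (intro ennreal_mult[symmetric]) auto
    finally show ?thesis .
  qed
  have far: "(\<Sum>k. ennreal (?c * (\<delta> * 2 ^ Suc k) powr (- s)) * ks_energy m p (\<delta> * 2 ^ Suc k) \<Omega> g)
      \<le> ennreal (K_far \<delta> g)"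
  proof -
    have "ennreal (?c * (\<delta> * 2 ^ Suc k) powr (- s)) * ks_energy m p (\<delta> * 2 ^ Suc k) \<Omega> g \<le>
        ennreal (K_far \<delta> g) * ennreal ((1 / 2) ^ Suc k)" for k
    proof -
      let ?R = "\<delta> * 2 ^ Suc k"
      have R: "0 < ?R" using \<delta> by simp
      have "ks_energy m p ?R \<Omega> g \<le> ennreal (c * 2 powr p * (1 + c) * overlap 2) *
          (\<integral>\<^sup>+x. ennreal (\<bar>g x\<bar> powr p) \<partial>m)"
        by (rule ks_energy_le_Lp[OF gm \<Omega>b R p_pos])
      also have "\<dots> = ennreal ?L"
        using g F_Lp nn_integral_Lp[OF _ p_pos, of g m] c by (auto simp: ennreal_mult)
      finally have "ennreal (?c * ?R powr (- s)) * ks_energy m p ?R \<Omega> g \<le> ennreal (?c * ?R powr (- s)) * ennreal ?L"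
        by (rule mult_left_mono) simp
      also have "\<dots> = ennreal (?c * ?L * ?R powr (- s))"
        using c by (simp add: ennreal_mult[symmetric] mult_ac)
      \<comment> \<open>Convergence uniform in \<theta>: \<open>s \<ge> 1\<close> controls the power
        of two, and \<open>s \<le> \<beta>\<close> with \<open>\<delta> \<le> 1\<close> the power of
        \<delta>.\<close>
      also have "?R powr (- s) \<le> \<delta> powr (- \<beta>) * (1 / 2) ^ Suc k"
      proof -
        have "?R powr (- s) = \<delta> powr (- s) * (2 ^ Suc k) powr (- s)"
          using \<delta> by (simp add: powr_mult)
        also have "\<dots> \<le> \<delta> powr (- \<beta>) * (2 ^ Suc k) powr (- 1)"
        proof (rule mult_mono)
          show "\<delta> powr (- s) \<le> \<delta> powr (- \<beta>)" using \<delta> st by (intro powr_mono') auto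
          show "(2 ^ Suc k :: real) powr (- s) \<le> (2 ^ Suc k) powr (- 1)"
            using st by (intro powr_mono) (auto simp del: power_Suc)
        qed auto
        also have "(2 ^ Suc k :: real) powr (- 1) = (1 / 2) ^ Suc k"
          by (simp add: powr_minus power_one_over field_simps)
        finally show ?thesis .
      qed
      hence "ennreal (?c * ?L * ?R powr (- s)) \<le> ennreal (?c * ?L * (\<delta> powr (- \<beta>) * (1 / 2) ^ Suc k))"
        using c by (intro ennreal_leI mult_left_mono) auto
      also have "\<dots> = ennreal (K_far \<delta> g) * ennreal ((1 / 2) ^ Suc k)"
        using c by (subst ennreal_mult[symmetric]) (auto simp: K_far_def mult_ac)
      finally show ?thesis .
    qed
    hence "(\<Sum>k. ennreal (?c * (\<delta> * 2 ^ Suc k) powr (- s)) * ks_energy m p (\<delta> * 2 ^ Suc k) \<Omega> g) \<le>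
        (\<Sum>k. ennreal (K_far \<delta> g) * ennreal ((1 / 2) ^ Suc k))"
      by (intro suminf_le summableI)
    also have "\<dots> = ennreal (K_far \<delta> g) * (\<Sum>k. ennreal ((1 / 2) ^ Suc k))" by (rule ennreal_suminf_cmult)
    also have "(\<Sum>k. ennreal ((1 / 2) ^ Suc k)) = ennreal 1"
      by (rule suminf_ennreal_eq[OF _ power_half_series]) simp
    finally show ?thesis by simp
  qed
  have far0: "0 \<le> K_far \<delta> g" using c by (simp add: K_far_def)
  have near0: "0 \<le> ?c * K_upper * ?G * (\<delta> powr t / (1 - 2 powr (- t)))"
    using c K_upper_nonneg one_minus_powr_bounds(1)[OF st(3,4)] st(3) by simp
  have "nonlocal_energy m p \<theta> \<Omega> g \<le>
      ennreal (?c * K_upper * ?G * (\<delta> powr t / (1 - 2 powr (- t)))) + ennreal (K_far \<delta> g)"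
    using nonlocal_energy_le_dyadic[OF gm \<Omega>b _ _ \<delta>(1), of \<theta>] st(1,2) add_mono[OF near far]
    unfolding s_def by (force intro: order_trans)
  hence "ennreal (\<theta>\<^sub>p - \<theta>) * nonlocal_energy m p \<theta> \<Omega> g \<le> ennreal (\<theta>\<^sub>p - \<theta>) *
      (ennreal (?c * K_upper * ?G * (\<delta> powr t / (1 - 2 powr (- t)))) + ennreal (K_far \<delta> g))"
    by (rule mult_left_mono) simp
  also have "\<dots> = ennreal (?c * K_upper * ?G * ((\<theta>\<^sub>p - \<theta>) * (\<delta> powr t / (1 - 2 powr (- t)))) + (\<theta>\<^sub>p - \<theta>) * K_far \<delta> g)"
    using far0 near0 \<theta>(2) by (simp add: ennreal_plus[symmetric] ennreal_mult[symmetric] algebra_simps del: ennreal_plus)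
  also have "\<dots> \<le> ennreal (?c * K_upper * ?G * 2 + (\<theta>\<^sub>p - \<theta>) * K_far \<delta> g)"
  proof (intro ennreal_leI add_right_mono mult_left_mono)
    have "\<delta> powr t \<le> 1" using \<delta> st(3) powr_mono2[of t \<delta> 1] by simp
    hence "\<delta> powr t / (1 - 2 powr (- t)) \<le> 1 / (t / 2)"
      using one_minus_powr_bounds(1)[OF st(3,4)] st(3) by (intro frac_le) auto
    hence "(\<theta>\<^sub>p - \<theta>) * (\<delta> powr t / (1 - 2 powr (- t))) \<le> (\<theta>\<^sub>p - \<theta>) * (1 / (t / 2))"
      using \<theta>(2) by (intro mult_left_mono) auto
    also have "\<dots> = 2 / p" 
    proof -
      have "x * (1 / (p * x / 2)) = 2 / p" if "0 < x" for x using that p_pos by (simp add: field_simps)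
      from this[of "\<theta>\<^sub>p - \<theta>"] show ?thesis using \<theta>(2) by (simp only: t_def diff_gt_0_iff_gt)
    qed
    also have "\<dots> \<le> 2" using p_gt_1 by (simp add: field_simps)
    finally show "(\<theta>\<^sub>p - \<theta>) * (\<delta> powr t / (1 - 2 powr (- t))) \<le> 2" .
  qed (use c K_upper_nonneg in auto)
  finally show ?thesis by (simp add: K_limsup_def mult_ac)
qed

text \<open>As \<open>1 / p < 1 \<le> \<theta>\<^sub>p\<close>, the exponent
  \<open>p * \<theta>\<close> is at least \<open>1\<close> close to the limit, which the dyadic sums
  require.\<close>

lemma eventually_at_left_admissible:
  assumes "1 \<le> \<theta>\<^sub>p"
  shows "eventually (\<lambda>\<theta>. 1 \<le> p * \<theta> \<and> \<theta> < \<theta>\<^sub>p \<and> p * (\<theta>\<^sub>p - \<theta>) \<le> 1) (at_left \<theta>\<^sub>p)"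
proof -
  have "1 / p < 1" "0 < 1 / p" using p_gt_1 by simp_all
  hence "max (1 / p) (\<theta>\<^sub>p - 1 / p) < \<theta>\<^sub>p" using assms unfolding max_less_iff_conj by linarith
  hence "eventually (\<lambda>\<theta>. \<theta> \<in> {max (1 / p) (\<theta>\<^sub>p - 1 / p)<..<\<theta>\<^sub>p}) (at_left \<theta>\<^sub>p)"
    by (rule eventually_at_left_real)
  thus ?thesis
  proof eventually_elim
    case (elim \<theta>)
    thus ?case using p_pos by (auto simp: field_simps)
  qed
qed

text \<open>The neighbourhoods \<open>D n\<close> decrease to the closure of \<Omega>, whose energy
  is that of \<Omega> itself since the frontier is null.\<close>

lemma limsup_nonlocal_energy_le:
  assumes g: "g \<in> F" and \<Omega>: "open \<Omega>" and \<beta>: "\<beta> = p * \<theta>\<^sub>p" and \<theta>p: "1 \<le> \<theta>\<^sub>p"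
    and bd: "emeasure (\<Gamma> g) (frontier \<Omega>) = 0"
  shows "Limsup (at_left \<theta>\<^sub>p) (\<lambda>\<theta>. ennreal (\<theta>\<^sub>p - \<theta>) * nonlocal_energy m p \<theta> \<Omega> g)
    \<le> ennreal (K_limsup * measure (\<Gamma> g) \<Omega>)"
proof (rule ennreal_le_epsilon)
  fix e :: real assume e: "0 < e"
  define a where "a = 2 * A\<^sub>P + 1"
  have a: "0 < a" using AP_ge by (simp add: a_def)
  define D where "D n = (\<Union>y\<in>\<Omega>. ball y (a * inverse (real (Suc n))))" for n
  have D: "open (D n)" for n by (auto simp: D_def)
  interpret finite_measure "\<Gamma> g" by (rule Gamma_finite[OF g])
  have sets: "sets (\<Gamma> g) = sets borel" by (rule Gamma_borel[OF g])
  have "decseq D"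
  proof (rule decseq_SucI)
    fix n
    have "a * inverse (real (Suc (Suc n))) \<le> a * inverse (real (Suc n))"
      using a by (intro mult_left_mono) (auto simp: field_simps)
    hence "ball y (a * inverse (real (Suc (Suc n)))) \<subseteq> ball y (a * inverse (real (Suc n)))" for y :: 'a
      by (rule subset_ball)
    thus "D (Suc n) \<subseteq> D n" unfolding D_def by blast
  qed
  moreover have "(\<Inter>n. D n) = closure \<Omega>"
  proof (rule set_eqI)
    fix x
    show "x \<in> (\<Inter>n. D n) \<longleftrightarrow> x \<in> closure \<Omega>"
    proof
      assume x: "x \<in> (\<Inter>n. D n)"
      show "x \<in> closure \<Omega>"
        unfolding closure_approachable
      proof (intro allI impI)
        fix r :: real assume "0 < r"
        then obtain n where "inverse (real (Suc n)) < r / a" using a reals_Archimedean[of "r / a"] by auto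
        hence n: "a * inverse (real (Suc n)) < r" using a by (simp only: pos_less_divide_eq mult.commute)
        obtain y where "y \<in> \<Omega>" "dist y x < a * inverse (real (Suc n))" using x unfolding D_def by auto
        thus "\<exists>y\<in>\<Omega>. dist y x < r" using n by (meson less_trans)
      qed
    next
      assume x: "x \<in> closure \<Omega>"
      have "x \<in> D n" for n
      proof -
        have "0 < a * inverse (real (Suc n))" using a by simp
        then obtain y where "y \<in> \<Omega>" "dist y x < a * inverse (real (Suc n))"
          using x unfolding closure_approachable by blast
        thus ?thesis unfolding D_def by auto
      qed
      thus "x \<in> (\<Inter>n. D n)" by blast
    qed
  qed
  ultimately have "(\<lambda>n. measure (\<Gamma> g) (D n)) \<longlonglongrightarrow> measure (\<Gamma> g) (closure \<Omega>)"
    using finite_Lim_measure_decseq[of D] sets by (auto intro!: borel_open D)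
  moreover have "measure (\<Gamma> g) (closure \<Omega>) = measure (\<Gamma> g) \<Omega>"
  proof -
    have "closure \<Omega> = \<Omega> \<union> frontier \<Omega>" using \<Omega> closure_Un_frontier by metis
    hence "measure (\<Gamma> g) (closure \<Omega>) \<le> measure (\<Gamma> g) \<Omega> + measure (\<Gamma> g) (frontier \<Omega>)"
      using \<Omega> sets measure_Un_le[of \<Omega> "\<Gamma> g" "frontier \<Omega>"] by (simp add: frontier_closed)
    moreover have "measure (\<Gamma> g) \<Omega> \<le> measure (\<Gamma> g) (closure \<Omega>)"
      using \<Omega> sets by (intro finite_measure_mono closure_subset) auto
    moreover have "measure (\<Gamma> g) (frontier \<Omega>) = 0" using bd by (simp add: measure_def)
    ultimately show ?thesis by linarith
  qed
  ultimately have "(\<lambda>n. K_limsup * measure (\<Gamma> g) (D n)) \<longlonglongrightarrow> K_limsup * measure (\<Gamma> g) \<Omega>"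
    by (intro tendsto_mult_left) simp
  hence "eventually (\<lambda>n. K_limsup * measure (\<Gamma> g) (D n) < K_limsup * measure (\<Gamma> g) \<Omega> + e / 2) sequentially"
    using e by (intro order_tendstoD(2)) auto
  \<comment> \<open>The neighbourhood, and with it \<delta>, is fixed before \<theta> tends to its
    limit, because \<open>K_far\<close> may blow up as \<delta> shrinks.\<close>
  then obtain n where n: "K_limsup * measure (\<Gamma> g) (D n) < K_limsup * measure (\<Gamma> g) \<Omega> + e / 2"
    unfolding eventually_sequentially by blast
  define \<delta> where "\<delta> = inverse (real (Suc n))"
  have \<delta>: "0 < \<delta>" "\<delta> \<le> 1" by (auto simp: \<delta>_def field_simps)
  have "((\<lambda>\<theta>. (\<theta>\<^sub>p - \<theta>) * K_far \<delta> g) \<longlongrightarrow> (\<theta>\<^sub>p - \<theta>\<^sub>p) * K_far \<delta> g) (at_left \<theta>\<^sub>p)"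
    by (intro tendsto_intros)
  hence "eventually (\<lambda>\<theta>. (\<theta>\<^sub>p - \<theta>) * K_far \<delta> g < e / 2) (at_left \<theta>\<^sub>p)"
    using e by (intro order_tendstoD(2)) auto
  with eventually_at_left_admissible[OF \<theta>p]
  have "eventually (\<lambda>\<theta>. ennreal (\<theta>\<^sub>p - \<theta>) * nonlocal_energy m p \<theta> \<Omega> g \<le>
      ennreal (K_limsup * measure (\<Gamma> g) \<Omega> + e)) (at_left \<theta>\<^sub>p)"
  proof eventually_elim
    case (elim \<theta>)
    have "ennreal (\<theta>\<^sub>p - \<theta>) * nonlocal_energy m p \<theta> \<Omega> g \<le>
        ennreal (K_limsup * measure (\<Gamma> g) (D n) + (\<theta>\<^sub>p - \<theta>) * K_far \<delta> g)"
      by (rule nonlocal_energy_upper[OF g \<Omega> \<beta> \<delta>]) (use elim D in \<open>auto simp: D_def a_def \<delta>_def\<close>)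
    also have "\<dots> \<le> ennreal (K_limsup * measure (\<Gamma> g) \<Omega> + e)"
      using elim n by (intro ennreal_leI) linarith
    finally show ?case .
  qed
  hence "Limsup (at_left \<theta>\<^sub>p) (\<lambda>\<theta>. ennreal (\<theta>\<^sub>p - \<theta>) * nonlocal_energy m p \<theta> \<Omega> g) \<le>
      ennreal (K_limsup * measure (\<Gamma> g) \<Omega> + e)"
    by (rule Limsup_bounded)
  thus "Limsup (at_left \<theta>\<^sub>p) (\<lambda>\<theta>. ennreal (\<theta>\<^sub>p - \<theta>) * nonlocal_energy m p \<theta> \<Omega> g) \<le>
      ennreal (K_limsup * measure (\<Gamma> g) \<Omega>) + ennreal e"
    using e K_limsup_nonneg by simp
qed

text \<open>The geometric sum is at least \<open>\<delta> powr t / t\<close>, so the normalising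
  factor leaves \<open>1 / p\<close>; the other factor \<open>1 / 2\<close> comes from the
  multiplicity in \<open>nonlocal_energy_ge_dyadic\<close>.\<close>

lemma nonlocal_energy_lower:
  assumes g: "g \<in> F" and \<Omega>: "open \<Omega>" and \<beta>: "\<beta> = p * \<theta>\<^sub>p" and \<delta>: "0 < \<delta>" "\<delta> \<le> 1" and L: "0 \<le> L"
    and \<theta>: "1 \<le> p * \<theta>" "\<theta> < \<theta>\<^sub>p" "p * (\<theta>\<^sub>p - \<theta>) \<le> 1"
    and ks: "\<And>r. 0 < r \<Longrightarrow> r \<le> \<delta> \<Longrightarrow> ennreal (L * r powr \<beta>) \<le> ks_energy m p r \<Omega> g"
  shows "ennreal (L * \<delta> powr (p * (\<theta>\<^sub>p - \<theta>)) / (2 * p)) \<le> ennreal (\<theta>\<^sub>p - \<theta>) * nonlocal_energy m p \<theta> \<Omega> g"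
proof -
  define s where "s = p * \<theta>"
  define t where "t = p * (\<theta>\<^sub>p - \<theta>)"
  have st: "1 \<le> s" "0 < t" "t \<le> 1" "\<beta> - s = t"
    using \<theta> p_pos by (auto simp: s_def t_def \<beta> algebra_simps)
  have \<Omega>b: "\<Omega> \<in> sets borel" using \<Omega> by simp
  have gm: "g \<in> borel_measurable borel" by (rule F_measurable[OF g])
  have "ennreal L * ennreal ((\<delta> / 2 ^ k) powr t) \<le>
      ennreal ((\<delta> / 2 ^ k) powr (- s)) * ks_energy m p (\<delta> / 2 ^ k) \<Omega> g" for k
  proof -
    let ?R = "\<delta> / 2 ^ k"
    have R: "0 < ?R" "?R \<le> \<delta>" using \<delta> by (auto simp: field_simps)
    have "?R powr t = ?R powr (- s) * ?R powr \<beta>" using st(4) by (simp add: powr_add[symmetric])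
    hence "ennreal L * ennreal (?R powr t) = ennreal (?R powr (- s)) * ennreal (L * ?R powr \<beta>)"
      using L by (simp add: ennreal_mult[symmetric] mult_ac)
    also have "\<dots> \<le> ennreal (?R powr (- s)) * ks_energy m p ?R \<Omega> g"
      by (intro mult_left_mono ks R) simp
    finally show ?thesis .
  qed
  hence "(\<Sum>k. ennreal L * ennreal ((\<delta> / 2 ^ k) powr t)) \<le>
      (\<Sum>k. ennreal ((\<delta> / 2 ^ k) powr (- s)) * ks_energy m p (\<delta> / 2 ^ k) \<Omega> g)"
    by (intro suminf_le summableI)
  also have "\<dots> \<le> 2 * nonlocal_energy m p \<theta> \<Omega> g"
    unfolding s_def by (rule nonlocal_energy_ge_dyadic[OF gm \<Omega>b \<theta>(1) \<delta>(1)])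
  also have "(\<Sum>k. ennreal L * ennreal ((\<delta> / 2 ^ k) powr t)) = ennreal L * ennreal (\<delta> powr t / (1 - 2 powr (- t)))"
    using dyadic_powr_sums[OF \<delta>(1) st(2)] by (simp add: ennreal_suminf_cmult)
  finally have main: "ennreal L * ennreal (\<delta> powr t / (1 - 2 powr (- t))) \<le> 2 * nonlocal_energy m p \<theta> \<Omega> g" .
  have "L * \<delta> powr t / (2 * p) = ((\<theta>\<^sub>p - \<theta>) / 2) * (L * (\<delta> powr t / t))"
    using \<theta>(2) p_pos by (simp add: t_def field_simps)
  also have "\<dots> \<le> ((\<theta>\<^sub>p - \<theta>) / 2) * (L * (\<delta> powr t / (1 - 2 powr (- t))))"
    using one_minus_powr_bounds[OF st(2,3)] st(2) L \<theta>(2)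
    by (intro mult_left_mono divide_left_mono) auto
  finally have "ennreal (L * \<delta> powr t / (2 * p)) \<le> ennreal ((\<theta>\<^sub>p - \<theta>) / 2) * (ennreal L * ennreal (\<delta> powr t / (1 - 2 powr (- t))))"
    using one_minus_powr_bounds[OF st(2,3)] st(2) L \<theta>(2)
    by (simp add: ennreal_mult[symmetric] ennreal_leI)
  also have "\<dots> \<le> ennreal ((\<theta>\<^sub>p - \<theta>) / 2) * (2 * nonlocal_energy m p \<theta> \<Omega> g)"
    by (intro mult_left_mono main) simp
  also have "\<dots> = ennreal (\<theta>\<^sub>p - \<theta>) * nonlocal_energy m p \<theta> \<Omega> g"
  proof -
    have "ennreal ((\<theta>\<^sub>p - \<theta>) / 2) * 2 = ennreal (\<theta>\<^sub>p - \<theta>)"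
    proof -
      have "ennreal (x / 2) * 2 = ennreal x" if "0 < x" for x
        using that ennreal_mult[of "x / 2" 2] by simp
      from this[of "\<theta>\<^sub>p - \<theta>"] show ?thesis using \<theta>(2) by (simp only: diff_gt_0_iff_gt)
    qed
    thus ?thesis by (simp add: mult.assoc[symmetric])
  qed
  finally show ?thesis unfolding t_def .
qed

text \<open>Of the factor \<open>8\<close>, one \<open>2\<close> lies in the choice of
  \<open>L\<close>, one in bounding the power of \<delta> below by \<open>1 / 2\<close>, and one in
  \<open>nonlocal_energy_lower\<close>.\<close>

lemma liminf_nonlocal_energy_ge:
  assumes g: "g \<in> F" and \<Omega>: "open \<Omega>" and \<beta>: "\<beta> = p * \<theta>\<^sub>p" and \<theta>p: "1 \<le> \<theta>\<^sub>p"
  shows "ennreal (measure (\<Gamma> g) \<Omega> / (8 * p * (K_low + 1)))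
    \<le> Liminf (at_left \<theta>\<^sub>p) (\<lambda>\<theta>. ennreal (\<theta>\<^sub>p - \<theta>) * nonlocal_energy m p \<theta> \<Omega> g)"
proof (cases "measure (\<Gamma> g) \<Omega> = 0")
  case False
  define G where "G = measure (\<Gamma> g) \<Omega>"
  have G: "0 < G" using False by (simp add: G_def zero_less_measure_iff)
  have K: "0 \<le> K_low" using K_lsc_nonneg by (simp add: K_low_def)
  \<comment> \<open>Half of \<open>G / (K_low + 1)\<close>, so that \<open>K_low * L < G\<close> is
    strict; the added \<open>1\<close> avoids division by zero.\<close>
  define L where "L = G / (2 * (K_low + 1))"
  have L: "0 \<le> L" using G K by (simp add: L_def)
  have "K_low * L < G"
  proof -
    have "K_low * L \<le> (K_low + 1) * L" using L by (intro mult_right_mono) auto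
    also have "\<dots> = G / 2"
    proof -
      have "x * (G / (2 * x)) = G / 2" if "0 < x" for x using that by (simp add: field_simps)
      from this[of "K_low + 1"] show ?thesis using K by (simp only: L_def)
    qed
    finally show ?thesis using G by simp
  qed
  from ks_energy_eventually_gt[OF g \<Omega> L this[unfolded G_def]]
  obtain b where b: "0 < b" "\<And>r. 0 < r \<Longrightarrow> r < b \<Longrightarrow> ennreal (L * r powr \<beta>) < ks_energy m p r \<Omega> g"
    unfolding eventually_at_right_field by blast
  define \<delta> where "\<delta> = min 1 (b / 2)"
  have \<delta>: "0 < \<delta>" "\<delta> \<le> 1" "\<delta> < b" using b(1) by (auto simp: \<delta>_def min_def)
  have "((\<lambda>\<theta>. \<delta> powr (p * (\<theta>\<^sub>p - \<theta>))) \<longlongrightarrow> \<delta> powr (p * (\<theta>\<^sub>p - \<theta>\<^sub>p))) (at_left \<theta>\<^sub>p)"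
    using \<delta>(1) by (intro tendsto_intros) auto
  hence "eventually (\<lambda>\<theta>. 1 / 2 < \<delta> powr (p * (\<theta>\<^sub>p - \<theta>))) (at_left \<theta>\<^sub>p)"
    using \<delta>(1) by (intro order_tendstoD(1)) auto
  with eventually_at_left_admissible[OF \<theta>p]
  have "eventually (\<lambda>\<theta>. ennreal (G / (8 * p * (K_low + 1))) \<le> ennreal (\<theta>\<^sub>p - \<theta>) * nonlocal_energy m p \<theta> \<Omega> g)
      (at_left \<theta>\<^sub>p)"
  proof eventually_elim
    case (elim \<theta>)
    have "G / (8 * p * (K_low + 1)) = L * (1 / 2) / (2 * p)" using K p_pos by (simp add: L_def)
    also have "\<dots> \<le> L * \<delta> powr (p * (\<theta>\<^sub>p - \<theta>)) / (2 * p)"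
      using elim L p_pos by (intro divide_right_mono mult_left_mono) auto
    finally have "ennreal (G / (8 * p * (K_low + 1))) \<le> ennreal (L * \<delta> powr (p * (\<theta>\<^sub>p - \<theta>)) / (2 * p))"
      by (rule ennreal_leI)
    also have "\<dots> \<le> ennreal (\<theta>\<^sub>p - \<theta>) * nonlocal_energy m p \<theta> \<Omega> g"
    proof (rule nonlocal_energy_lower[OF g \<Omega> \<beta> \<delta>(1,2) L])
      show "ennreal (L * r powr \<beta>) \<le> ks_energy m p r \<Omega> g" if "0 < r" "r \<le> \<delta>" for r
        using b(2)[of r] that \<delta>(3) by (simp add: less_imp_le)
    qed (use elim in auto)
    finally show ?case .
  qed
  thus ?thesis unfolding G_def by (rule Liminf_bounded)
qed simp

end

theorem corollary1p13:
  fixes m :: "'a::polish_space measure"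
    and p \<theta>\<^sub>p :: real
    and F :: "('a \<Rightarrow> real) set"
    and \<E> :: "('a \<Rightarrow> real) \<Rightarrow> real"
    and \<Gamma> :: "('a \<Rightarrow> real) \<Rightarrow> 'a measure"
  assumes "p_energy_space m p F \<E> \<Gamma>"
    and "1 \<le> \<theta>\<^sub>p"
    and "volume_doubling m"
    and "poincare_ineq m p F \<Gamma> (p * \<theta>\<^sub>p)"
    and "capacity_upper m F \<E> (p * \<theta>\<^sub>p)"
  shows "\<exists>C::real. 1 \<le> C \<and>
    (\<forall>\<Omega>. open \<Omega> \<and> \<Omega> \<noteq> UNIV \<and> extension_property m p F \<Gamma> \<Omega> \<longrightarrow>
      (\<forall>u \<in> F_on m p F \<Gamma> \<Omega>.
         ennreal (1 / C) * emeasure (Gamma_loc m F \<Gamma> \<Omega> u) \<Omega>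
           \<le> Liminf (at_left \<theta>\<^sub>p) (\<lambda>\<theta>. ennreal (\<theta>\<^sub>p - \<theta>) * nonlocal_energy m p \<theta> \<Omega> u) \<and>
         Liminf (at_left \<theta>\<^sub>p) (\<lambda>\<theta>. ennreal (\<theta>\<^sub>p - \<theta>) * nonlocal_energy m p \<theta> \<Omega> u)
           \<le> Limsup (at_left \<theta>\<^sub>p) (\<lambda>\<theta>. ennreal (\<theta>\<^sub>p - \<theta>) * nonlocal_energy m p \<theta> \<Omega> u) \<and>
         Limsup (at_left \<theta>\<^sub>p) (\<lambda>\<theta>. ennreal (\<theta>\<^sub>p - \<theta>) * nonlocal_energy m p \<theta> \<Omega> u)
           \<le> ennreal C * emeasure (Gamma_loc m F \<Gamma> \<Omega> u) \<Omega>))"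
proof -
  interpret p_energy_space m p F \<E> \<Gamma> by fact
  let ?\<beta> = "p * \<theta>\<^sub>p"
  obtain c where c: "doubling_space m c" using doubling_space_of_volume_doubling[OF assms(3)] by blast
  interpret doubling_space m c by (rule c)
  obtain CP AP where CP: "0 < CP" "1 \<le> AP"
    and PI: "\<And>x r u. u \<in> F \<Longrightarrow> 0 < r \<Longrightarrow>
      (\<integral>\<^sup>+y\<in>ball x r. ennreal (\<bar>u y - mean_value m (ball x r) u\<bar> powr p) \<partial>m)
          \<le> ennreal (CP * r powr ?\<beta>) * emeasure (\<Gamma> u) (ball x (AP * r))"
    using assms(4) unfolding poincare_ineq_def by blast
  obtain CC A1 A2 where CC: "1 < CC" "1 < A1" "1 < A2"
    and cap: "\<And>x R. 0 < R \<Longrightarrow> ennreal R < ediameter (UNIV :: 'a set) / ennreal A2 \<Longrightarrow>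
        (INF u\<in>{u\<in>F. (AE y in m. y \<in> ball x R \<longrightarrow> u y = 1) \<and>
                      (AE y in m. y \<notin> ball x (A1 * R) \<longrightarrow> u y = 0)}. ennreal (\<E> u))
          \<le> ennreal CC * emeasure m (ball x R) / ennreal (R powr ?\<beta>)"
    using assms(5) unfolding capacity_upper_def by blast
  obtain a b :: 'a where ab: "a \<noteq> b" using two_points by blast
  \<comment> \<open>Two distinct points bound the diameter below by a positive real number, also
    when the diameter is infinite.\<close>
  define R0 where "R0 = dist a b / A2"
  have diam: "ennreal R < ediameter (UNIV :: 'a set) / ennreal A2" if "0 < R" "R < R0" for R
  proof -
    have "ennreal R < ennreal (dist a b / A2)"
      using that by (intro ennreal_lessI) (auto simp: R0_def)
    also have "\<dots> = ennreal (dist a b) / ennreal A2" using CC by (simp add: divide_ennreal)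
    also have "\<dots> \<le> ediameter (UNIV :: 'a set) / ennreal A2"
      unfolding ediameter_def
      by (intro divide_right_mono_ennreal SUP_upper2[of a] SUP_upper2[of b]) auto
    finally show ?thesis .
  qed
  interpret energy_poincare m p F \<E> \<Gamma> c ?\<beta> CP AP "2 * CC" A1 R0
  proof unfold_locales
    show "0 < ?\<beta>" using p_gt_1 assms(2) by simp
    show "0 < R0" using ab CC by (simp add: R0_def)
    show "(\<integral>\<^sup>+y\<in>ball x r. ennreal (\<bar>u y - mean_value m (ball x r) u\<bar> powr p) \<partial>m)
        \<le> ennreal (CP * r powr ?\<beta>) * emeasure (\<Gamma> u) (ball x (AP * r))" if "u \<in> F" "0 < r" for u r x
      by (rule PI[OF that])
    fix R x assume R: "0 < R" "R < R0"
    have v: "0 < vol x R" by (rule vol_pos[OF R(1)])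
    let ?S = "{u\<in>F. (AE y in m. y \<in> ball x R \<longrightarrow> u y = 1) \<and> (AE y in m. y \<notin> ball x (A1 * R) \<longrightarrow> u y = 0)}"
    have "(INF u\<in>?S. ennreal (\<E> u)) \<le> ennreal (CC * vol x R / R powr ?\<beta>)"
      using cap[OF R(1) diam[OF R], of x] R CC v
      by (simp add: emeasure_ball divide_ennreal ennreal_mult[symmetric])
    \<comment> \<open>The bound is positive, so doubling it is strict and some competitor lies below
      it even if the infimum is not attained.\<close>
    also have "\<dots> < ennreal (2 * CC * vol x R / R powr ?\<beta>)"
      using R CC v by (intro ennreal_lessI divide_strict_right_mono) auto
    finally obtain u where "u \<in> ?S" "ennreal (\<E> u) < ennreal (2 * CC * vol x R / R powr ?\<beta>)"
      unfolding INF_less_iff by blast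
    thus "\<exists>u\<in>F. (AE y in m. y \<in> ball x R \<longrightarrow> u y = 1) \<and> (AE y in m. y \<notin> ball x (A1 * R) \<longrightarrow> u y = 0)
        \<and> \<E> u \<le> 2 * CC * vol x R / R powr ?\<beta>"
      using v CC by (intro bexI[of _ u]) (auto simp: ennreal_less_iff E_nonneg)
  qed (use CP CC in auto)
  \<comment> \<open>Fixed before \<Omega> and \<open>u\<close>: all entries are built from the
    constants of the interpreted locale.\<close>
  define C where "C = max 1 (max K_limsup (8 * p * (K_low + 1)))"
  show ?thesis
  proof (intro exI[of _ C] conjI allI impI ballI)
    show "1 \<le> C" by (simp add: C_def)
    fix \<Omega> u
    assume h: "open \<Omega> \<and> \<Omega> \<noteq> UNIV \<and> extension_property m p F \<Gamma> \<Omega>" and u: "u \<in> F_on m p F \<Gamma> \<Omega>"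
    obtain g where g: "g \<in> F" "AE x in m. x \<in> \<Omega> \<longrightarrow> u x = g x" "emeasure (\<Gamma> g) (frontier \<Omega>) = 0"
      using h u unfolding extension_property_def by blast
    have \<Omega>: "open \<Omega>" using h by simp
    \<comment> \<open>The local energy and the nonlocal energies do not distinguish \<open>u\<close>
      from its extension \<open>g\<close>, so both limit bounds for \<open>g\<close> apply.\<close>
    have loc: "emeasure (Gamma_loc m F \<Gamma> \<Omega> u) \<Omega> = ennreal (measure (\<Gamma> g) \<Omega>)"
      using Gamma_loc_eq[OF g(1) \<Omega> g(2)] Gamma_emeasure[OF g(1)] by simp
    have nl: "nonlocal_energy m p \<theta> \<Omega> u = nonlocal_energy m p \<theta> \<Omega> g" for \<theta>
      by (rule nonlocal_energy_cong[OF g(2)])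
    have K: "0 \<le> K_low" using K_lsc_nonneg by (simp add: K_low_def)
    have "ennreal (1 / C) * ennreal (measure (\<Gamma> g) \<Omega>) = ennreal (measure (\<Gamma> g) \<Omega> / C)"
      by (subst ennreal_mult[symmetric]) (auto simp: C_def)
    also have "\<dots> \<le> ennreal (measure (\<Gamma> g) \<Omega> / (8 * p * (K_low + 1)))"
      using K p_pos by (intro ennreal_leI divide_left_mono) (auto simp: C_def)
    also have "\<dots> \<le> Liminf (at_left \<theta>\<^sub>p) (\<lambda>\<theta>. ennreal (\<theta>\<^sub>p - \<theta>) * nonlocal_energy m p \<theta> \<Omega> g)"
      by (rule liminf_nonlocal_energy_ge[OF g(1) \<Omega> refl assms(2)])
    finally show "ennreal (1 / C) * emeasure (Gamma_loc m F \<Gamma> \<Omega> u) \<Omega>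
        \<le> Liminf (at_left \<theta>\<^sub>p) (\<lambda>\<theta>. ennreal (\<theta>\<^sub>p - \<theta>) * nonlocal_energy m p \<theta> \<Omega> u)"
      unfolding loc nl .
    show "Liminf (at_left \<theta>\<^sub>p) (\<lambda>\<theta>. ennreal (\<theta>\<^sub>p - \<theta>) * nonlocal_energy m p \<theta> \<Omega> u)
        \<le> Limsup (at_left \<theta>\<^sub>p) (\<lambda>\<theta>. ennreal (\<theta>\<^sub>p - \<theta>) * nonlocal_energy m p \<theta> \<Omega> u)"
      by (rule Liminf_le_Limsup) (simp add: trivial_limit_at_left_real)
    have "Limsup (at_left \<theta>\<^sub>p) (\<lambda>\<theta>. ennreal (\<theta>\<^sub>p - \<theta>) * nonlocal_energy m p \<theta> \<Omega> g)
        \<le> ennreal (K_limsup * measure (\<Gamma> g) \<Omega>)"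
      by (rule limsup_nonlocal_energy_le[OF g(1) \<Omega> refl assms(2) g(3)])
    also have "\<dots> \<le> ennreal (C * measure (\<Gamma> g) \<Omega>)"
      by (intro ennreal_leI mult_right_mono) (auto simp: C_def)
    also have "\<dots> = ennreal C * ennreal (measure (\<Gamma> g) \<Omega>)"
      by (rule ennreal_mult) (auto simp: C_def)
    finally show "Limsup (at_left \<theta>\<^sub>p) (\<lambda>\<theta>. ennreal (\<theta>\<^sub>p - \<theta>) * nonlocal_energy m p \<theta> \<Omega> u)
        \<le> ennreal C * emeasure (Gamma_loc m F \<Gamma> \<Omega> u) \<Omega>"
      unfolding loc nl .
  qed
qed

end
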